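(* Let $\mathcal H=\mathcal H_1\oplus\mathcal H_0\oplus\mathcal H_{-1}$ be Hilbert spaces, and let $T=(T_1,\ldots,T_n)$ be a (not necessarily commuting) row contraction on $\mathcal H$ such that with respect to this decomposition $$T_i=\begin{bmatrix}S_i&*&*\\0&N_i&*\\0&0&C_i\end{bmatrix}\qquad(i=1,\ldots,n).$$ Then $S=(S_i)$, $N=(N_i)$ and $C=(C_i)$ are row contractions on $\mathcal H_1$, $\mathcal H_0$ and $\mathcal H_{-1}$, respectively, and there exist Hilbert spaces $\mathcal E_1,\mathcal E_2,\mathcal E$ and unitary operators $$\tau_1\in\mathcal B(\mathcal D_{N^*}\oplus\mathcal E,\ \mathcal D_C\oplus\mathcal E_1),\qquad \tau_2\in\mathcal B(\mathcal D_{S^*}\oplus\mathcal E_2,\ \mathcal D_N\oplus\mathcal E)$$ such that the characteristic function $\Theta_T$ coincides with $$\begin{bmatrix}\Theta_C&0\\0&I_{\Gamma\otimes\mathcal E_1}\end{bmatrix}(I_\Gamma\otimes\tau_1)\begin{bmatrix}\Theta_N&0\\0&I_{\Gamma\otimes\mathcal E}\end{bmatrix}(I_\Gamma\otimes\tau_2)\begin{bmatrix}\Theta_S&0\\0&I_{\Gamma\otimes\mathcal E_2}\end{bmatrix}.$$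
   Context: $\Gamma=\bigoplus_{m\ge0}(\mathbb C^n)^{\otimes m}$ is the full Fock space, with vacuum vector $e_\emptyset$. With $e_1,\ldots,e_n$ the standard basis of $\mathbb C^n$, the left and right creation operators on $\Gamma$ are $L_jf=e_j\otimes f$ and $R_jf=f\otimes e_j$. An operator $M\in\mathcal B(\Gamma\otimes\mathcal E,\Gamma\otimes\mathcal E_* )$ is multi-analytic if $M(L_i\otimes I_{\mathcal E})=(L_i\otimes I_{\mathcal E_*})M$ for all $i$. Multi-analytic operators $M\in\mathcal B(\Gamma\otimes\mathcal E,\Gamma\otimes\mathcal E_* )$ and $M'\in\mathcal B(\Gamma\otimes\mathcal E',\Gamma\otimes\mathcal E'_* )$ coincide if there are unitaries $W:\mathcal E\to\mathcal E'$ and $W_*:\mathcal E_*\to\mathcal E_*'$ with $(I_\Gamma\otimes W_* )M=M'(I_\Gamma\otimes W)$. A row contraction on $\mathcal H$ is an $n$-tuple $T=(T_1,\ldots,T_n)$ of bounded operators with $\sum_iT_iT_i^*\le I$; $T$ also denotes the row operator $\mathcal H^n\to\mathcal H$. Defect operators: $D_T=(I-T^*T)^{1/2}$ on $\mathcal H^n$, $D_{T^*}=(I-TT^* )^{1/2}$ on $\mathcal H$; $\mathcal D_T=\overline{\mathrm{ran}}\,D_T$, $\mathcal D_{T^*}=\overline{\mathrm{ran}}\,D_{T^*}$. The characteristic function of $T$ is the multi-analytic operator $\Theta_T\in\mathcal B(\Gamma\otimes\mathcal D_T,\Gamma\otimes\mathcal D_{T^*})$ given by the strong operator limit $$\Theta_T=\text{SOT-}\lim_{r\to1^-}\Big[-I_\Gamma\otimes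 T+(I_\Gamma\otimes D_{T^*})\Big(I_{\Gamma\otimes\mathcal H}-r\sum_{i=1}^nR_i\otimes T_i^*\Big)^{-1}r\tilde R\,(I_\Gamma\otimes D_T)\Big]\Big|_{\Gamma\otimes\mathcal D_T},$$ where $\tilde R=(R_1\otimes I_{\mathcal H},\ldots,R_n\otimes I_{\mathcal H}):(\Gamma\otimes\mathcal H)^n\to\Gamma\otimes\mathcal H$ and $\Gamma\otimes\mathcal H^n$ is identified with $(\Gamma\otimes\mathcal H)^n$. *)

theory Defs
  imports "HOL-Analysis.Analysis"
begin

section \<open>Complex Hilbert spaces\<close>

text \<open>
  The complex inner product is linear in the first argument.  Its real part is the library's
  \<^const>\<open>inner\<close>, so that norm and topology are those of \<^class>\<open>real_inner\<close>.
\<close>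

class chilbert_space = real_inner + banach +
  fixes scaleC :: "complex \<Rightarrow> 'a \<Rightarrow> 'a"  (infixr \<open>*\<^sub>C\<close> 75)
    and cinner :: "'a \<Rightarrow> 'a \<Rightarrow> complex"
  assumes scaleC_add_right: "c *\<^sub>C (x + y) = c *\<^sub>C x + c *\<^sub>C y"
    and scaleC_add_left: "(c + d) *\<^sub>C x = c *\<^sub>C x + d *\<^sub>C x"
    and scaleC_scaleC: "c *\<^sub>C d *\<^sub>C x = (c * d) *\<^sub>C x"
    and scaleC_of_real: "of_real r *\<^sub>C x = r *\<^sub>R x"
    and cinner_add_left: "cinner (x + y) z = cinner x z + cinner y z"
    and cinner_scaleC_left: "cinner (c *\<^sub>C x) y = c * cinner x y"
    and cinner_commute: "cinner x y = cnj (cinner y x)"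
    and inner_eq_Re_cinner: "inner x y = Re (cinner x y)"

lemma cinner_add_right: "cinner x (y + z) = cinner x y + cinner x z"
  by (metis cinner_add_left cinner_commute complex_cnj_add)

lemma cinner_scaleC_right: "cinner x (c *\<^sub>C y) = cnj c * cinner x y"
  by (metis cinner_commute cinner_scaleC_left complex_cnj_mult)

lemma cinner_self: "cinner x x = of_real ((norm x)\<^sup>2)"
proof -
  have "Im (cinner x x) = 0"
    using cinner_commute[of x x] by (metis Reals_cnj_iff complex_is_Real_iff)
  then show ?thesis
    by (simp add: complex_eq_iff power2_norm_eq_inner inner_eq_Re_cinner)
qed

lemma norm_scaleC: "norm (c *\<^sub>C x) = cmod c * norm x"
proof -
  have "cinner (c *\<^sub>C x) (c *\<^sub>C x) = of_real ((cmod c * norm x)\<^sup>2)"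
    unfolding cinner_scaleC_left cinner_scaleC_right cinner_self[of x] power_mult_distrib of_real_mult
    by (simp only: complex_norm_square ac_simps)
  then have "(norm (c *\<^sub>C x))\<^sup>2 = (cmod c * norm x)\<^sup>2"
    unfolding cinner_self by (simp only: of_real_eq_iff)
  then show ?thesis
    by (simp add: power2_eq_iff_nonneg)
qed

lemma norm_cinner_le: "cmod (cinner x y) \<le> norm x * norm y"
proof (cases "cinner x y = 0")
  case False
  define u where "u = cnj (cinner x y) / cmod (cinner x y)"
  have "u * cinner x y = of_real (cmod (cinner x y))"
    using False complex_norm_square[of "cinner x y"]
    by (simp add: u_def field_simps power2_eq_square)
  then have "cmod (cinner x y) = inner (u *\<^sub>C x) y"
    by (simp add: inner_eq_Re_cinner cinner_scaleC_left)
  also have "\<dots> \<le> norm (u *\<^sub>C x) * norm y"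
    by (rule norm_cauchy_schwarz)
  also have "norm (u *\<^sub>C x) = norm x"
    using False by (simp add: norm_scaleC u_def norm_divide)
  finally show ?thesis .
qed simp

instantiation complex :: chilbert_space
begin
definition scaleC_complex :: "complex \<Rightarrow> complex \<Rightarrow> complex" where
  "scaleC_complex c x = c * x"
definition cinner_complex :: "complex \<Rightarrow> complex \<Rightarrow> complex" where
  "cinner_complex x y = x * cnj y"
instance
  by standard (simp_all add: scaleC_complex_def cinner_complex_def algebra_simps
      scaleR_conv_of_real inner_complex_def)
end

instantiation prod :: (chilbert_space, chilbert_space) chilbert_space
begin
definition scaleC_prod :: "complex \<Rightarrow> 'a \<times> 'b \<Rightarrow> 'a \<times> 'b" where
  "scaleC_prod c x = (c *\<^sub>C fst x, c *\<^sub>C snd x)"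
definition cinner_prod :: "'a \<times> 'b \<Rightarrow> 'a \<times> 'b \<Rightarrow> complex" where
  "cinner_prod x y = cinner (fst x) (fst y) + cinner (snd x) (snd y)"
instance
proof
  fix x y :: "'a \<times> 'b"
  show "cinner x y = cnj (cinner y x)"
    unfolding cinner_prod_def complex_cnj_add by (metis cinner_commute)
qed (simp_all add: scaleC_prod_def cinner_prod_def scaleC_add_right scaleC_add_left
      scaleC_scaleC scaleC_of_real cinner_add_left cinner_scaleC_left inner_prod_def
      inner_eq_Re_cinner scaleR_prod_def algebra_simps)
end

instantiation vec :: (chilbert_space, finite) chilbert_space
begin
definition scaleC_vec :: "complex \<Rightarrow> 'a ^ 'b \<Rightarrow> 'a ^ 'b" where
  "scaleC_vec c x = (\<chi> i. c *\<^sub>C (x $ i))"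
definition cinner_vec :: "'a ^ 'b \<Rightarrow> 'a ^ 'b \<Rightarrow> complex" where
  "cinner_vec x y = (\<Sum>i\<in>UNIV. cinner (x $ i) (y $ i))"
instance
proof
  fix x y :: "'a ^ 'b"
  show "cinner x y = cnj (cinner y x)"
    unfolding cinner_vec_def cnj_sum by (metis cinner_commute)
qed (simp_all add: scaleC_vec_def cinner_vec_def vec_eq_iff scaleC_add_right scaleC_add_left
      scaleC_scaleC scaleC_of_real cinner_add_left cinner_scaleC_left inner_vec_def
      inner_eq_Re_cinner sum.distrib sum_distrib_left)
end


section \<open>Square-summable families\<close>

typedef (overloaded) ('i, 'a) ell2 =
  "{f :: 'i \<Rightarrow> 'a::chilbert_space. (\<lambda>i. (norm (f i))\<^sup>2) summable_on UNIV}"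
  by (rule exI[of _ "\<lambda>_. 0"]) simp

lemma summable_Rep_ell2: "(\<lambda>i. (norm (Rep_ell2 f i))\<^sup>2) summable_on UNIV"
  using Rep_ell2[of f] by simp

lemma ell2_eq_iff: "f = g \<longleftrightarrow> (\<forall>i. Rep_ell2 f i = Rep_ell2 g i)"
  by (metis Rep_ell2_inject ext)

lemma ell2_add_mem:
  fixes f g :: "'i \<Rightarrow> 'a::chilbert_space"
  assumes "(\<lambda>i. (norm (f i))\<^sup>2) summable_on UNIV" "(\<lambda>i. (norm (g i))\<^sup>2) summable_on UNIV"
  shows "(\<lambda>i. (norm (f i + g i))\<^sup>2) summable_on UNIV"
proof (rule summable_on_comparison_test)
  show "(\<lambda>i. 2 * (norm (f i))\<^sup>2 + 2 * (norm (g i))\<^sup>2) summable_on UNIV"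
    using assms by (intro summable_on_add summable_on_cmult_right)
  fix i
  have "(norm (f i + g i))\<^sup>2 \<le> (norm (f i) + norm (g i))\<^sup>2"
    by (simp add: norm_triangle_ineq)
  also have "\<dots> \<le> 2 * (norm (f i))\<^sup>2 + 2 * (norm (g i))\<^sup>2"
    using sum_squares_bound[of "norm (f i)" "norm (g i)"] by (simp add: power2_sum)
  finally show "(norm (f i + g i))\<^sup>2 \<le> 2 * (norm (f i))\<^sup>2 + 2 * (norm (g i))\<^sup>2" .
qed simp_all

lemma ell2_scaleC_mem:
  fixes f :: "'i \<Rightarrow> 'a::chilbert_space"
  assumes "(\<lambda>i. (norm (f i))\<^sup>2) summable_on UNIV"
  shows "(\<lambda>i. (norm (c *\<^sub>C f i))\<^sup>2) summable_on UNIV"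
  using summable_on_cmult_right[OF assms, of "(cmod c)\<^sup>2"]
  by (simp add: norm_scaleC power_mult_distrib)

lemma ell2_cinner_summable:
  fixes f g :: "'i \<Rightarrow> 'a::chilbert_space"
  assumes "(\<lambda>i. (norm (f i))\<^sup>2) summable_on UNIV" "(\<lambda>i. (norm (g i))\<^sup>2) summable_on UNIV"
  shows "(\<lambda>i. cinner (f i) (g i)) summable_on UNIV"
proof -
  have "(\<lambda>i. (norm (f i))\<^sup>2 + (norm (g i))\<^sup>2) summable_on UNIV"
    using assms by (intro summable_on_add)
  then have "(\<lambda>i. norm (cinner (f i) (g i))) summable_on UNIV"
  proof (rule summable_on_comparison_test)
    fix i
    have "2 * cmod (cinner (f i) (g i)) \<le> 2 * (norm (f i) * norm (g i))"
      using norm_cinner_le[of "f i" "g i"] by simp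
    also have "\<dots> \<le> (norm (f i))\<^sup>2 + (norm (g i))\<^sup>2"
      using sum_squares_bound[of "norm (f i)" "norm (g i)"] by simp
    finally have "2 * cmod (cinner (f i) (g i)) \<le> (norm (f i))\<^sup>2 + (norm (g i))\<^sup>2" .
    then show "norm (cinner (f i) (g i)) \<le> (norm (f i))\<^sup>2 + (norm (g i))\<^sup>2"
      using norm_ge_zero[of "cinner (f i) (g i)"] by linarith
  qed simp
  then show ?thesis
    by (rule abs_summable_summable)
qed

instantiation ell2 :: (type, chilbert_space) real_vector
begin
definition zero_ell2 :: "('a, 'b) ell2" where
  "zero_ell2 = Abs_ell2 (\<lambda>i. 0)"
definition plus_ell2 :: "('a, 'b) ell2 \<Rightarrow> ('a, 'b) ell2 \<Rightarrow> ('a, 'b) ell2" where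
  "plus_ell2 f g = Abs_ell2 (\<lambda>i. Rep_ell2 f i + Rep_ell2 g i)"
definition uminus_ell2 :: "('a, 'b) ell2 \<Rightarrow> ('a, 'b) ell2" where
  "uminus_ell2 f = Abs_ell2 (\<lambda>i. - Rep_ell2 f i)"
definition minus_ell2 :: "('a, 'b) ell2 \<Rightarrow> ('a, 'b) ell2 \<Rightarrow> ('a, 'b) ell2" where
  "minus_ell2 f g = f + (- g)"
definition scaleR_ell2 :: "real \<Rightarrow> ('a, 'b) ell2 \<Rightarrow> ('a, 'b) ell2" where
  "scaleR_ell2 r f = Abs_ell2 (\<lambda>i. r *\<^sub>R Rep_ell2 f i)"

lemma Rep_ell2_zero [simp]: "Rep_ell2 (0 :: ('a, 'b) ell2) i = 0"
  by (simp add: zero_ell2_def Abs_ell2_inverse)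

lemma Rep_ell2_plus [simp]: "Rep_ell2 (f + g :: ('a, 'b) ell2) i = Rep_ell2 f i + Rep_ell2 g i"
  by (simp add: plus_ell2_def Abs_ell2_inverse ell2_add_mem summable_Rep_ell2)

lemma Rep_ell2_uminus [simp]: "Rep_ell2 (- f :: ('a, 'b) ell2) i = - Rep_ell2 f i"
  by (simp add: uminus_ell2_def Abs_ell2_inverse summable_Rep_ell2)

lemma Rep_ell2_minus [simp]: "Rep_ell2 (f - g :: ('a, 'b) ell2) i = Rep_ell2 f i - Rep_ell2 g i"
  by (simp add: minus_ell2_def)

lemma Rep_ell2_scaleR [simp]: "Rep_ell2 (r *\<^sub>R f :: ('a, 'b) ell2) i = r *\<^sub>R Rep_ell2 f i"
  using ell2_scaleC_mem[OF summable_Rep_ell2[of f], of "of_real r"]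
  by (simp add: scaleR_ell2_def Abs_ell2_inverse scaleC_of_real)

instance
  by standard (simp_all add: ell2_eq_iff algebra_simps)
end

instantiation ell2 :: (type, chilbert_space) real_inner
begin
definition inner_ell2 :: "('a, 'b) ell2 \<Rightarrow> ('a, 'b) ell2 \<Rightarrow> real" where
  "inner_ell2 f g = (\<Sum>\<^sub>\<infinity>i. inner (Rep_ell2 f i) (Rep_ell2 g i))"
definition norm_ell2 :: "('a, 'b) ell2 \<Rightarrow> real" where
  "norm_ell2 f = sqrt (inner f f)"
definition sgn_ell2 :: "('a, 'b) ell2 \<Rightarrow> ('a, 'b) ell2" where
  "sgn_ell2 f = f /\<^sub>R norm f"
definition dist_ell2 :: "('a, 'b) ell2 \<Rightarrow> ('a, 'b) ell2 \<Rightarrow> real" where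
  "dist_ell2 f g = norm (f - g)"
definition uniformity_ell2 :: "(('a, 'b) ell2 \<times> ('a, 'b) ell2) filter" where
  "uniformity_ell2 = (INF e\<in>{0<..}. principal {(f, g). dist f g < e})"
definition open_ell2 :: "('a, 'b) ell2 set \<Rightarrow> bool" where
  "open_ell2 U \<longleftrightarrow> (\<forall>x\<in>U. \<forall>\<^sub>F (x', y) in uniformity. x' = x \<longrightarrow> y \<in> U)"

lemma ell2_inner_summable:
  "(\<lambda>i. inner (Rep_ell2 f i) (Rep_ell2 (g :: ('a, 'b) ell2) i)) summable_on UNIV"
  unfolding inner_eq_Re_cinner
  by (intro summable_on_Re ell2_cinner_summable summable_Rep_ell2)

instance
proof
  fix f g h :: "('a, 'b) ell2" and r :: real and U :: "('a, 'b) ell2 set"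
  show "inner f g = inner g f"
    by (simp add: inner_ell2_def inner_commute)
  show "inner (f + g) h = inner f h + inner g h"
    by (simp add: inner_ell2_def inner_add_left infsum_add ell2_inner_summable)
  show "inner (r *\<^sub>R f) g = r * inner f g"
    by (simp add: inner_ell2_def infsum_cmult_right')
  show "0 \<le> inner f f"
    by (simp add: inner_ell2_def infsum_nonneg)
  show "inner f f = 0 \<longleftrightarrow> f = 0"
  proof
    assume "inner f f = 0"
    then have "inner (Rep_ell2 f i) (Rep_ell2 f i) = 0" for i
      using nonneg_infsum_le_0D[OF _ ell2_inner_summable[of f f], of i] 
      by (auto simp: inner_ell2_def)
    then show "f = 0"
      by (simp add: ell2_eq_iff)
  qed (simp add: inner_ell2_def)
qed (simp_all add: norm_ell2_def sgn_ell2_def dist_ell2_def uniformity_ell2_def open_ell2_def)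
end

lemma ell2_norm_squared: "(norm (f :: ('i, 'a::chilbert_space) ell2))\<^sup>2 = (\<Sum>\<^sub>\<infinity>i. (norm (Rep_ell2 f i))\<^sup>2)"
  by (simp add: power2_norm_eq_inner inner_ell2_def)

lemma ell2_sum_le_norm:
  fixes f :: "('i, 'a::chilbert_space) ell2"
  assumes "finite F"
  shows "(\<Sum>i\<in>F. (norm (Rep_ell2 f i))\<^sup>2) \<le> (norm f)\<^sup>2"
  unfolding ell2_norm_squared
  by (rule finite_sum_le_infsum) (use assms in \<open>auto simp: summable_Rep_ell2\<close>)

lemma norm_Rep_ell2_le: "norm (Rep_ell2 f i) \<le> norm (f :: ('i, 'a::chilbert_space) ell2)"
  using ell2_sum_le_norm[of "{i}" f] by (simp add: power2_le_iff_abs_le)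

instance ell2 :: (type, chilbert_space) banach
proof
  fix X :: "nat \<Rightarrow> ('a, 'b) ell2"
  assume X: "Cauchy X"
  have "Cauchy (\<lambda>n. Rep_ell2 (X n) i)" for i
  proof (rule metric_CauchyI)
    fix e :: real assume "e > 0"
    then obtain M where M: "\<forall>m\<ge>M. \<forall>n\<ge>M. dist (X m) (X n) < e"
      using X by (meson metric_CauchyD)
    have "dist (Rep_ell2 (X m) i) (Rep_ell2 (X n) i) \<le> dist (X m) (X n)" for m n
      using norm_Rep_ell2_le[of "X m - X n" i] by (simp add: dist_norm)
    with M show "\<exists>M. \<forall>m\<ge>M. \<forall>n\<ge>M. dist (Rep_ell2 (X m) i) (Rep_ell2 (X n) i) < e"
      by (meson le_less_trans)
  qed
  then have "\<forall>i. \<exists>l. (\<lambda>n. Rep_ell2 (X n) i) \<longlonglongrightarrow> l"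
    by (simp add: Cauchy_convergent_iff convergent_def)
  then obtain l where l: "\<And>i. (\<lambda>n. Rep_ell2 (X n) i) \<longlonglongrightarrow> l i"
    by metis
  have bound: "(\<Sum>i\<in>F. (norm (Rep_ell2 (X m) i - l i))\<^sup>2) \<le> e\<^sup>2"
    if "\<forall>n\<ge>M. dist (X m) (X n) < e" "finite F" for e M m F
  proof (rule LIMSEQ_le_const2)
    show "(\<lambda>n. \<Sum>i\<in>F. (norm (Rep_ell2 (X m) i - Rep_ell2 (X n) i))\<^sup>2)
        \<longlonglongrightarrow> (\<Sum>i\<in>F. (norm (Rep_ell2 (X m) i - l i))\<^sup>2)"
      by (intro tendsto_intros l)
    have "(\<Sum>i\<in>F. (norm (Rep_ell2 (X m) i - Rep_ell2 (X n) i))\<^sup>2) \<le> e\<^sup>2" if "n \<ge> M" for n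
    proof -
      have "(\<Sum>i\<in>F. (norm (Rep_ell2 (X m) i - Rep_ell2 (X n) i))\<^sup>2) \<le> (norm (X m - X n))\<^sup>2"
        using ell2_sum_le_norm[OF \<open>finite F\<close>, of "X m - X n"] by simp
      also have "\<dots> \<le> e\<^sup>2"
        using \<open>\<forall>n\<ge>M. _\<close> \<open>n \<ge> M\<close> by (intro power_mono) (auto simp: dist_norm less_imp_le)
      finally show ?thesis .
    qed
    then show "\<exists>N. \<forall>n\<ge>N. (\<Sum>i\<in>F. (norm (Rep_ell2 (X m) i - Rep_ell2 (X n) i))\<^sup>2) \<le> e\<^sup>2"
      by blast
  qed
  have summ: "(\<lambda>i. (norm (Rep_ell2 (X m) i - l i))\<^sup>2) summable_on UNIV"
    and small: "(\<Sum>\<^sub>\<infinity>i. (norm (Rep_ell2 (X m) i - l i))\<^sup>2) \<le> e\<^sup>2"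
    if "\<forall>n\<ge>M. dist (X m) (X n) < e" for e M m
  proof -
    show "(\<lambda>i. (norm (Rep_ell2 (X m) i - l i))\<^sup>2) summable_on UNIV"
      by (rule nonneg_bdd_above_summable_on) (use bound[OF that] in \<open>auto intro!: bdd_aboveI[of _ "e\<^sup>2"]\<close>)
    then show "(\<Sum>\<^sub>\<infinity>i. (norm (Rep_ell2 (X m) i - l i))\<^sup>2) \<le> e\<^sup>2"
      by (rule infsum_le_finite_sums) (use bound[OF that] in auto)
  qed
  obtain M1 where M1: "\<forall>m\<ge>M1. \<forall>n\<ge>M1. dist (X m) (X n) < 1"
    using metric_CauchyD[OF X, of 1] by auto
  have "(\<lambda>i. (norm (Rep_ell2 (X M1) i + - (Rep_ell2 (X M1) i - l i)))\<^sup>2) summable_on UNIV"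
    by (intro ell2_add_mem summable_Rep_ell2) (use summ[of M1 M1 1] M1 in \<open>simp add: norm_minus_commute\<close>)
  then have Rep_l: "Rep_ell2 (Abs_ell2 l) = l"
    by (simp add: Abs_ell2_inverse)
  have "X \<longlonglongrightarrow> Abs_ell2 l"
  proof (rule metric_LIMSEQ_I)
    fix e :: real assume "e > 0"
    then obtain M where M: "\<forall>m\<ge>M. \<forall>n\<ge>M. dist (X m) (X n) < e / 2"
      using metric_CauchyD[OF X, of "e / 2"] by auto
    have "dist (X m) (Abs_ell2 l) < e" if "m \<ge> M" for m
    proof -
      have "(norm (X m - Abs_ell2 l))\<^sup>2 \<le> (e / 2)\<^sup>2"
        using small[of M m "e / 2"] M that by (simp add: ell2_norm_squared Rep_l)
      then have "norm (X m - Abs_ell2 l) \<le> e / 2"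
        using \<open>e > 0\<close> by (simp add: power2_le_iff_abs_le)
      then show ?thesis
        using \<open>e > 0\<close> by (simp add: dist_norm)
    qed
    then show "\<exists>M. \<forall>m\<ge>M. dist (X m) (Abs_ell2 l) < e"
      by blast
  qed
  then show "convergent X"
    by (rule convergentI)
qed

instantiation ell2 :: (type, chilbert_space) chilbert_space
begin
definition scaleC_ell2 :: "complex \<Rightarrow> ('a, 'b) ell2 \<Rightarrow> ('a, 'b) ell2" where
  "scaleC_ell2 c f = Abs_ell2 (\<lambda>i. c *\<^sub>C Rep_ell2 f i)"
definition cinner_ell2 :: "('a, 'b) ell2 \<Rightarrow> ('a, 'b) ell2 \<Rightarrow> complex" where
  "cinner_ell2 f g = (\<Sum>\<^sub>\<infinity>i. cinner (Rep_ell2 f i) (Rep_ell2 g i))"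

lemma Rep_ell2_scaleC [simp]: "Rep_ell2 (c *\<^sub>C f :: ('a, 'b) ell2) i = c *\<^sub>C Rep_ell2 f i"
  by (simp add: scaleC_ell2_def Abs_ell2_inverse ell2_scaleC_mem summable_Rep_ell2)

instance
proof
  fix f g h :: "('a, 'b) ell2" and c :: complex
  show "cinner (f + g) h = cinner f h + cinner g h"
    by (simp add: cinner_ell2_def cinner_add_left infsum_add ell2_cinner_summable summable_Rep_ell2)
  show "cinner (c *\<^sub>C f) g = c * cinner f g"
    by (simp add: cinner_ell2_def cinner_scaleC_left infsum_cmult_right')
  show "cinner f g = cnj (cinner g f)"
    unfolding cinner_ell2_def infsum_cnj[symmetric] by (metis cinner_commute)
  show "inner f g = Re (cinner f g)"
    by (simp add: cinner_ell2_def inner_ell2_def inner_eq_Re_cinner infsum_Re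
        ell2_cinner_summable summable_Rep_ell2)
qed (simp_all add: ell2_eq_iff scaleC_add_right scaleC_add_left scaleC_scaleC scaleC_of_real)
end


section \<open>Operators\<close>

definition csubspace :: "'a::chilbert_space set \<Rightarrow> bool" where
  "csubspace V \<longleftrightarrow> 0 \<in> V \<and> (\<forall>x\<in>V. \<forall>y\<in>V. x + y \<in> V) \<and> (\<forall>c. \<forall>x\<in>V. c *\<^sub>C x \<in> V)"

definition closed_csubspace :: "'a::chilbert_space set \<Rightarrow> bool" where
  "closed_csubspace V \<longleftrightarrow> csubspace V \<and> closed V"

text \<open>
  An operator between closed subspaces \<open>V\<close> and \<open>W\<close> is a total function of which only the values
  on \<open>V\<close> matter.
\<close>

definition bounded_clinear_on ::
  "'a::chilbert_space set \<Rightarrow> 'b::chilbert_space set \<Rightarrow> ('a \<Rightarrow> 'b) \<Rightarrow> bool" where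
  "bounded_clinear_on V W A \<longleftrightarrow>
     (\<forall>x\<in>V. A x \<in> W) \<and>
     (\<forall>x\<in>V. \<forall>y\<in>V. A (x + y) = A x + A y) \<and>
     (\<forall>c. \<forall>x\<in>V. A (c *\<^sub>C x) = c *\<^sub>C A x) \<and>
     (\<exists>K. \<forall>x\<in>V. norm (A x) \<le> K * norm x)"

abbreviation bounded_clinear :: "('a::chilbert_space \<Rightarrow> 'b::chilbert_space) \<Rightarrow> bool" where
  "bounded_clinear \<equiv> bounded_clinear_on UNIV UNIV"

definition unitary_on ::
  "'a::chilbert_space set \<Rightarrow> 'b::chilbert_space set \<Rightarrow> ('a \<Rightarrow> 'b) \<Rightarrow> bool" where
  "unitary_on V W U \<longleftrightarrow>
     bounded_clinear_on V W U \<and>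
     (\<forall>x\<in>V. \<forall>y\<in>V. cinner (U x) (U y) = cinner x y) \<and> U ` V = W"

definition cadjoint ::
  "('a::chilbert_space \<Rightarrow> 'b::chilbert_space) \<Rightarrow> 'b \<Rightarrow> 'a" where
  "cadjoint A = (THE B. \<forall>x y. cinner (A x) y = cinner x (B y))"

definition positive_op :: "('a::chilbert_space \<Rightarrow> 'a) \<Rightarrow> bool" where
  "positive_op A \<longleftrightarrow> bounded_clinear A \<and> (\<forall>x. cinner (A x) x \<in> \<real>\<^sub>\<ge>\<^sub>0)"

definition sqrt_op :: "('a::chilbert_space \<Rightarrow> 'a) \<Rightarrow> 'a \<Rightarrow> 'a" where
  "sqrt_op A = (THE B. positive_op B \<and> B \<circ> B = A)"


section \<open>Row contractions\<close>

text \<open>The space $\mathcal H^n$ is \<open>'h ^ 'n\<close>.\<close>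

definition row_op ::
  "('n::finite \<Rightarrow> 'h::chilbert_space \<Rightarrow> 'h) \<Rightarrow> 'h ^ 'n \<Rightarrow> 'h" where
  "row_op T v = (\<Sum>i\<in>UNIV. T i (v $ i))"

definition row_contraction :: "('n::finite \<Rightarrow> 'h::chilbert_space \<Rightarrow> 'h) \<Rightarrow> bool" where
  "row_contraction T \<longleftrightarrow>
     (\<forall>i. bounded_clinear (T i)) \<and>
     positive_op (\<lambda>x. x - (\<Sum>i\<in>UNIV. T i (cadjoint (T i) x)))"

definition defect_op ::
  "('n::finite \<Rightarrow> 'h::chilbert_space \<Rightarrow> 'h) \<Rightarrow> 'h ^ 'n \<Rightarrow> 'h ^ 'n" where
  "defect_op T = sqrt_op (\<lambda>v. v - cadjoint (row_op T) (row_op T v))"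

definition defect_op_star ::
  "('n::finite \<Rightarrow> 'h::chilbert_space \<Rightarrow> 'h) \<Rightarrow> 'h \<Rightarrow> 'h" where
  "defect_op_star T = sqrt_op (\<lambda>x. x - row_op T (cadjoint (row_op T) x))"

definition defect_space ::
  "('n::finite \<Rightarrow> 'h::chilbert_space \<Rightarrow> 'h) \<Rightarrow> ('h ^ 'n) set" where
  "defect_space T = closure (range (defect_op T))"

definition defect_space_star ::
  "('n::finite \<Rightarrow> 'h::chilbert_space \<Rightarrow> 'h) \<Rightarrow> 'h set" where
  "defect_space_star T = closure (range (defect_op_star T))"


section \<open>The full Fock space\<close>

text \<open>
  The full Fock space $\Gamma$ has the orthonormal basis $e_w = e_{i_1} \otimes \dots \otimes e_{i_m}$
  indexed by the words $w = i_1 \dots i_m$ in the letters \<open>'n\<close>; the vacuum vector belongs to the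
  empty word.  Thus $\Gamma$ is \<open>('n, complex) fock\<close>, and $\Gamma \otimes \mathcal H$ is
  \<open>('n, 'h) fock\<close>, where a family \<open>f\<close> stands for $\sum_w e_w \otimes f(w)$.  The lemmas
  \<open>cinner_tensor\<close> and \<open>tensor_total\<close> below say that this is the Hilbert space tensor product.
\<close>

type_synonym ('n, 'h) fock = "('n list, 'h) ell2"

definition tensor :: "('n, complex) fock \<Rightarrow> 'h::chilbert_space \<Rightarrow> ('n, 'h) fock"  (infixr \<open>\<otimes>\<^sub>F\<close> 76) where
  "f \<otimes>\<^sub>F x = Abs_ell2 (\<lambda>w. Rep_ell2 f w *\<^sub>C x)"

definition fock_basis :: "'n list \<Rightarrow> ('n, complex) fock" where
  "fock_basis w = Abs_ell2 (\<lambda>v. if v = w then 1 else 0)"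

text \<open>$\Gamma \otimes V$ for a closed subspace \<open>V\<close>.\<close>

definition fock_of :: "'h::chilbert_space set \<Rightarrow> ('n, 'h) fock set" where
  "fock_of V = {f. \<forall>w. Rep_ell2 f w \<in> V}"

text \<open>$I_\Gamma \otimes A$.\<close>

definition fock_map ::
  "('h::chilbert_space \<Rightarrow> 'k::chilbert_space) \<Rightarrow> ('n, 'h) fock \<Rightarrow> ('n, 'k) fock" where
  "fock_map A f = Abs_ell2 (\<lambda>w. A (Rep_ell2 f w))"

text \<open>$L_j \otimes I$ and $R_j \otimes I$; for \<open>'h = complex\<close> these are $L_j$ and $R_j$.\<close>

definition left_creation :: "'n \<Rightarrow> ('n, 'h::chilbert_space) fock \<Rightarrow> ('n, 'h) fock" where
  "left_creation j f =
     Abs_ell2 (\<lambda>w. if w \<noteq> [] \<and> hd w = j then Rep_ell2 f (tl w) else 0)"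

definition right_creation :: "'n \<Rightarrow> ('n, 'h::chilbert_space) fock \<Rightarrow> ('n, 'h) fock" where
  "right_creation j f =
     Abs_ell2 (\<lambda>w. if w \<noteq> [] \<and> last w = j then Rep_ell2 f (butlast w) else 0)"

lemma Rep_tensor: "Rep_ell2 (f \<otimes>\<^sub>F x) w = Rep_ell2 f w *\<^sub>C x"
proof -
  have "(\<lambda>w. (norm (Rep_ell2 f w *\<^sub>C x))\<^sup>2) summable_on UNIV"
    using summable_on_cmult_left[OF summable_Rep_ell2[of f], of "(norm x)\<^sup>2"]
    by (simp add: norm_scaleC power_mult_distrib)
  then show ?thesis
    by (simp add: tensor_def Abs_ell2_inverse)
qed

lemma Rep_fock_basis: "Rep_ell2 (fock_basis w) v = (if v = w then 1 else 0)"
proof -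
  have "(\<lambda>v. (norm (if v = w then 1 else 0 :: complex))\<^sup>2) summable_on UNIV"
    by (rule finite_nonzero_values_imp_summable_on) (rule finite_subset[of _ "{w}"], auto)
  then show ?thesis
    by (simp add: fock_basis_def Abs_ell2_inverse)
qed

lemma ell2_extend_mem:
  fixes f :: "'i \<Rightarrow> 'a::chilbert_space" and p :: "'i \<Rightarrow> 'j"
  assumes f: "(\<lambda>i. (norm (f i))\<^sup>2) summable_on UNIV"
    and p: "\<And>i. q (p i) = i" and P: "\<And>j. P j \<Longrightarrow> p (q j) = j"
  shows "(\<lambda>j. (norm (if P j then f (q j) else 0))\<^sup>2) summable_on UNIV"
proof -
  have "inj p"
    by (metis injI p)
  then have "(\<lambda>j. (norm (f (q j)))\<^sup>2) summable_on range p"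
    using f by (simp add: summable_on_reindex o_def p)
  then have "(\<lambda>j. (norm (f (q j)))\<^sup>2) summable_on Collect P"
    by (rule summable_on_subset_banach) (use P in \<open>auto intro: rangeI[of p] simp: image_iff, metis\<close>)
  then show ?thesis
    by (subst summable_on_cong_neutral[where T = "Collect P"]) auto
qed

lemma Rep_left_creation:
  "Rep_ell2 (left_creation j f) w = (if w \<noteq> [] \<and> hd w = j then Rep_ell2 f (tl w) else 0)"
  unfolding left_creation_def
  by (subst Abs_ell2_inverse)
    (auto intro!: ell2_extend_mem[where p = "\<lambda>v. j # v"] summable_Rep_ell2)

lemma Rep_right_creation:
  "Rep_ell2 (right_creation j f) w = (if w \<noteq> [] \<and> last w = j then Rep_ell2 f (butlast w) else 0)"
  unfolding right_creation_def
  by (subst Abs_ell2_inverse)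
    (auto intro!: ell2_extend_mem[where p = "\<lambda>v. v @ [j]"] summable_Rep_ell2)

lemma Rep_fock_map:
  assumes "bounded_clinear_on V W A" "f \<in> fock_of V"
  shows "Rep_ell2 (fock_map A f) w = A (Rep_ell2 f w)"
proof -
  obtain K where K: "\<And>x. x \<in> V \<Longrightarrow> norm (A x) \<le> K * norm x"
    using assms(1) unfolding bounded_clinear_on_def by blast
  have "(\<lambda>w. (norm (A (Rep_ell2 f w)))\<^sup>2) summable_on UNIV"
  proof (rule summable_on_comparison_test)
    show "(\<lambda>w. K\<^sup>2 * (norm (Rep_ell2 f w))\<^sup>2) summable_on UNIV"
      by (intro summable_on_cmult_right summable_Rep_ell2)
    fix w
    have "(norm (A (Rep_ell2 f w)))\<^sup>2 \<le> (K * norm (Rep_ell2 f w))\<^sup>2"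
      using assms(2) by (intro power_mono K) (auto simp: fock_of_def)
    then show "(norm (A (Rep_ell2 f w)))\<^sup>2 \<le> K\<^sup>2 * (norm (Rep_ell2 f w))\<^sup>2"
      by (simp add: power_mult_distrib)
  qed simp
  then show ?thesis
    by (simp add: fock_map_def Abs_ell2_inverse)
qed

lemma cinner_tensor: "cinner (f \<otimes>\<^sub>F x) (g \<otimes>\<^sub>F y) = cinner f g * cinner x y"
proof -
  have "cinner (f \<otimes>\<^sub>F x) (g \<otimes>\<^sub>F y) =
      (\<Sum>\<^sub>\<infinity>w. cinner (Rep_ell2 f w) (Rep_ell2 g w) * cinner x y)"
    by (simp add: cinner_ell2_def Rep_tensor cinner_scaleC_left cinner_scaleC_right
        cinner_complex_def mult.assoc mult.left_commute)
  then show ?thesis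
    by (simp add: infsum_cmult_left' cinner_ell2_def[of f g])
qed

lemma cinner_fock_basis_tensor: "cinner h (fock_basis w \<otimes>\<^sub>F x) = cinner (Rep_ell2 h w) x"
proof -
  have "cinner h (fock_basis w \<otimes>\<^sub>F x) =
      (\<Sum>\<^sub>\<infinity>v\<in>{w}. cinner (Rep_ell2 h v) (Rep_ell2 (fock_basis w \<otimes>\<^sub>F x) v))"
    unfolding cinner_ell2_def
    by (rule infsum_cong_neutral)
      (auto simp: Rep_tensor Rep_fock_basis cinner_scaleC_right)
  then show ?thesis
    by (simp add: Rep_tensor Rep_fock_basis cinner_scaleC_right)
qed

lemma tensor_total:
  assumes "\<And>f x. cinner h (f \<otimes>\<^sub>F x) = 0"
  shows "h = 0"
proof -
  have "cinner (Rep_ell2 h w) (Rep_ell2 h w) = 0" for w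
    using assms[of "fock_basis w" "Rep_ell2 h w"] by (simp only: cinner_fock_basis_tensor)
  then show ?thesis
    by (simp add: ell2_eq_iff cinner_self)
qed

lemma left_creation_tensor: "left_creation j (f \<otimes>\<^sub>F x) = left_creation j f \<otimes>\<^sub>F x"
  by (simp add: ell2_eq_iff Rep_left_creation Rep_tensor scaleC_of_real[of 0, simplified])

lemma right_creation_tensor: "right_creation j (f \<otimes>\<^sub>F x) = right_creation j f \<otimes>\<^sub>F x"
  by (simp add: ell2_eq_iff Rep_right_creation Rep_tensor scaleC_of_real[of 0, simplified])

lemma left_creation_basis: "left_creation j (fock_basis w) = fock_basis (j # w)"
  by (auto simp: ell2_eq_iff Rep_left_creation Rep_fock_basis)

lemma right_creation_basis: "right_creation j (fock_basis w) = fock_basis (w @ [j])"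
  by (auto simp: ell2_eq_iff Rep_right_creation Rep_fock_basis)

lemma fock_map_tensor:
  assumes "bounded_clinear_on V W A" "csubspace V" "x \<in> V"
  shows "fock_map A (f \<otimes>\<^sub>F x) = f \<otimes>\<^sub>F A x"
proof -
  have "f \<otimes>\<^sub>F x \<in> fock_of V"
    using assms(2,3) by (simp add: fock_of_def Rep_tensor csubspace_def)
  with assms show ?thesis
    by (simp add: ell2_eq_iff Rep_fock_map Rep_tensor bounded_clinear_on_def)
qed


section \<open>Multi-analytic operators and the characteristic function\<close>

definition multi_analytic ::
  "'h::chilbert_space set \<Rightarrow> 'k::chilbert_space set \<Rightarrow> (('n, 'h) fock \<Rightarrow> ('n, 'k) fock) \<Rightarrow> bool" where
  "multi_analytic V W M \<longleftrightarrow>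
     bounded_clinear_on (fock_of V) (fock_of W) M \<and>
     (\<forall>i. \<forall>f\<in>fock_of V. M (left_creation i f) = left_creation i (M f))"

definition coincide ::
  "'a::chilbert_space set \<Rightarrow> 'b::chilbert_space set \<Rightarrow> (('n, 'a) fock \<Rightarrow> ('n, 'b) fock) \<Rightarrow>
   'c::chilbert_space set \<Rightarrow> 'd::chilbert_space set \<Rightarrow> (('n, 'c) fock \<Rightarrow> ('n, 'd) fock) \<Rightarrow> bool" where
  "coincide V U M V' U' M' \<longleftrightarrow>
     multi_analytic V U M \<and> multi_analytic V' U' M' \<and>
     (\<exists>W W1. unitary_on V V' W \<and> unitary_on U U' W1 \<and>
        (\<forall>f\<in>fock_of V. fock_map W1 (M f) = M' (fock_map W f)))"

text \<open>
  $\tilde R$, with $\Gamma \otimes \mathcal H^n$ in place of $(\Gamma \otimes \mathcal H)^n$.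
\<close>

definition right_row :: "('n::finite, 'h::chilbert_space ^ 'n) fock \<Rightarrow> ('n, 'h) fock" where
  "right_row f = (\<Sum>i\<in>UNIV. right_creation i (fock_map (\<lambda>v. v $ i) f))"

text \<open>
  The characteristic function is to be regarded as an operator on
  $\Gamma \otimes \mathcal D_T$, that is, on \<open>fock_of (defect_space T)\<close>.
\<close>

definition char_fun ::
  "('n::finite \<Rightarrow> 'h::chilbert_space \<Rightarrow> 'h) \<Rightarrow> ('n, 'h ^ 'n) fock \<Rightarrow> ('n, 'h) fock" where
  "char_fun T f = Lim (at_left 1) (\<lambda>r::real.
     - fock_map (row_op T) f +
     fock_map (defect_op_star T)
       (inv (\<lambda>g. g - r *\<^sub>R (\<Sum>i\<in>UNIV. right_creation i (fock_map (cadjoint (T i)) g)))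
         (r *\<^sub>R right_row (fock_map (defect_op T) f))))"

text \<open>
  The block diagonal operator with entries \<open>A\<close> and \<open>B\<close>, under the identification of
  $\Gamma \otimes (\mathcal H \oplus \mathcal K)$ with
  $(\Gamma \otimes \mathcal H) \oplus (\Gamma \otimes \mathcal K)$.
\<close>

definition fock_diag ::
  "(('n, 'a::chilbert_space) fock \<Rightarrow> ('n, 'b::chilbert_space) fock) \<Rightarrow>
   (('n, 'c::chilbert_space) fock \<Rightarrow> ('n, 'd::chilbert_space) fock) \<Rightarrow>
   ('n, 'a \<times> 'c) fock \<Rightarrow> ('n, 'b \<times> 'd) fock" where
  "fock_diag A B f =
     Abs_ell2 (\<lambda>w. (Rep_ell2 (A (fock_map fst f)) w, Rep_ell2 (B (fock_map snd f)) w))"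

text \<open>
  The auxiliary Hilbert spaces in the factorization are taken to be closed subspaces of
  $\mathcal H \oplus \mathcal H^n$.  This is no restriction: if any Hilbert spaces
  $\mathcal E_1, \mathcal E_2, \mathcal E$ and unitaries are as required, then the unitaries of the
  coincidence embed $\mathcal E_2$ into $\mathcal D_T \subseteq \mathcal H^n$ and $\mathcal E_1$
  into $\mathcal D_{T^*} \subseteq \mathcal H$, and $\tau_2$ embeds $\mathcal E$ into
  $\mathcal D_{S^*} \oplus \mathcal E_2 \subseteq \mathcal H \oplus \mathcal H^n$.
\<close>

type_synonym ('n, 'h) aux = "'h \<times> ('h ^ 'n)"

end

(*
  The characteristic function of T is the input-output map of a linear system on the tree of words:
  the state starts at 0, and one step from the word w sends (state, input) to (states at the words
  w i, output) by the Julia operator (x, f) |-> (T* x + D_T f, D_T* x - T f), which is unitary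
  from H + D_T to H^n + D_T*.  Triangularity of T lets the Julia operators of S, N and C be split
  off from that of T one after the other: each time the adjoint of the remaining isometry maps the
  corresponding block of H^n by S, N or C alone, so that D_S u |-> (remaining part of the adjoint
  at u) is isometric, and its range and the orthogonal complement of its range decompose the input
  space into a defect space and an auxiliary space.  What is left over are the constant unitaries
  tau_1, tau_2 and those of the coincidence; composing the resulting cascade of systems word by
  word gives the factorization.
*)
theory Submission
  imports Defs
begin

section \<open>Hilbert space preliminaries\<close>

text \<open>The zeros below the diagonal fix the order of splitting. The row operator of T sends a
  vector of the first block to (S u, 0, 0), so S can be removed at once; it sends one of the second
  block to (X u, N u, 0), and the component X u does no harm only after the states of H_1 have left
  the energy balance. All signals of the cascade are therefore kept as linear functions of one
  parameter l = (state, input) of the system of T. Splitting off a factor then only rewrites one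
  quadratic identity in l, and each constant unitary arises by extending an isometry between two
  sets of signal values to their closures.

  Convergence as r tends to 1 needs no Neumann series: the energy balance makes the systems
  contractive uniformly in r, and on e_w tensor x the parameter enters only through powers of r.

  The auxiliary spaces must be subspaces of one fixed type, so each orthogonal complement is carried
  by an explicit isometry into H + H^n, with coordinates left free for the defect space that joins
  it at the next stage.\<close>

lemma scaleC_zero_left [simp]: "0 *\<^sub>C x = (0::'a::chilbert_space)"
  using scaleC_of_real[of 0 x] by simp

lemma scaleC_one [simp]: "1 *\<^sub>C x = (x::'a::chilbert_space)"
  using scaleC_of_real[of 1 x] by simp

lemma scaleC_zero_right [simp]: "c *\<^sub>C 0 = (0::'a::chilbert_space)"
  using norm_scaleC[of c "0::'a"] by simp

lemma scaleC_minus_one: "(-1) *\<^sub>C x = - (x::'a::chilbert_space)"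
  using scaleC_of_real[of "-1" x] by simp

lemma cinner_zero_left [simp]: "cinner 0 (y::'a::chilbert_space) = 0"
  using cinner_scaleC_left[of 0 0 y] by simp

lemma cinner_zero_right [simp]: "cinner (x::'a::chilbert_space) 0 = 0"
  using cinner_scaleC_right[of x 0 0] by simp

lemma cinner_minus_left: "cinner (- x) (y::'a::chilbert_space) = - cinner x y"
  using cinner_scaleC_left[of "-1" x y] by (simp add: scaleC_minus_one)

lemma cinner_minus_right: "cinner x (- y::'a::chilbert_space) = - cinner x y"
  using cinner_scaleC_right[of x "-1" y] by (simp add: scaleC_minus_one)

lemma cinner_diff_left: "cinner (x - z) (y::'a::chilbert_space) = cinner x y - cinner z y"
  using cinner_add_left[of x "- z" y] by (simp add: cinner_minus_left)

lemma cinner_diff_right: "cinner x (y - z::'a::chilbert_space) = cinner x y - cinner x z"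
  using cinner_add_right[of x y "- z"] by (simp add: cinner_minus_right)

lemma scaleC_minus_right: "c *\<^sub>C (- x) = - (c *\<^sub>C (x::'a::chilbert_space))"
  by (metis scaleC_minus_one scaleC_scaleC mult.commute)

lemma scaleC_diff_right: "c *\<^sub>C (x - y) = c *\<^sub>C x - c *\<^sub>C (y::'a::chilbert_space)"
  using scaleC_add_right[of c x "- y"] by (simp add: scaleC_minus_right)

lemma scaleC_sum_right: "c *\<^sub>C (\<Sum>i\<in>I. f i) = (\<Sum>i\<in>I. c *\<^sub>C (f i::'a::chilbert_space))"
  by (induction I rule: infinite_finite_induct) (simp_all add: scaleC_add_right)

lemma scaleC_scaleR_commute: "c *\<^sub>C (r *\<^sub>R x) = r *\<^sub>R (c *\<^sub>C (x::'a::chilbert_space))"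
  by (simp only: scaleC_of_real[symmetric] scaleC_scaleC mult.commute)

lemma cinner_sum_left: "cinner (\<Sum>i\<in>I. f i) (y::'a::chilbert_space) = (\<Sum>i\<in>I. cinner (f i) y)"
  by (induction I rule: infinite_finite_induct) (simp_all add: cinner_add_left)

lemma cinner_self_eq_0 [simp]: "cinner x x = 0 \<longleftrightarrow> x = (0::'a::chilbert_space)"
  by (simp add: cinner_self)

lemma cinner_eqI:
  fixes x y :: "'a::chilbert_space"
  assumes "\<And>z. cinner x z = cinner y z"
  shows "x = y"
proof -
  have "cinner (x - y) (x - y) = 0"
    by (simp add: assms cinner_diff_left)
  then show ?thesis
    by simp
qed

lemma cinner_eqI':
  fixes x y :: "'a::chilbert_space"
  assumes "\<And>z. cinner z x = cinner z y"
  shows "x = y"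
proof -
  have "cinner (x - y) (x - y) = 0"
    by (simp add: assms cinner_diff_right)
  then show ?thesis
    by simp
qed

lemma Im_cinner: "Im (cinner x y) = inner x (\<i> *\<^sub>C (y::'a::chilbert_space))"
  by (simp add: inner_eq_Re_cinner cinner_scaleC_right)

text \<open>Reduces the complex inner product to the real one, so that continuity, polarization and
  orthogonality can be taken over from real inner product spaces.\<close>

lemma cinner_eq_Complex: "cinner x y = Complex (inner x y) (inner x (\<i> *\<^sub>C (y::'a::chilbert_space)))"
  by (simp add: complex_eq_iff Im_cinner inner_eq_Re_cinner)

lemma continuous_cinner_left: "continuous_on UNIV (\<lambda>x. cinner x (y::'a::chilbert_space))"
  unfolding cinner_eq_Complex Complex_eq by (intro continuous_intros)

lemma bounded_linear_cinner_left: "bounded_linear (\<lambda>x. cinner x (y::'a::chilbert_space))"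
proof (rule bounded_linear_intro[where K = "norm y"])
  show "cinner (r *\<^sub>R x) y = r *\<^sub>R cinner x y" for r x
    using cinner_scaleC_left[of "of_real r" x y] by (simp add: scaleC_of_real scaleR_conv_of_real)
qed (simp_all add: cinner_add_left norm_cinner_le)

lemma bounded_linear_scaleC: "bounded_linear (\<lambda>x. c *\<^sub>C (x::'a::chilbert_space))"
  by (rule bounded_linear_intro[where K = "cmod c"])
    (simp_all add: scaleC_add_right norm_scaleC scaleC_scaleR_commute)

subsection \<open>Subspaces and linear maps\<close>

lemma csubspaceD:
  assumes "csubspace V"
  shows csubspace_0: "0 \<in> V"
    and csubspace_add: "x \<in> V \<Longrightarrow> y \<in> V \<Longrightarrow> x + y \<in> V"
    and csubspace_scale: "x \<in> V \<Longrightarrow> c *\<^sub>C x \<in> V"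
    and csubspace_scaleR: "x \<in> V \<Longrightarrow> r *\<^sub>R x \<in> V"
    and csubspace_uminus: "x \<in> V \<Longrightarrow> - x \<in> V"
    and csubspace_diff: "x \<in> V \<Longrightarrow> y \<in> V \<Longrightarrow> x - y \<in> V"
proof -
  show "0 \<in> V" and add: "\<And>x y. x \<in> V \<Longrightarrow> y \<in> V \<Longrightarrow> x + y \<in> V"
    and scale: "\<And>c x. x \<in> V \<Longrightarrow> c *\<^sub>C x \<in> V"
    using assms by (auto simp: csubspace_def)
  show "x \<in> V \<Longrightarrow> r *\<^sub>R x \<in> V" for r x
    using scale[of x "of_real r"] by (simp add: scaleC_of_real)
  show neg: "x \<in> V \<Longrightarrow> - x \<in> V" for x
    using scale[of x "-1"] by (simp add: scaleC_minus_one)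
  show "x \<in> V \<Longrightarrow> y \<in> V \<Longrightarrow> x - y \<in> V" for x y
    using add[of x "- y"] neg by simp
qed

lemma csubspace_UNIV [simp]: "csubspace UNIV"
  by (simp add: csubspace_def)

lemma csubspace_Times: "csubspace V \<Longrightarrow> csubspace W \<Longrightarrow> csubspace (V \<times> W)"
  by (simp add: csubspace_def scaleC_prod_def zero_prod_def)

lemma closed_csubspace_Times:
  "closed_csubspace V \<Longrightarrow> closed_csubspace W \<Longrightarrow> closed_csubspace (V \<times> W)"
  by (simp add: closed_csubspace_def csubspace_Times closed_Times)

lemma csubspace_closure: "csubspace V \<Longrightarrow> closed_csubspace (closure V)"
proof -
  assume V: "csubspace V"
  have "x + y \<in> closure V" if "x \<in> closure V" "y \<in> closure V" for x y
  proof -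
    obtain f g where "\<And>n. f n \<in> V" "f \<longlonglongrightarrow> x" "\<And>n. g n \<in> V" "g \<longlonglongrightarrow> y"
      using \<open>x \<in> _\<close> \<open>y \<in> _\<close> unfolding closure_sequential by blast
    then show ?thesis
      unfolding closure_sequential
      by (intro exI[of _ "\<lambda>n. f n + g n"]) (auto intro: tendsto_add csubspace_add[OF V])
  qed
  moreover have "c *\<^sub>C x \<in> closure V" if "x \<in> closure V" for c x
  proof -
    obtain f where "\<And>n. f n \<in> V" "f \<longlonglongrightarrow> x"
      using \<open>x \<in> _\<close> unfolding closure_sequential by blast
    then show ?thesis
      unfolding closure_sequential
      by (intro exI[of _ "\<lambda>n. c *\<^sub>C f n"])
        (auto intro: bounded_linear.tendsto[OF bounded_linear_scaleC] csubspace_scale[OF V])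
  qed
  ultimately show ?thesis
    using subsetD[OF closure_subset csubspace_0[OF V]]
    unfolding closed_csubspace_def csubspace_def by auto
qed

text \<open>Linearity without bound or codomain: the signals of the linear systems below are handled
  in this form, their norms being controlled by energy identities.\<close>

definition clinear_on :: "'a::chilbert_space set \<Rightarrow> ('a \<Rightarrow> 'b::chilbert_space) \<Rightarrow> bool" where
  "clinear_on V A \<longleftrightarrow> (\<forall>x\<in>V. \<forall>y\<in>V. A (x + y) = A x + A y) \<and> (\<forall>c. \<forall>x\<in>V. A (c *\<^sub>C x) = c *\<^sub>C A x)"

lemma clinear_onD:
  assumes "clinear_on V A" "x \<in> V"
  shows clinear_on_add: "y \<in> V \<Longrightarrow> A (x + y) = A x + A y"
    and clinear_on_scale: "A (c *\<^sub>C x) = c *\<^sub>C A x"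
    and clinear_on_scaleR: "A (r *\<^sub>R x) = r *\<^sub>R A x"
    and clinear_on_diff: "csubspace V \<Longrightarrow> y \<in> V \<Longrightarrow> A (x - y) = A x - A y"
proof -
  show add: "\<And>y. y \<in> V \<Longrightarrow> A (x + y) = A x + A y" and scale: "\<And>c. A (c *\<^sub>C x) = c *\<^sub>C A x"
    using assms by (auto simp: clinear_on_def)
  show "A (r *\<^sub>R x) = r *\<^sub>R A x"
    using scale[of "of_real r"] by (simp add: scaleC_of_real)
  assume V: "csubspace V" and y: "y \<in> V"
  have "A ((- 1) *\<^sub>C y) = (- 1) *\<^sub>C A y"
    using assms(1) y unfolding clinear_on_def by blast
  then show "A (x - y) = A x - A y"
    using add[of "- y"] csubspace_uminus[OF V y] by (simp add: scaleC_minus_one)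
qed

lemma clinear_on_subset: "clinear_on V A \<Longrightarrow> W \<subseteq> V \<Longrightarrow> clinear_on W A"
  by (auto simp: clinear_on_def subset_iff)

lemma clinear_on_Pair:
  "clinear_on V A \<Longrightarrow> clinear_on V B \<Longrightarrow> clinear_on V (\<lambda>x. (A x, B x))"
  by (simp add: clinear_on_def scaleC_prod_def)

lemma clinear_on_compose:
  "clinear_on V A \<Longrightarrow> clinear_on W B \<Longrightarrow> A ` V \<subseteq> W \<Longrightarrow> clinear_on V (\<lambda>x. B (A x))"
  by (auto simp: clinear_on_def image_subset_iff)

lemma clinear_on_compose_UNIV:
  "clinear_on V A \<Longrightarrow> clinear_on UNIV B \<Longrightarrow> clinear_on V (\<lambda>x. B (A x))"
  by (rule clinear_on_compose) auto

lemma clinear_on_plus: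
  "clinear_on V A \<Longrightarrow> clinear_on V B \<Longrightarrow> clinear_on V (\<lambda>x. A x + B x)"
  by (simp add: clinear_on_def scaleC_add_right)

lemma clinear_on_minus:
  "clinear_on V A \<Longrightarrow> clinear_on V B \<Longrightarrow> clinear_on V (\<lambda>x. A x - B x)"
  by (simp add: clinear_on_def scaleC_diff_right)

lemma clinear_on_0 [simp]: "clinear_on V (\<lambda>x. 0)"
  by (simp add: clinear_on_def)

lemma clinear_on_id [simp]: "clinear_on V (\<lambda>x. x)"
  by (simp add: clinear_on_def)

lemma clinear_on_fst [simp]: "clinear_on V fst"
  by (simp add: clinear_on_def scaleC_prod_def)

lemma clinear_on_snd [simp]: "clinear_on V snd"
  by (simp add: clinear_on_def scaleC_prod_def)

lemma clinear_on_vec_nth [simp]: "clinear_on V (\<lambda>v. v $ i)"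
  by (simp add: clinear_on_def scaleC_vec_def)

lemma clinear_on_vec_lambda:
  "(\<And>i. clinear_on V (\<lambda>v. A v i)) \<Longrightarrow> clinear_on V (\<lambda>v. \<chi> i. A v i)"
  by (simp add: clinear_on_def scaleC_vec_def vec_eq_iff)

lemma bounded_clinear_on_iff:
  "bounded_clinear_on V W A \<longleftrightarrow> A ` V \<subseteq> W \<and> clinear_on V A \<and> (\<exists>K. \<forall>x\<in>V. norm (A x) \<le> K * norm x)"
  unfolding bounded_clinear_on_def clinear_on_def by blast

lemma bounded_clinear_on_imp_clinear_on: "bounded_clinear_on V W A \<Longrightarrow> clinear_on V A"
  by (simp add: bounded_clinear_on_iff)

lemma bounded_clinear_imp_bounded_linear:
  assumes "bounded_clinear A"
  shows "bounded_linear A"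
proof -
  obtain K where K: "\<And>x. norm (A x) \<le> K * norm x" and lin: "clinear_on UNIV A"
    using assms by (auto simp: bounded_clinear_on_iff)
  show ?thesis
    by (rule bounded_linear_intro[where K = K])
      (use K clinear_on_add[OF lin] clinear_on_scaleR[OF lin] in \<open>auto simp: mult.commute\<close>)
qed

lemma bounded_clinearI:
  assumes "bounded_linear A" "\<And>c x. A (c *\<^sub>C x) = c *\<^sub>C A x"
  shows "bounded_clinear A"
  using bounded_linear.bounded[OF assms(1)] assms(2) linear_add[OF bounded_linear.linear[OF assms(1)]]
  by (auto simp: bounded_clinear_on_def mult.commute)

lemma bounded_clinear_scale: "bounded_clinear A \<Longrightarrow> A (c *\<^sub>C x) = c *\<^sub>C A x"
  by (simp add: bounded_clinear_on_def)

lemma norm_eq_imp_cinner_eq: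
  assumes V: "csubspace V" and A: "clinear_on V A" and B: "clinear_on V B"
    and eq: "\<And>x. x \<in> V \<Longrightarrow> norm (A x) = norm (B x)" and "x \<in> V" "y \<in> V"
  shows "cinner (A x) (A y) = cinner (B x) (B y)"
proof -
  have "inner (A x) (A y) = inner (B x) (B y)" if "x \<in> V" "y \<in> V" for x y
  proof -
    have "(norm (A x + A y))\<^sup>2 = (norm (B x + B y))\<^sup>2"
      using eq[of "x + y"] that csubspace_add[OF V that]
      by (simp add: clinear_on_add[OF A] clinear_on_add[OF B])
    then show ?thesis
      using eq that by (simp add: dot_norm)
  qed
  from this[of x y] this[of x "\<i> *\<^sub>C y"] show ?thesis
    using assms(5,6) csubspace_scale[OF V]
    by (simp add: cinner_eq_Complex clinear_on_scale[OF A] clinear_on_scale[OF B])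
qed

lemma csubspace_image: "csubspace V \<Longrightarrow> clinear_on V A \<Longrightarrow> csubspace (A ` V)"
proof -
  assume V: "csubspace V" and A: "clinear_on V A"
  have "A 0 = 0"
    using clinear_on_scale[OF A csubspace_0[OF V], of 0] by simp
  then have "0 \<in> A ` V"
    using csubspace_0[OF V] by (metis imageI)
  moreover have "A x + A y \<in> A ` V" if "x \<in> V" "y \<in> V" for x y
    using clinear_on_add[OF A that] csubspace_add[OF V that] by (metis imageI)
  moreover have "c *\<^sub>C A x \<in> A ` V" if "x \<in> V" for c x
    using clinear_on_scale[OF A that] csubspace_scale[OF V that] by (metis imageI)
  ultimately show ?thesis
    by (auto simp: csubspace_def)
qed

lemma norm_prod_squared: "(norm x)\<^sup>2 = (norm (fst x))\<^sup>2 + (norm (snd x))\<^sup>2"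
  by (simp add: norm_prod_def)

lemma norm_vec_squared: "(norm v)\<^sup>2 = (\<Sum>i\<in>UNIV. (norm (v $ i :: 'a::chilbert_space))\<^sup>2)"
  by (simp add: norm_vec_def L2_set_def sum_nonneg)

subsection \<open>Projection theorem, Riesz representation, adjoints\<close>

text \<open>A minimizing sequence is Cauchy by the parallelogram law, because the midpoint of two of
  its terms lies in \<open>V\<close> and so is no closer to \<open>x\<close> than the infimum
  \<open>d\<close>.\<close>

lemma nearest_point_exists:
  fixes V :: "'a::{real_inner, banach} set"
  assumes "subspace V" "closed V"
  shows "\<exists>y\<in>V. \<forall>z\<in>V. dist x y \<le> dist x z"
proof -
  define d where "d = infdist x V"
  have ne: "V \<noteq> {}"
    using subspace_0[OF assms(1)] by blast
  have d_le: "d \<le> norm (x - z)" if "z \<in> V" for z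
    using infdist_le[OF that, of x] by (simp add: d_def dist_norm)
  have "\<exists>y\<in>V. norm (x - y) < d + inverse (Suc n)" for n
  proof -
    have "infdist x V < d + inverse (Suc n)"
      by (simp add: d_def)
    then show ?thesis
      using ne cINF_less_iff[OF ne bdd_below_image_dist] by (auto simp: infdist_def dist_norm)
  qed
  then obtain y where y: "\<And>n. y n \<in> V" "\<And>n. norm (x - y n) < d + inverse (Suc n)"
    by metis
  have "Cauchy y"
  proof (rule CauchyI)
    fix e :: real assume "e > 0"
    \<comment> \<open>Chosen so that 4 (d + t)^2 - (2 d)^2 = 8 d t + 4 t^2 is at most
      \<open>c * t\<close> for t between 0 and 1.\<close>
    define c where "c = 8 * d + 4"
    have "d \<ge> 0"
      by (simp add: d_def infdist_nonneg)
    then have "c > 0"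
      by (simp add: c_def)
    obtain M where M: "inverse (Suc M) < e\<^sup>2 / c"
      using reals_Archimedean[of "e\<^sup>2 / c"] \<open>e > 0\<close> \<open>c > 0\<close> by auto
    have "norm (y m - y n) < e" if "m \<ge> M" "n \<ge> M" for m n
    proof -
      define t :: real where "t = inverse (Suc M)"
      have t: "0 < t" "t \<le> 1" "inverse (Suc m) \<le> t" "inverse (Suc n) \<le> t"
        using that by (auto simp: t_def inverse_eq_divide field_simps)
      have half: "(1/2) *\<^sub>R (y m + y n) \<in> V"
        using y(1) assms(1) by (simp add: subspace_add subspace_scale)
      have "(x - y m) + (x - y n) = 2 *\<^sub>R (x - (1/2) *\<^sub>R (y m + y n))"
        by (simp add: algebra_simps flip: scaleR_2)
      then have "norm ((x - y m) + (x - y n)) = 2 * norm (x - (1/2) *\<^sub>R (y m + y n))"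
        by simp
      then have lower: "2 * d \<le> norm ((x - y m) + (x - y n))"
        using d_le[OF half] by simp
      have sq: "(norm (x - y k))\<^sup>2 \<le> (d + t)\<^sup>2" if "inverse (Suc k) \<le> t" for k
        using y(2)[of k] that by (intro power_mono) auto
      have "(norm (y m - y n))\<^sup>2 = 2 * (norm (x - y m))\<^sup>2 + 2 * (norm (x - y n))\<^sup>2
          - (norm ((x - y m) + (x - y n)))\<^sup>2"
        by (simp add: power2_norm_eq_inner inner_diff_left inner_diff_right inner_add_left inner_add_right
            inner_commute algebra_simps)
      also have "\<dots> \<le> 4 * (d + t)\<^sup>2 - (2 * d)\<^sup>2"
        using sq[OF t(3)] sq[OF t(4)] power_mono[OF lower, of 2] \<open>d \<ge> 0\<close> by linarith
      also have "\<dots> = 8 * d * t + 4 * t * t"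
        by (simp add: power2_eq_square algebra_simps)
      also have "\<dots> \<le> 8 * d * t + 4 * t * 1"
        using t by (intro add_left_mono mult_left_mono) auto
      also have "\<dots> = c * t"
        by (simp add: c_def algebra_simps)
      also have "\<dots> < e\<^sup>2"
        using M \<open>c > 0\<close> by (simp add: t_def field_simps)
      finally show ?thesis
        using \<open>e > 0\<close> by (simp add: power2_less_imp_less)
    qed
    then show "\<exists>M. \<forall>m\<ge>M. \<forall>n\<ge>M. norm (y m - y n) < e"
      by blast
  qed
  then obtain l where l: "y \<longlonglongrightarrow> l"
    by (auto simp: Cauchy_convergent_iff convergent_def)
  have "norm (x - l) \<le> d"
  proof (rule LIMSEQ_le)
    show "(\<lambda>n. norm (x - y n)) \<longlonglongrightarrow> norm (x - l)"
      by (intro tendsto_intros l)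
    show "(\<lambda>n. d + inverse (real (Suc n))) \<longlonglongrightarrow> d"
      using LIMSEQ_inverse_real_of_nat_add[of d] by simp
  qed (use y(2) less_imp_le in blast)
  moreover have "l \<in> V"
    using closed_sequentially[OF assms(2) _ l] y(1) by blast
  ultimately show ?thesis
    using d_le by (intro bexI[of _ l]) (auto simp: dist_norm intro: order_trans)
qed

text \<open>The variational inequality at the nearest point, applied to \<open>y + z\<close> and
  \<open>y - z\<close>, bounds the inner product with \<open>z\<close> from both sides by 0.\<close>

lemma real_projection_exists:
  fixes V :: "'a::{real_inner, banach} set"
  assumes "subspace V" "closed V"
  shows "\<exists>y\<in>V. \<forall>z\<in>V. inner (x - y) z = 0"
proof -
  obtain y where y: "y \<in> V" "\<forall>z\<in>V. dist x y \<le> dist x z"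
    using nearest_point_exists[OF assms] by blast
  have le: "inner (x - y) z \<le> 0" if "z \<in> V" for z
    using any_closest_point_dot[OF subspace_imp_convex[OF assms(1)] assms(2) y(1) _ y(2), of "y + z"]
      subspace_add[OF assms(1) y(1) that] by simp
  have "inner (x - y) z = 0" if "z \<in> V" for z
    using le[OF that] le[OF subspace_neg[OF assms(1) that]] by simp
  then show ?thesis
    using y(1) by blast
qed

lemma csubspace_imp_subspace: "csubspace V \<Longrightarrow> subspace V"
  by (simp add: subspace_def csubspaceD)

text \<open>Real orthogonality to a complex subspace is complex orthogonality, since the subspace is
  closed under multiplication by \<open>\<i>\<close>.\<close>

lemma projection_exists:
  assumes "closed_csubspace V"
  shows "\<exists>y\<in>V. \<forall>z\<in>V. cinner (x - y) z = 0"
proof -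
  have V: "csubspace V" "closed V"
    using assms by (auto simp: closed_csubspace_def)
  obtain y where "y \<in> V" "\<And>z. z \<in> V \<Longrightarrow> inner (x - y) z = 0"
    using real_projection_exists[OF csubspace_imp_subspace[OF V(1)] V(2)] by blast
  then show ?thesis
    using csubspace_scale[OF V(1)] by (intro bexI[of _ y]) (auto simp: cinner_eq_Complex complex_eq_iff)
qed

lemma real_riesz:
  fixes f :: "'a::{real_inner, banach} \<Rightarrow> real"
  assumes "bounded_linear f"
  shows "\<exists>y. \<forall>x. f x = inner x y"
proof (cases "\<forall>x. f x = 0")
  case True
  then show ?thesis
    by (intro exI[of _ 0]) simp
next
  case False
  interpret f: bounded_linear f
    by (rule assms)
  obtain a where a: "f a \<noteq> 0"
    using False by blast
  have "subspace {x. f x = 0}"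
    by (simp add: subspace_def f.zero f.add f.scaleR)
  moreover have "closed {x. f x = 0}"
    by (intro closed_Collect_eq continuous_on_const f.continuous_on continuous_on_id)
  ultimately obtain b where b: "f b = 0" "\<And>z. f z = 0 \<Longrightarrow> inner (a - b) z = 0"
    using real_projection_exists[of "{x. f x = 0}" a] by auto
  \<comment> \<open>\<open>u\<close> is the component of \<open>a\<close> orthogonal to the kernel
    of \<open>f\<close>. As \<open>x - (f x / f u) *\<^sub>R u\<close> lies in that kernel, pairing
    it with \<open>u\<close> determines \<open>f x\<close>.\<close>
  define u where "u = a - b"
  have fu: "f u = f a"
    by (simp add: u_def f.diff b)
  then have "inner u u \<noteq> 0"
    using a f.zero by auto
  have "f x = inner x ((f u / inner u u) *\<^sub>R u)" for x
  proof -
    have "inner u (x - (f x / f u) *\<^sub>R u) = 0"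
      using b(2)[of "x - (f x / f u) *\<^sub>R u"] fu a by (simp add: u_def[symmetric] f.diff f.scaleR)
    then show ?thesis
      using fu a \<open>inner u u \<noteq> 0\<close> by (simp add: inner_diff_right inner_commute field_simps)
  qed
  then show ?thesis
    by blast
qed

text \<open>The real Riesz theorem represents the real part of the functional; complex linearity of
  \<open>A\<close>, used at \<open>\<i> *\<^sub>C x\<close>, shows that the same vector represents
  the imaginary part.\<close>

lemma cadjoint_exists:
  assumes "bounded_clinear A"
  shows "\<exists>B. \<forall>x y. cinner (A x) y = cinner x (B y)"
proof -
  have A: "bounded_linear A"
    using assms by (rule bounded_clinear_imp_bounded_linear)
  have "\<exists>z. \<forall>x. cinner (A x) y = cinner x z" for y
  proof -
    obtain z where z: "\<And>x. inner (A x) y = inner x z"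
      using real_riesz[OF bounded_linear_compose[OF bounded_linear_inner_left A], of y] by blast
    have "cinner (A x) y = cinner x z" for x
    proof (rule complex_eqI)
      show "Re (cinner (A x) y) = Re (cinner x z)"
        using z[of x] by (simp add: inner_eq_Re_cinner)
      show "Im (cinner (A x) y) = Im (cinner x z)"
        using z[of "\<i> *\<^sub>C x"]
        by (simp add: inner_eq_Re_cinner bounded_clinear_scale[OF assms] cinner_scaleC_left)
    qed
    then show ?thesis
      by blast
  qed
  then show ?thesis
    by metis
qed

lemma cadjoint_eqI:
  assumes "\<And>x y. cinner (A x) y = cinner x (B y)"
  shows "cadjoint A = B"
  unfolding cadjoint_def
proof (rule the_equality)
  fix B' assume B': "\<forall>x y. cinner (A x) y = cinner x (B' y)"
  have "cinner z (B' y) = cinner z (B y)" for z y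
    by (rule trans[OF B'[rule_format, symmetric] assms])
  then show "B' = B"
    by (intro ext) (rule cinner_eqI')
qed (use assms in simp)

lemma cinner_cadjoint:
  assumes "bounded_clinear A"
  shows "cinner x (cadjoint A y) = cinner (A x) y"
proof -
  obtain B where B: "\<And>x y. cinner (A x) y = cinner x (B y)"
    using cadjoint_exists[OF assms] by blast
  then have "cadjoint A = B"
    by (rule cadjoint_eqI)
  then show ?thesis
    by (simp add: B)
qed

lemma cinner_cadjoint':
  assumes "bounded_clinear A"
  shows "cinner (cadjoint A y) x = cinner y (A x)"
  using cinner_cadjoint[OF assms, of x y] cinner_commute[of x "cadjoint A y"]
    cinner_commute[of "A x" y] by simp

text \<open>The square of the norm of the adjoint at y equals the inner product of
  \<open>A (cadjoint A y)\<close> with y; Cauchy-Schwarz and cancelling one factor give the bound.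
  It keeps the constant \<open>K\<close>, so that contractions have contractive adjoints.\<close>

lemma
  assumes A: "bounded_clinear A"
  shows bounded_clinear_cadjoint: "bounded_clinear (cadjoint A)"
    and norm_cadjoint_le: "0 \<le> K \<Longrightarrow> (\<And>x. norm (A x) \<le> K * norm x) \<Longrightarrow> norm (cadjoint A y) \<le> K * norm y"
proof -
  show bound: "norm (cadjoint A y) \<le> K * norm y" if "0 \<le> K" and K: "\<And>x. norm (A x) \<le> K * norm x" for K y
  proof (cases "cadjoint A y = 0")
    case True
    then show ?thesis
      using \<open>0 \<le> K\<close> by simp
  next
    case False
    have "(norm (cadjoint A y))\<^sup>2 = cmod (cinner (cadjoint A y) (cadjoint A y))"
      by (simp only: cinner_self norm_of_real) simp
    also have "\<dots> = cmod (cinner (A (cadjoint A y)) y)"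
      by (simp add: cinner_cadjoint[OF A])
    also have "\<dots> \<le> norm (A (cadjoint A y)) * norm y"
      by (rule norm_cinner_le)
    also have "\<dots> \<le> K * norm (cadjoint A y) * norm y"
      by (intro mult_right_mono K) simp
    finally show ?thesis
      using False by (simp add: power2_eq_square mult.commute mult.left_commute)
  qed
  obtain K where K: "\<And>x. norm (A x) \<le> K * norm x" and "0 \<le> K"
    using bounded_linear.nonneg_bounded[OF bounded_clinear_imp_bounded_linear[OF A]]
    by (auto simp: mult.commute)
  have "cadjoint A (x + y) = cadjoint A x + cadjoint A y" for x y
    by (rule cinner_eqI') (simp add: cinner_cadjoint[OF A] cinner_add_right)
  moreover have "cadjoint A (c *\<^sub>C x) = c *\<^sub>C cadjoint A x" for c x
    by (rule cinner_eqI') (simp add: cinner_cadjoint[OF A] cinner_scaleC_right)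
  ultimately show "bounded_clinear (cadjoint A)"
    using bound[OF \<open>0 \<le> K\<close> K] by (auto simp: bounded_clinear_on_def)
qed

lemma bounded_clinear_compose:
  assumes "bounded_clinear A" "bounded_clinear B"
  shows "bounded_clinear (\<lambda>x. A (B x))"
  using assms
  by (intro bounded_clinearI bounded_linear_compose[of A B])
    (simp_all add: bounded_clinear_imp_bounded_linear bounded_clinear_scale)

lemma bounded_clinear_diff:
  assumes "bounded_clinear A" "bounded_clinear B"
  shows "bounded_clinear (\<lambda>x. A x - B x)"
  using assms
  by (intro bounded_clinearI bounded_linear_sub)
    (simp_all add: bounded_clinear_imp_bounded_linear bounded_clinear_scale scaleC_diff_right)

lemma bounded_clinear_id: "bounded_clinear (\<lambda>x. x)"
  by (intro bounded_clinearI) simp_all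

lemma infsum_bounded_linear:
  assumes "bounded_linear h" "f summable_on A"
  shows "infsum (\<lambda>x. h (f x)) A = h (infsum f A)"
  by (rule infsumI[OF has_sum_bounded_linear[OF assms(1) has_sum_infsum[OF assms(2)]]])

section \<open>Square roots of positive operators\<close>

text \<open>Positivity includes that the quadratic form is real. Its reality at \<open>x + y\<close>
  relates the imaginary parts of the two mixed terms, and the same relation for
  \<open>\<i> *\<^sub>C y\<close> relates the real parts.\<close>

lemma positive_op_selfadjoint:
  assumes "positive_op A"
  shows "cinner (A x) y = cinner x (A y)"
proof -
  have A: "bounded_clinear A"
    using assms by (simp add: positive_op_def)
  have lin: "clinear_on UNIV A"
    using A by (rule bounded_clinear_on_imp_clinear_on)
  have real: "Im (cinner (A z) z) = 0" for z
    using assms by (metis complex_nonneg_Reals_iff positive_op_def)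
  have Im: "Im (cinner (A x) y) = - Im (cinner (A y) x)" for x y
    using real[of "x + y"] real[of x] real[of y]
    by (simp add: clinear_on_add[OF lin] cinner_add_left cinner_add_right)
  have "cinner (A y) x = cnj (cinner (A x) y)"
    using Im[of x y] Im[of x "\<i> *\<^sub>C y"]
    by (simp add: complex_eq_iff clinear_on_scale[OF lin] cinner_scaleC_left cinner_scaleC_right)
  then show ?thesis
    using cinner_commute[of x "A y"] by simp
qed

lemma positive_op_nonneg: "positive_op A \<Longrightarrow> 0 \<le> inner (A x) x"
  unfolding positive_op_def inner_eq_Re_cinner by (auto simp: complex_nonneg_Reals_iff)

text \<open>Cauchy-Schwarz for a semidefinite form: along the line from \<open>y\<close> in
  direction \<open>z = A y\<close> the form is a quadratic in \<open>t\<close> with value 0 at 0,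
  and it could become negative unless its slope 2 b, with b the squared norm of \<open>A y\<close>,
  vanishes.\<close>

lemma positive_op_eq_0:
  assumes "positive_op A" "inner (A y) y = 0"
  shows "A y = 0"
proof -
  define z where "z = A y"
  define a where "a = inner (A z) z"
  define b where "b = inner (A y) z"
  have A: "bounded_linear A"
    using assms by (simp add: positive_op_def bounded_clinear_imp_bounded_linear)
  interpret A: bounded_linear A
    by (rule A)
  have sym: "inner (A z) y = b"
    using positive_op_selfadjoint[OF assms(1), of z y]
    by (simp add: inner_eq_Re_cinner b_def) (metis complex_cnj cinner_commute complex.sel(1) cnj.sel(1))
  have a: "0 \<le> a"
    unfolding a_def by (rule positive_op_nonneg[OF assms(1)])
  \<comment> \<open>The minimizer is - b / a when a is positive; a + 1 avoids division by zero and
    still makes the value negative unless b = 0.\<close>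
  define t where "t = - b / (a + 1)"
  have "0 \<le> inner (A (y + t *\<^sub>R z)) (y + t *\<^sub>R z)"
    by (rule positive_op_nonneg[OF assms(1)])
  also have "\<dots> = 2 * t * b + t\<^sup>2 * a"
    using assms(2) sym
    by (simp add: A.add A.scaleR inner_add_left inner_add_right a_def b_def power2_eq_square algebra_simps)
  also have "\<dots> = - (b\<^sup>2 * (a + 2) / (a + 1)\<^sup>2)"
  proof -
    have "a + 1 \<noteq> 0"
      using a by simp
    then show ?thesis
      by (simp add: t_def divide_simps) (simp add: power2_eq_square algebra_simps)
  qed
  finally have "b\<^sup>2 * (a + 2) / (a + 1)\<^sup>2 \<le> 0"
    by simp
  then have "b = 0"
    using a by (auto simp: divide_le_0_iff mult_le_0_iff)
  then show ?thesis
    by (simp add: b_def z_def)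
qed

text \<open>The Taylor coefficients of $\sqrt{1 - x}$.\<close>

definition sqrt_coeff :: "nat \<Rightarrow> real" where
  "sqrt_coeff n = (1/2 gchoose n) * (- 1) ^ n"

lemma sqrt_coeff_0: "sqrt_coeff 0 = 1"
  by (simp add: sqrt_coeff_def)

text \<open>The rising factorial that starts at -1/2 has exactly one negative factor, its
  first.\<close>

lemma sqrt_coeff_Suc: "sqrt_coeff (Suc n) \<le> 0"
proof -
  have "sqrt_coeff (Suc n) = pochhammer (- (1/2)) (Suc n) / fact (Suc n)"
    by (simp add: sqrt_coeff_def gbinomial_pochhammer power_mult_distrib[symmetric] del: pochhammer_Suc)
  also have "\<dots> = - (1/2) * pochhammer (1/2) n / fact (Suc n)"
    by (simp add: pochhammer_rec del: fact_Suc)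
  also have "\<dots> \<le> 0"
    by (simp add: pochhammer_nonneg del: fact_Suc)
  finally show ?thesis .
qed

text \<open>Partial sums are the coefficients of (1 - x)^(1/2) / (1 - x) = (1 - x)^(-1/2), which are
  rising factorials of 1/2 over n!.\<close>

lemma sum_sqrt_coeff_nonneg: "0 \<le> (\<Sum>k\<le>n. sqrt_coeff k)"
proof -
  have "(\<Sum>k\<le>n. sqrt_coeff k) = (- 1) ^ n * (- (1/2) gchoose n)"
    using gbinomial_sum_lower_neg[of "1/2 :: real" n] by (simp add: sqrt_coeff_def)
  also have "\<dots> = pochhammer (1/2) n / fact n"
    by (simp add: gbinomial_pochhammer power_mult_distrib[symmetric])
  finally show ?thesis
    by (simp add: pochhammer_nonneg)
qed

text \<open>The coefficients of the square of sqrt(1 - x), that is, of 1 - x; Vandermonde's identity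
  with 1/2 + 1/2 = 1.\<close>

lemma sqrt_coeff_convolution:
  "(\<Sum>k\<le>n. sqrt_coeff k * sqrt_coeff (n - k)) = (if n = 0 then 1 else if n = 1 then - 1 else 0)"
proof -
  have "(\<Sum>k\<le>n. sqrt_coeff k * sqrt_coeff (n - k))
      = (- 1) ^ n * (\<Sum>k\<in>{0..n}. (1/2 gchoose k) * (1/2 gchoose (n - k)))"
    unfolding sum_distrib_left atMost_atLeast0
    by (intro sum.cong) (auto simp: sqrt_coeff_def power_add[symmetric] algebra_simps)
  also have "(\<Sum>k\<in>{0..n}. (1/2 gchoose k) * (1/2 gchoose (n - k))) = (1 :: real) gchoose n"
    using gbinomial_Vandermonde[of "1/2 :: real" "1/2" n] by simp
  also have "(1 :: real) gchoose n = of_nat (1 choose n)"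
    using binomial_gbinomial[of 1 n, where 'a = real] by simp
  finally show ?thesis
    by (cases n) (auto simp: binomial_eq_0)
qed

text \<open>Only the coefficient of degree 0 is positive, so the absolute partial sums are 2 minus
  the nonnegative partial sums. Convergence on the boundary of the unit disc lets the series be
  applied to operators of norm exactly 1.\<close>

lemma sqrt_coeff_abs_summable: "(\<lambda>n. norm (sqrt_coeff n)) summable_on UNIV"
proof -
  have "(\<Sum>k\<le>n. \<bar>sqrt_coeff k\<bar>) \<le> 2" for n
  proof -
    have "(\<Sum>k\<le>n. \<bar>sqrt_coeff k\<bar>) = 2 - (\<Sum>k\<le>n. sqrt_coeff k)"
      by (induction n) (use sqrt_coeff_Suc in \<open>auto simp: sqrt_coeff_0\<close>)
    then show ?thesis
      using sum_sqrt_coeff_nonneg[of n] by simp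
  qed
  then have "summable (\<lambda>k. \<bar>sqrt_coeff k\<bar>)"
    by (intro summableI_nonneg_bounded[where x = 2])
      (auto intro: order_trans[OF sum_mono2[of "{..n}" "{..<n}" for n]])
  then show ?thesis
    by (simp add: summable_on_UNIV_nonneg_real_iff)
qed

lemma infsum_sqrt_coeff_nonneg: "0 \<le> infsum sqrt_coeff UNIV"
proof -
  have "(sqrt_coeff has_sum infsum sqrt_coeff UNIV) UNIV"
    using Infinite_Sum.abs_summable_summable[OF sqrt_coeff_abs_summable] by simp
  then have "sqrt_coeff sums infsum sqrt_coeff UNIV"
    by (rule has_sum_imp_sums)
  then have "(\<lambda>n. \<Sum>k\<le>n. sqrt_coeff k) \<longlonglongrightarrow> infsum sqrt_coeff UNIV"
    by (simp add: sums_def_le)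
  then show ?thesis
    by (rule LIMSEQ_le_const) (use sum_sqrt_coeff_nonneg in auto)
qed

definition series_sqrt :: "('a::chilbert_space \<Rightarrow> 'a) \<Rightarrow> 'a \<Rightarrow> 'a" where
  "series_sqrt A x = (\<Sum>\<^sub>\<infinity>n. sqrt_coeff n *\<^sub>R ((\<lambda>x. x - A x) ^^ n) x)"

text \<open>The norm condition on I - A makes the series converge. For the squares of the two defect
  operators, I - A is a product of a contraction with its adjoint.\<close>

locale positive_contraction =
  fixes A :: "'a::chilbert_space \<Rightarrow> 'a"
  assumes positive: "positive_op A" and complement_le: "norm (x - A x) \<le> norm x"
begin

definition X where "X x = x - A x"

lemma bounded_clinear_A: "bounded_clinear A"
  using positive by (simp add: positive_op_def)

lemma iterate: "bounded_linear (X ^^ n)" "norm ((X ^^ n) x) \<le> norm x"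
  "(X ^^ n) (c *\<^sub>C x) = c *\<^sub>C (X ^^ n) x" "cinner ((X ^^ n) x) y = cinner x ((X ^^ n) y)"
proof -
  have X: "bounded_clinear X"
    unfolding X_def by (intro bounded_clinear_diff bounded_clinear_id bounded_clinear_A)
  have sa: "cinner (X x) y = cinner x (X y)" for x y
    using positive_op_selfadjoint[OF positive] by (simp add: X_def cinner_diff_left cinner_diff_right)
  show "bounded_linear (X ^^ n)"
    by (induction n) (simp_all add: o_def id_def bounded_linear_compose[OF bounded_clinear_imp_bounded_linear[OF X]])
  show "norm ((X ^^ n) x) \<le> norm x"
    by (induction n) (auto simp: X_def intro: order_trans[OF complement_le])
  show "(X ^^ n) (c *\<^sub>C x) = c *\<^sub>C (X ^^ n) x"
    by (induction n) (simp_all add: bounded_clinear_scale[OF X])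
  show "cinner ((X ^^ n) x) y = cinner x ((X ^^ n) y)"
  proof (induction n arbitrary: y)
    case (Suc n)
    show ?case
      using funpow_swap1[of X n y] by (simp add: sa Suc)
  qed simp
qed

lemma series_sqrt_eq: "series_sqrt A x = (\<Sum>\<^sub>\<infinity>n. sqrt_coeff n *\<^sub>R (X ^^ n) x)"
  by (simp add: series_sqrt_def X_def[abs_def])

lemma abs_summable: "(\<lambda>n. norm (sqrt_coeff n *\<^sub>R (X ^^ n) x)) summable_on UNIV"
proof (rule summable_on_comparison_test)
  show "(\<lambda>n. norm (sqrt_coeff n) * norm x) summable_on UNIV"
    using sqrt_coeff_abs_summable by (rule summable_on_cmult_left)
qed (auto intro: mult_left_mono iterate)

lemma summable: "(\<lambda>n. sqrt_coeff n *\<^sub>R (X ^^ n) x) summable_on UNIV"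
  by (rule Infinite_Sum.abs_summable_summable[OF abs_summable])

text \<open>Cauchy product: the double series is absolutely summable, is regrouped by the total
  degree m + k, and the convolution leaves only I - X, which is \<open>A\<close>.\<close>

lemma series_sqrt_squared: "series_sqrt A (series_sqrt A x) = A x"
proof -
  let ?s = "sqrt_coeff"
  define g where "g = (\<lambda>(m, k). (?s m * ?s k) *\<^sub>R (X ^^ (m + k)) x)"
  have "(\<lambda>z. norm (case z of (m, k) \<Rightarrow> ?s m * ?s k)) summable_on UNIV \<times> UNIV"
    unfolding Infinite_Sum.abs_summable_on_Sigma_iff
    by (auto simp: norm_mult abs_mult infsum_cmult_right'
        intro!: summable_on_cmult_right summable_on_cmult_left
          sqrt_coeff_abs_summable[unfolded real_norm_def])
  then have "(\<lambda>z. norm (case z of (m, k) \<Rightarrow> ?s m * ?s k) * norm x) summable_on UNIV \<times> UNIV"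
    by (rule summable_on_cmult_left)
  then have "(\<lambda>z. norm (g z)) summable_on UNIV \<times> UNIV"
    by (rule summable_on_comparison_test) (auto simp: g_def intro!: mult_left_mono iterate(2))
  then have g: "g summable_on UNIV \<times> UNIV"
    by (rule abs_summable_summable)
  have "series_sqrt A (series_sqrt A x) = (\<Sum>\<^sub>\<infinity>m. ?s m *\<^sub>R (X ^^ m) (\<Sum>\<^sub>\<infinity>k. ?s k *\<^sub>R (X ^^ k) x))"
    by (simp add: series_sqrt_eq)
  also have "\<dots> = (\<Sum>\<^sub>\<infinity>m. \<Sum>\<^sub>\<infinity>k. g (m, k))"
  proof (rule infsum_cong)
    fix m
    have L: "bounded_linear (\<lambda>y. ?s m *\<^sub>R (X ^^ m) y)"
      by (intro bounded_linear_const_scaleR iterate)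
    have "?s m *\<^sub>R (X ^^ m) (\<Sum>\<^sub>\<infinity>k. ?s k *\<^sub>R (X ^^ k) x) = (\<Sum>\<^sub>\<infinity>k. ?s m *\<^sub>R (X ^^ m) (?s k *\<^sub>R (X ^^ k) x))"
      using infsum_bounded_linear[OF L summable] by (simp add: o_def)
    then show "?s m *\<^sub>R (X ^^ m) (\<Sum>\<^sub>\<infinity>k. ?s k *\<^sub>R (X ^^ k) x) = (\<Sum>\<^sub>\<infinity>k. g (m, k))"
      by (simp add: g_def linear_scale[OF bounded_linear.linear[OF iterate(1)]] funpow_add)
  qed
  also have "\<dots> = infsum g (UNIV \<times> UNIV)"
    using g by (rule infsum_Sigma_banach)
  also have "\<dots> = infsum (\<lambda>(n, k). g (k, n - k)) (Sigma UNIV (\<lambda>n. {..n}))"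
    by (rule infsum_reindex_bij_witness[where i = "\<lambda>(n, k). (k, n - k)" and j = "\<lambda>(m, k). (m + k, m)"]) auto
  also have "\<dots> = (\<Sum>\<^sub>\<infinity>n. \<Sum>\<^sub>\<infinity>k\<in>{..n}. g (k, n - k))"
  proof -
    have "(\<lambda>(n, k). g (k, n - k)) summable_on (Sigma UNIV (\<lambda>n. {..n}))"
      using g by (rule summable_on_reindex_bij_witness[where i = "\<lambda>(n, k). (k, n - k)" and j = "\<lambda>(m, k). (m + k, m)", THEN iffD1, rotated -1]) auto
    from infsum_Sigma_banach[OF this] show ?thesis
      by simp
  qed
  also have "\<dots> = (\<Sum>\<^sub>\<infinity>n. (\<Sum>k\<le>n. ?s k * ?s (n - k)) *\<^sub>R (X ^^ n) x)"
    by (intro infsum_cong) (simp add: g_def scaleR_sum_left)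
  also have "\<dots> = (\<Sum>\<^sub>\<infinity>n\<in>{0, 1}. (\<Sum>k\<le>n. ?s k * ?s (n - k)) *\<^sub>R (X ^^ n) x)"
    by (rule infsum_cong_neutral) (auto simp only: sqrt_coeff_convolution, auto split: if_splits)
  also have "\<dots> = A x"
    by (simp add: sqrt_coeff_convolution X_def sqrt_coeff_0)
  finally show ?thesis .
qed

text \<open>Each \<open>inner ((X ^^ n) x) x\<close> is at most the squared norm of x, with equality
  for n = 0, and all later coefficients are nonpositive. Replacing every term by this bound
  therefore lowers the sum, to the nonnegative sum of the coefficients times the squared
  norm.\<close>

lemma positive_series_sqrt: "positive_op (series_sqrt A)"
proof -
  have "bounded_clinear (series_sqrt A)"
  proof (rule bounded_clinearI)
    show "series_sqrt A (c *\<^sub>C x) = c *\<^sub>C series_sqrt A x" for c x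
      using infsum_bounded_linear[OF bounded_linear_scaleC[of c] summable[of x]]
      by (simp add: series_sqrt_eq iterate o_def scaleC_scaleR_commute)
    show "bounded_linear (series_sqrt A)"
    proof (rule bounded_linear_intro)
      show "series_sqrt A (x + y) = series_sqrt A x + series_sqrt A y" for x y
        by (simp add: series_sqrt_eq linear_add[OF bounded_linear.linear[OF iterate(1)]]
            scaleR_add_right infsum_add summable)
      show "series_sqrt A (r *\<^sub>R x) = r *\<^sub>R series_sqrt A x" for r x
        using infsum_scaleR_right[of r "\<lambda>n. sqrt_coeff n *\<^sub>R (X ^^ n) x" UNIV]
        by (simp add: series_sqrt_eq linear_scale[OF bounded_linear.linear[OF iterate(1)]] mult.commute)
      show "norm (series_sqrt A x) \<le> norm x * (\<Sum>\<^sub>\<infinity>n. norm (sqrt_coeff n))" for x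
      proof -
        have "norm (series_sqrt A x) \<le> (\<Sum>\<^sub>\<infinity>n. norm (sqrt_coeff n *\<^sub>R (X ^^ n) x))"
          unfolding series_sqrt_eq by (rule norm_infsum_bound[OF abs_summable])
        also have "\<dots> \<le> (\<Sum>\<^sub>\<infinity>n. norm (sqrt_coeff n) * norm x)"
          by (intro infsum_mono abs_summable summable_on_cmult_left sqrt_coeff_abs_summable)
            (auto intro: mult_left_mono iterate)
        finally show ?thesis
          by (simp only: infsum_cmult_left' mult.commute[of "norm x"])
      qed
    qed
  qed
  moreover have "cinner (series_sqrt A x) x \<in> \<real>\<^sub>\<ge>\<^sub>0" for x
  proof -
    define \<phi> where "\<phi> n = inner ((X ^^ n) x) x" for n
    have \<phi>: "cinner ((X ^^ n) x) x = of_real (\<phi> n)" for n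
    proof -
      have "cnj (cinner ((X ^^ n) x) x) = cinner ((X ^^ n) x) x"
        using iterate(4)[of n x x] cinner_commute[of "(X ^^ n) x" x] by simp
      then show ?thesis
        by (simp add: \<phi>_def inner_eq_Re_cinner complex_eq_iff)
    qed
    have summ: "(\<lambda>n. sqrt_coeff n * \<phi> n) summable_on UNIV"
      using summable_on_bounded_linear[OF bounded_linear_inner_left[of x] summable[of x]]
      by (simp add: \<phi>_def)
    have "cinner (series_sqrt A x) x = (\<Sum>\<^sub>\<infinity>n. cinner (sqrt_coeff n *\<^sub>R (X ^^ n) x) x)"
      unfolding series_sqrt_eq
      using infsum_bounded_linear[OF bounded_linear_cinner_left[of x] summable[of x]]
      by (simp add: o_def)
    also have "\<dots> = (\<Sum>\<^sub>\<infinity>n. of_real (sqrt_coeff n * \<phi> n))"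
      by (intro infsum_cong) (simp add: cinner_scaleC_left \<phi> flip: scaleC_of_real)
    also have "\<dots> = of_real (\<Sum>\<^sub>\<infinity>n. sqrt_coeff n * \<phi> n)"
      by (rule infsum_bounded_linear[OF bounded_linear_of_real summ])
    finally have eq: "cinner (series_sqrt A x) x = of_real (\<Sum>\<^sub>\<infinity>n. sqrt_coeff n * \<phi> n)" .
    have "0 \<le> infsum sqrt_coeff UNIV * (norm x)\<^sup>2"
      by (simp add: infsum_sqrt_coeff_nonneg)
    also have "\<dots> = (\<Sum>\<^sub>\<infinity>n. sqrt_coeff n * (norm x)\<^sup>2)"
      by (simp add: infsum_cmult_left')
    also have "\<dots> \<le> (\<Sum>\<^sub>\<infinity>n. sqrt_coeff n * \<phi> n)"
    proof (intro infsum_mono summ summable_on_cmult_left Infinite_Sum.abs_summable_summable[OF sqrt_coeff_abs_summable])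
      fix n
      have le: "\<phi> n \<le> (norm x)\<^sup>2"
        using norm_cauchy_schwarz[of "(X ^^ n) x" x] mult_right_mono[OF iterate(2)[of n x], of "norm x"]
        by (simp add: \<phi>_def power2_eq_square)
      show "sqrt_coeff n * (norm x)\<^sup>2 \<le> sqrt_coeff n * \<phi> n"
      proof (cases n)
        case 0
        then show ?thesis
          by (simp add: \<phi>_def power2_norm_eq_inner)
      next
        case (Suc m)
        then show ?thesis
          using le sqrt_coeff_Suc[of m] by (simp add: mult_left_mono_neg)
      qed
    qed
    finally show ?thesis
      unfolding eq by simp
  qed
  ultimately show ?thesis
    by (simp add: positive_op_def)
qed

end

lemma series_sqrt_intertwine:
  assumes "positive_contraction A" "positive_contraction B" "bounded_linear P"
    and "\<And>x. P (A x) = B (P x)"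
  shows "P (series_sqrt A x) = series_sqrt B (P x)"
proof -
  interpret A: positive_contraction A
    by fact
  interpret B: positive_contraction B
    by fact
  interpret P: bounded_linear P
    by fact
  have "P ((A.X ^^ n) x) = (B.X ^^ n) (P x)" for n
    by (induction n) (simp_all add: A.X_def B.X_def P.diff assms(4))
  then show ?thesis
    using infsum_bounded_linear[OF P.bounded_linear_axioms A.summable[of x]]
    by (simp add: A.series_sqrt_eq B.series_sqrt_eq o_def P.scaleR)
qed

context positive_contraction
begin

text \<open>Any positive root B commutes with A = B^2 and hence with the series root. For y = (B -
  R) x, R being the series root, (B + R) y = 0; both quadratic forms are nonnegative, so B y = R y =
  0, and self-adjointness gives y = 0. Thus the definite description in \<open>sqrt_op\<close>
  denotes.\<close>

lemma sqrt_op_eq: "sqrt_op A = series_sqrt A"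
  unfolding sqrt_op_def
proof (rule the_equality)
  show "positive_op (series_sqrt A) \<and> series_sqrt A \<circ> series_sqrt A = A"
    by (auto simp: positive_series_sqrt series_sqrt_squared)
next
  fix B assume B: "positive_op B \<and> B \<circ> B = A"
  let ?R = "series_sqrt A"
  have BB: "B (B x) = A x" for x
    using B by (metis comp_apply)
  have R: "positive_op ?R"
    by (rule positive_series_sqrt)
  have lin: "bounded_linear B" "bounded_linear ?R"
    using B R by (auto simp: positive_op_def intro: bounded_clinear_imp_bounded_linear)
  interpret B: bounded_linear B
    by (rule lin)
  interpret R: bounded_linear ?R
    by (rule lin)
  have comm: "B (?R x) = ?R (B x)" for x
    by (rule series_sqrt_intertwine[OF positive_contraction_axioms positive_contraction_axioms lin(1)])
      (simp flip: BB)
  have "B x = ?R x" for x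
  proof -
    define y where "y = B x - ?R x"
    have "B y + ?R y = 0"
      by (simp add: y_def B.diff R.diff comm BB series_sqrt_squared)
    then have "inner (B y) y + inner (?R y) y = 0"
      by (metis inner_add_left inner_zero_left)
    then have "inner (B y) y = 0" "inner (?R y) y = 0"
      using positive_op_nonneg[of B y] positive_op_nonneg[OF R, of y] B by auto
    then have 0: "B y = 0" "?R y = 0"
      using positive_op_eq_0[of B y] positive_op_eq_0[OF R, of y] B by auto
    have "cinner y y = cinner (B x) y - cinner (?R x) y"
      by (subst (1) y_def) (rule cinner_diff_left)
    also have "\<dots> = cinner x (B y) - cinner x (?R y)"
      using positive_op_selfadjoint[of B x y] positive_op_selfadjoint[OF R, of x y] B by simp
    finally have "y = 0"
      using 0 by simp
    then show ?thesis
      by (simp add: y_def)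
  qed
  then show "B = series_sqrt A"
    by blast
qed

lemma positive_sqrt_op: "positive_op (sqrt_op A)"
  by (simp add: sqrt_op_eq positive_series_sqrt)

lemma sqrt_op_squared: "sqrt_op A (sqrt_op A x) = A x"
  by (simp add: sqrt_op_eq series_sqrt_squared)

end

text \<open>Used with \<open>P\<close> the row operator or its adjoint, to move it past the two
  defect operators; \<open>P\<close> may act between different spaces, since the intertwining is
  checked term by term in the power series.\<close>

lemma sqrt_op_intertwine:
  assumes "positive_contraction A" "positive_contraction B" "bounded_linear P"
    and "\<And>x. P (A x) = B (P x)"
  shows "P (sqrt_op A x) = sqrt_op B (P x)"
  using series_sqrt_intertwine[OF assms] assms(1,2) by (simp add: positive_contraction.sqrt_op_eq)

section \<open>Unitaries between closed subspaces\<close>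

lemma unitary_onD:
  assumes "unitary_on V W U"
  shows unitary_on_clinear_on: "clinear_on V U"
    and unitary_on_cinner: "x \<in> V \<Longrightarrow> y \<in> V \<Longrightarrow> cinner (U x) (U y) = cinner x y"
    and unitary_on_norm: "x \<in> V \<Longrightarrow> norm (U x) = norm x"
    and unitary_on_mem: "x \<in> V \<Longrightarrow> U x \<in> W"
    and unitary_on_image: "U ` V = W"
    and unitary_on_bounded: "bounded_clinear_on V W U"
proof -
  show "clinear_on V U" "U ` V = W" "x \<in> V \<Longrightarrow> U x \<in> W" "bounded_clinear_on V W U"
    using assms by (auto simp: unitary_on_def bounded_clinear_on_iff)
  show 1: "x \<in> V \<Longrightarrow> y \<in> V \<Longrightarrow> cinner (U x) (U y) = cinner x y" for x y
    using assms by (auto simp: unitary_on_def)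
  show "norm (U x) = norm x" if "x \<in> V"
  proof -
    have "(norm (U x))\<^sup>2 = (norm x)\<^sup>2"
      using 1[OF that that] unfolding cinner_self of_real_eq_iff .
    then show ?thesis
      by (simp add: power2_eq_iff_nonneg)
  qed
qed

lemma unitary_onI:
  assumes V: "csubspace V" and U: "clinear_on V U" and norm: "\<And>x. x \<in> V \<Longrightarrow> norm (U x) = norm x"
    and image: "U ` V = W"
  shows "unitary_on V W U"
  using norm_eq_imp_cinner_eq[OF V U clinear_on_id] norm image U
  by (auto simp: unitary_on_def bounded_clinear_on_iff intro: exI[of _ 1])

lemma unitary_on_inverse:
  assumes V: "csubspace V" and U: "unitary_on V W U"
  obtains U' where "unitary_on W V U'" "\<forall>x\<in>V. U' (U x) = x" "\<forall>y\<in>W. U (U' y) = y"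
proof -
  note lin = unitary_on_clinear_on[OF U]
  have inj: "inj_on U V"
  proof (rule inj_onI)
    fix x y assume xy: "x \<in> V" "y \<in> V" "U x = U y"
    have "norm (x - y) = norm (U x - U y)"
      using unitary_on_norm[OF U csubspace_diff[OF V xy(1,2)]] clinear_on_diff[OF lin xy(1) V xy(2)]
      by simp
    then show "x = y"
      using xy by simp
  qed
  define U' where "U' = inv_into V U"
  have 1: "U' (U x) = x" if "x \<in> V" for x
    using inj that by (simp add: U'_def)
  have 2: "U (U' y) = y" "U' y \<in> V" if "y \<in> W" for y
    using that unitary_on_image[OF U] by (auto simp: U'_def f_inv_into_f inv_into_into)
  have W: "csubspace W"
    using csubspace_image[OF V lin] unitary_on_image[OF U] by simp
  have "unitary_on W V U'"
  proof (rule unitary_onI[OF W])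
    show "clinear_on W U'"
      unfolding clinear_on_def
    proof (intro conjI ballI allI)
      fix x y assume "x \<in> W" "y \<in> W"
      then show "U' (x + y) = U' x + U' y"
        using 1[of "U' x + U' y"] csubspace_add[OF V, of "U' x" "U' y"] 2
          clinear_on_add[OF lin, of "U' x" "U' y"] by simp
    next
      fix c x assume "x \<in> W"
      then show "U' (c *\<^sub>C x) = c *\<^sub>C U' x"
        using 1[of "c *\<^sub>C U' x"] csubspace_scale[OF V, of "U' x"] 2
          clinear_on_scale[OF lin, of "U' x"] by simp
    qed
    show "norm (U' y) = norm y" if "y \<in> W" for y
      using unitary_on_norm[OF U 2(2)[OF that]] 2(1)[OF that] by simp
    show "U' ` W = V"
      using 1 2 unitary_on_mem[OF U] by (auto simp: image_iff) metis
  qed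
  then show thesis
    using 1 2 that by blast
qed

text \<open>\<open>J\<close> has as graph the closure \<open>R\<close> of the pairs
  \<open>(A x, B x)\<close>. Equal norms make each coordinate sequence Cauchy as soon as the other
  one is, so \<open>R\<close> relates every point of either closure to one of the other.\<close>

lemma isometry_extension:
  assumes L: "csubspace L" and A: "clinear_on L A" and B: "clinear_on L B"
    and eq: "\<And>x. x \<in> L \<Longrightarrow> norm (A x) = norm (B x)"
  obtains J where "unitary_on (closure (A ` L)) (closure (B ` L)) J" "\<And>x. x \<in> L \<Longrightarrow> J (A x) = B x"
proof -
  define R where "R y z \<longleftrightarrow> (\<exists>s. (\<forall>n. s n \<in> L) \<and> (\<lambda>n. A (s n)) \<longlonglongrightarrow> y \<and> (\<lambda>n. B (s n)) \<longlonglongrightarrow> z)" for y z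
  have conv: "convergent (\<lambda>n. G (s n))"
    if F: "clinear_on L F" and G: "clinear_on L G" and FG: "\<And>x. x \<in> L \<Longrightarrow> norm (F x) = norm (G x)"
      and s: "\<And>n. s n \<in> L" and conv: "convergent (\<lambda>n. F (s n))"
    for F :: "_ \<Rightarrow> 'd::chilbert_space" and G :: "_ \<Rightarrow> 'e::chilbert_space" and s
  proof -
    have "norm (F (s m) - F (s n)) = norm (G (s m) - G (s n))" for m n
      using FG[OF csubspace_diff[OF L s s], of m n]
      by (simp add: clinear_on_diff[OF F s L s] clinear_on_diff[OF G s L s])
    then show ?thesis
      using conv unfolding Cauchy_convergent_iff[symmetric] Cauchy_iff by simp
  qed
  have ex1: "\<exists>z. R y z" if y: "y \<in> closure (A ` L)" for y
  proof -
    obtain f where f: "\<And>n. f n \<in> A ` L" "f \<longlonglongrightarrow> y"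
      using y unfolding closure_sequential by blast
    have "\<forall>n. \<exists>x. x \<in> L \<and> f n = A x"
      using f(1) by blast
    then obtain s where s: "\<And>n. s n \<in> L" "\<And>n. f n = A (s n)"
      by metis
    have lim: "(\<lambda>n. A (s n)) \<longlonglongrightarrow> y"
      using f(2) by (simp flip: s(2))
    then have "convergent (\<lambda>n. B (s n))"
      using conv[OF A B eq, of s] s(1) lim by (auto simp: convergent_def)
    then show ?thesis
      using s(1) lim by (auto simp: R_def convergent_def)
  qed
  have ex2: "\<exists>y. R y z" if z: "z \<in> closure (B ` L)" for z
  proof -
    obtain f where f: "\<And>n. f n \<in> B ` L" "f \<longlonglongrightarrow> z"
      using z unfolding closure_sequential by blast
    have "\<forall>n. \<exists>x. x \<in> L \<and> f n = B x"
      using f(1) by blast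
    then obtain s where s: "\<And>n. s n \<in> L" "\<And>n. f n = B (s n)"
      by metis
    have lim: "(\<lambda>n. B (s n)) \<longlonglongrightarrow> z"
      using f(2) by (simp flip: s(2))
    then have "convergent (\<lambda>n. A (s n))"
      using conv[OF B A eq[symmetric], of s] s(1) lim by (auto simp: convergent_def)
    then show ?thesis
      using s(1) lim by (auto simp: R_def convergent_def)
  qed
  have R_closure: "y \<in> closure (A ` L)" "z \<in> closure (B ` L)" if yz: "R y z" for y z
  proof -
    obtain s where s: "\<And>n. s n \<in> L" "(\<lambda>n. A (s n)) \<longlonglongrightarrow> y" "(\<lambda>n. B (s n)) \<longlonglongrightarrow> z"
      using yz by (auto simp: R_def)
    show "y \<in> closure (A ` L)"
      unfolding closure_sequential by (rule exI[of _ "\<lambda>n. A (s n)"]) (use s in auto)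
    show "z \<in> closure (B ` L)"
      unfolding closure_sequential by (rule exI[of _ "\<lambda>n. B (s n)"]) (use s in auto)
  qed
  have R_norm: "norm y = norm z" if yz: "R y z" for y z
  proof -
    obtain s where s: "\<And>n. s n \<in> L" "(\<lambda>n. A (s n)) \<longlonglongrightarrow> y" "(\<lambda>n. B (s n)) \<longlonglongrightarrow> z"
      using yz by (auto simp: R_def)
    show ?thesis
      using tendsto_norm[OF s(2)] tendsto_norm[OF s(3)] eq[OF s(1)] by (simp add: LIMSEQ_unique)
  qed
  have R_add: "R (y + y') (z + z')" if yz: "R y z" "R y' z'" for y y' z z'
  proof -
    obtain s s' where "\<And>n. s n \<in> L" "(\<lambda>n. A (s n)) \<longlonglongrightarrow> y" "(\<lambda>n. B (s n)) \<longlonglongrightarrow> z"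
      "\<And>n. s' n \<in> L" "(\<lambda>n. A (s' n)) \<longlonglongrightarrow> y'" "(\<lambda>n. B (s' n)) \<longlonglongrightarrow> z'"
      using yz by (auto simp: R_def)
    then show ?thesis
      unfolding R_def
      by (intro exI[of _ "\<lambda>n. s n + s' n"])
        (auto simp: csubspace_add[OF L] clinear_on_add[OF A] clinear_on_add[OF B] intro: tendsto_add)
  qed
  have R_scale: "R (c *\<^sub>C y) (c *\<^sub>C z)" if yz: "R y z" for c y z
  proof -
    obtain s where "\<And>n. s n \<in> L" "(\<lambda>n. A (s n)) \<longlonglongrightarrow> y" "(\<lambda>n. B (s n)) \<longlonglongrightarrow> z"
      using yz by (auto simp: R_def)
    then show ?thesis
      unfolding R_def
      by (intro exI[of _ "\<lambda>n. c *\<^sub>C s n"])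
        (auto simp: csubspace_scale[OF L] clinear_on_scale[OF A] clinear_on_scale[OF B]
          intro: bounded_linear.tendsto[OF bounded_linear_scaleC])
  qed
  \<comment> \<open>Subtracting the two pairs relates 0 to \<open>z - z'\<close>, and related
    vectors have equal norms.\<close>
  have R_unique: "z = z'" if "R y z" "R y z'" for y z z'
    using R_norm[OF R_add[OF that(1) R_scale[OF that(2), of "-1"]]]
    by (simp add: scaleC_minus_one)
  define J where "J y = (SOME z. R y z)" for y
  have J_eq: "J y = z" if "R y z" for y z
    unfolding J_def using that R_unique by blast
  have RJ: "R y (J y)" if "y \<in> closure (A ` L)" for y
    unfolding J_def using ex1[OF that] by (rule someI_ex)
  have clA: "csubspace (closure (A ` L))"
    using csubspace_closure[OF csubspace_image[OF L A]] by (simp add: closed_csubspace_def)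
  have "unitary_on (closure (A ` L)) (closure (B ` L)) J"
  proof (rule unitary_onI[OF clA])
    show "clinear_on (closure (A ` L)) J"
      unfolding clinear_on_def by (intro conjI ballI allI J_eq R_add R_scale RJ)
    show "J ` closure (A ` L) = closure (B ` L)"
    proof
      show "J ` closure (A ` L) \<subseteq> closure (B ` L)"
        using R_closure(2) RJ by blast
      show "closure (B ` L) \<subseteq> J ` closure (A ` L)"
      proof
        fix z assume "z \<in> closure (B ` L)"
        then obtain y where "R y z"
          using ex2 by blast
        then show "z \<in> J ` closure (A ` L)"
          using J_eq R_closure(1) by (intro image_eqI[of _ _ y]) auto
      qed
    qed
    show "norm (J y) = norm y" if "y \<in> closure (A ` L)" for y
      using R_norm[OF RJ[OF that]] by simp
  qed
  moreover have "J (A x) = B x" if "x \<in> L" for x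
    by (rule J_eq) (use that in \<open>auto simp: R_def intro!: exI[of _ "\<lambda>n. x"]\<close>)
  ultimately show thesis
    using that by blast
qed

lemma csubspace_kernel:
  assumes V: "csubspace V" and A: "clinear_on V A"
  shows "csubspace {v \<in> V. A v = 0}"
  using clinear_on_scale[OF A csubspace_0[OF V], of 0]
  by (auto simp: csubspace_def clinear_on_add[OF A] clinear_on_scale[OF A] csubspaceD[OF V])

text \<open>\<open>V\<close> splits into \<open>B\<close> and its orthogonal complement;
  \<open>U\<close> undoes \<open>J\<close> on \<open>B\<close> and applies \<open>\<phi>\<close> to
  the complement. The isometry \<open>\<phi>\<close> places the complement in a prescribed type,
  which is where the auxiliary spaces of the factorization come from.\<close>

lemma unitary_complement:
  fixes J :: "'a::chilbert_space \<Rightarrow> 'v::chilbert_space" and \<phi> :: "'v \<Rightarrow> 'e::chilbert_space"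
  assumes A: "closed_csubspace A" and J: "unitary_on A B J" and BV: "B \<subseteq> V" and B: "closed B"
    and V: "closed_csubspace V"
    and \<phi>: "bounded_clinear \<phi>" "\<And>v. v \<in> V \<Longrightarrow> norm (\<phi> v) = norm v"
  obtains E U where "closed_csubspace E" "E \<subseteq> \<phi> ` V" "unitary_on V (A \<times> E) U"
    "\<And>a. a \<in> A \<Longrightarrow> U (J a) = (a, 0)"
proof -
  have sA: "csubspace A" and sV: "csubspace V" "closed V"
    using A V by (auto simp: closed_csubspace_def)
  have sB: "closed_csubspace B"
    using csubspace_image[OF sA unitary_on_clinear_on[OF J]] unitary_on_image[OF J] B
    by (simp add: closed_csubspace_def)
  have lin\<phi>: "clinear_on UNIV \<phi>"
    using \<phi>(1) by (rule bounded_clinear_on_imp_clinear_on)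
  define E0 where "E0 = {v \<in> V. \<forall>b\<in>B. cinner v b = 0}"
  have E0V: "E0 \<subseteq> V"
    by (auto simp: E0_def)
  have sE0: "csubspace E0"
    using sV(1) by (auto simp: csubspace_def E0_def cinner_add_left cinner_scaleC_left)
  have "closed {v. cinner v b = 0}" for b
    by (intro closed_Collect_eq continuous_on_const continuous_cinner_left)
  then have "closed (V \<inter> (\<Inter>b\<in>B. {v. cinner v b = 0}))"
    by (intro closed_Int closed_INT sV) auto
  also have "V \<inter> (\<Inter>b\<in>B. {v. cinner v b = 0}) = E0"
    by (auto simp: E0_def)
  finally have cE0: "closed E0" .
  \<comment> \<open>An isometric linear image of a complete subspace is complete, so the transported
    complement is closed.\<close>
  have "complete (\<phi> ` E0)"
  proof (rule complete_isometric_image[of 1])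
    show "\<forall>x\<in>E0. norm (\<phi> x) \<ge> 1 * norm x"
      using \<phi>(2) E0V by auto
  qed (use csubspace_imp_subspace[OF sE0] bounded_clinear_imp_bounded_linear[OF \<phi>(1)] cE0
      in \<open>auto simp: complete_eq_closed\<close>)
  then have cE: "closed_csubspace (\<phi> ` E0)"
    using csubspace_image[OF sE0 clinear_on_subset[OF lin\<phi>]]
    by (simp add: closed_csubspace_def complete_eq_closed)
  \<comment> \<open>\<open>U\<close> is the isometry from values of \<open>P\<close> to values of
    \<open>Q\<close>. Both ranges are closed, so the extension to closures is a map on all of
    \<open>V\<close>.\<close>
  define L where "L = A \<times> E0"
  have sL: "csubspace L"
    unfolding L_def by (intro csubspace_Times sA sE0)
  define P where "P = (\<lambda>x. J (fst x) + snd x)"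
  define Q where "Q = (\<lambda>x :: 'a \<times> 'v. (fst x, \<phi> (snd x)))"
  have linJ: "clinear_on L (\<lambda>x. J (fst x))"
    by (rule clinear_on_compose[OF clinear_on_fst unitary_on_clinear_on[OF J]]) (auto simp: L_def)
  have linP: "clinear_on L P"
    unfolding P_def by (intro clinear_on_plus linJ clinear_on_snd)
  have linQ: "clinear_on L Q"
    unfolding Q_def by (intro clinear_on_Pair clinear_on_compose_UNIV[OF _ lin\<phi>]) auto
  have norm: "norm (P x) = norm (Q x)" if "x \<in> L" for x
  proof -
    obtain a e where x: "x = (a, e)" "a \<in> A" "e \<in> E0"
      using \<open>x \<in> L\<close> by (auto simp: L_def)
    have "cinner e (J a) = 0"
      using x(3) unitary_on_mem[OF J x(2)] by (simp add: E0_def)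
    then have "inner e (J a) = 0"
      by (simp add: inner_eq_Re_cinner)
    then have "(norm (J a + e))\<^sup>2 = (norm (J a))\<^sup>2 + (norm e)\<^sup>2"
      by (simp add: power2_norm_eq_inner inner_add_left inner_add_right inner_commute)
    then have "(norm (P x))\<^sup>2 = (norm (Q x))\<^sup>2"
      using \<phi>(2)[of e] x(3) E0V unitary_on_norm[OF J x(2)] by (auto simp: x(1) P_def Q_def norm_prod_def)
    then show ?thesis
      by (simp add: power2_eq_iff_nonneg)
  qed
  have PL: "P ` L = V"
  proof
    show "P ` L \<subseteq> V"
      using E0V BV unitary_on_mem[OF J] by (auto simp: P_def L_def intro!: csubspace_add[OF sV(1)])
    show "V \<subseteq> P ` L"
    proof
      fix v assume v: "v \<in> V"
      obtain b where b: "b \<in> B" "\<And>z. z \<in> B \<Longrightarrow> cinner (v - b) z = 0"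
        using projection_exists[OF sB, of v] by blast
      obtain a where a: "a \<in> A" "b = J a"
        using b(1) unitary_on_image[OF J] by blast
      have "(a, v - b) \<in> L"
        using a b v BV by (auto simp: L_def E0_def intro!: csubspace_diff[OF sV(1)])
      then show "v \<in> P ` L"
        using a by (auto simp: P_def intro!: image_eqI[of _ _ "(a, v - b)"])
    qed
  qed
  have QL: "Q ` L = A \<times> \<phi> ` E0"
    by (auto simp: Q_def L_def image_iff)
  have "closed (A \<times> \<phi> ` E0)"
    using closed_csubspace_Times[OF A cE] by (simp add: closed_csubspace_def)
  then obtain U where U: "unitary_on V (A \<times> \<phi> ` E0) U" "\<And>x. x \<in> L \<Longrightarrow> U (P x) = Q x"
    using isometry_extension[OF sL linP linQ norm] sV(2) unfolding PL QL by (metis closure_closed)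
  have "U (J a) = (a, 0)" if "a \<in> A" for a
    using U(2)[of "(a, 0)"] that csubspace_0[OF sE0] clinear_on_scale[OF lin\<phi>, of 0 0]
    by (simp add: P_def Q_def L_def)
  then show thesis
    using that[OF cE _ U(1)] E0V by blast
qed

section \<open>Row contractions and their Julia operators\<close>

lemma cadjoint_cadjoint:
  assumes "bounded_clinear A"
  shows "cadjoint (cadjoint A) = A"
  by (rule cadjoint_eqI) (rule cinner_cadjoint'[OF assms])

lemma bounded_clinear_row_op:
  assumes "\<And>i. bounded_clinear (T i)"
  shows "bounded_clinear (row_op T)"
proof (rule bounded_clinearI)
  have "bounded_linear (\<lambda>v. \<Sum>i\<in>UNIV. T i (v $ i))"
    by (intro bounded_linear_sum bounded_linear_compose[OF bounded_clinear_imp_bounded_linear[OF assms]]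
        bounded_linear_vec_nth)
  then show "bounded_linear (row_op T)"
    by (simp add: row_op_def[abs_def])
  show "row_op T (c *\<^sub>C v) = c *\<^sub>C row_op T v" for c v
    by (simp add: row_op_def scaleC_vec_def bounded_clinear_scale[OF assms] scaleC_sum_right)
qed

lemma cadjoint_row_op:
  assumes "\<And>i. bounded_clinear (T i)"
  shows "cadjoint (row_op T) x = (\<chi> i. cadjoint (T i) x)"
proof -
  have "cadjoint (row_op T) = (\<lambda>x. \<chi> i. cadjoint (T i) x)"
    by (rule cadjoint_eqI) (simp add: row_op_def cinner_vec_def cinner_sum_left cinner_cadjoint[OF assms])
  then show ?thesis
    by simp
qed

lemma row_op_cadjoint_row_op:
  assumes "\<And>i. bounded_clinear (T i)"
  shows "row_op T (cadjoint (row_op T) x) = (\<Sum>i\<in>UNIV. T i (cadjoint (T i) x))"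
  by (subst cadjoint_row_op[OF assms]) (simp add: row_op_def)

lemma positive_op_defect:
  assumes A: "bounded_clinear A" and le: "\<And>x. norm (A x) \<le> norm x"
  shows "positive_op (\<lambda>x. x - cadjoint A (A x))"
proof -
  have "cinner (x - cadjoint A (A x)) x = of_real ((norm x)\<^sup>2 - (norm (A x))\<^sup>2)" for x
    by (simp add: cinner_diff_left cinner_cadjoint'[OF A] cinner_self)
  moreover have "0 \<le> (norm x)\<^sup>2 - (norm (A x))\<^sup>2" for x
    using le[of x] by (simp add: power_mono)
  moreover have "bounded_clinear (\<lambda>x. x - cadjoint A (A x))"
    by (rule bounded_clinear_diff[OF bounded_clinear_id
          bounded_clinear_compose[OF bounded_clinear_cadjoint[OF A] A]])
  ultimately show ?thesis
    by (simp only: positive_op_def) (simp add: complex_nonneg_Reals_iff del: of_real_diff)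
qed

text \<open>The sum in the definition is the row operator times its adjoint, so positivity says that
  the adjoint is a contraction, and an operator is a contraction exactly when its adjoint
  is.\<close>

lemma row_contraction_iff:
  "row_contraction T \<longleftrightarrow> (\<forall>i. bounded_clinear (T i)) \<and> (\<forall>v. norm (row_op T v) \<le> norm v)"
proof (intro iffI conjI allI)
  fix i assume "row_contraction T"
  then show "bounded_clinear (T i)"
    by (simp add: row_contraction_def)
next
  fix v assume T: "row_contraction T"
  have bT: "bounded_clinear (T i)" for i
    using T by (simp add: row_contraction_def)
  let ?T = "row_op T"
  have b: "bounded_clinear ?T"
    by (rule bounded_clinear_row_op[OF bT])
  have "positive_op (\<lambda>x. x - ?T (cadjoint ?T x))"
    unfolding row_op_cadjoint_row_op[OF bT] using T by (simp add: row_contraction_def)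
  from positive_op_nonneg[OF this]
  have "(norm (cadjoint ?T x))\<^sup>2 \<le> (norm x)\<^sup>2" for x
    by (simp add: inner_diff_left power2_norm_eq_inner)
      (simp add: inner_eq_Re_cinner cinner_cadjoint[OF b])
  then have "norm (cadjoint ?T x) \<le> 1 * norm x" for x
    by (simp add: power2_le_iff_abs_le)
  from norm_cadjoint_le[OF bounded_clinear_cadjoint[OF b] _ this, of v]
  show "norm (row_op T v) \<le> norm v"
    by (simp add: cadjoint_cadjoint[OF b])
next
  assume "(\<forall>i. bounded_clinear (T i)) \<and> (\<forall>v. norm (row_op T v) \<le> norm v)"
  then have bT: "\<And>i. bounded_clinear (T i)" and le: "\<And>v. norm (row_op T v) \<le> norm v"
    by auto
  have b: "bounded_clinear (row_op T)"
    by (rule bounded_clinear_row_op[OF bT])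
  have "norm (cadjoint (row_op T) x) \<le> norm x" for x
    using norm_cadjoint_le[OF b, of 1 x] le by simp
  from positive_op_defect[OF bounded_clinear_cadjoint[OF b] this]
  show "row_contraction T"
    using bT by (simp add: row_contraction_def cadjoint_cadjoint[OF b] row_op_cadjoint_row_op[OF bT])
qed

lemma positive_contraction_defect:
  assumes A: "bounded_clinear A" and le: "\<And>x. norm (A x) \<le> norm x"
  shows "positive_contraction (\<lambda>x. x - cadjoint A (A x))"
proof
  show "norm (x - (x - cadjoint A (A x))) \<le> norm x" for x
    using order_trans[OF _ le[of x], of "norm (cadjoint A (A x))"]
      norm_cadjoint_le[OF A, of 1 "A x"] le by simp
qed (rule positive_op_defect[OF assms])

locale row_contr =
  fixes T :: "'n::finite \<Rightarrow> 'h::chilbert_space \<Rightarrow> 'h"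
  assumes row_contraction: "row_contraction T"
begin

abbreviation "R \<equiv> row_op T"
abbreviation "Rs \<equiv> cadjoint (row_op T)"
abbreviation "D \<equiv> defect_op T"
abbreviation "Ds \<equiv> defect_op_star T"

lemma bounded_T: "bounded_clinear (T i)"
  using row_contraction by (simp add: row_contraction_def)

lemma bounded_R: "bounded_clinear R"
  by (rule bounded_clinear_row_op[OF bounded_T])

lemma bounded_Rs: "bounded_clinear Rs"
  by (rule bounded_clinear_cadjoint[OF bounded_R])

lemma norm_R: "norm (R v) \<le> norm v"
  using row_contraction by (simp add: row_contraction_iff)

lemma norm_Rs: "norm (Rs x) \<le> norm x"
  using norm_cadjoint_le[OF bounded_R, of 1 x] norm_R by simp

lemma positive_contraction_D: "positive_contraction (\<lambda>v. v - Rs (R v))"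
  by (rule positive_contraction_defect[OF bounded_R norm_R])

lemma positive_contraction_Ds: "positive_contraction (\<lambda>x. x - R (Rs x))"
  using positive_contraction_defect[OF bounded_Rs norm_Rs] by (simp add: cadjoint_cadjoint[OF bounded_R])

lemma D_squared: "D (D v) = v - Rs (R v)" and Ds_squared: "Ds (Ds x) = x - R (Rs x)"
  unfolding defect_op_def defect_op_star_def
  by (simp_all add: positive_contraction.sqrt_op_squared positive_contraction_D positive_contraction_Ds)

lemma positive_D: "positive_op D" and positive_Ds: "positive_op Ds"
  unfolding defect_op_def defect_op_star_def
  by (simp_all add: positive_contraction.positive_sqrt_op positive_contraction_D positive_contraction_Ds)

lemma bounded_D: "bounded_clinear D" and bounded_Ds: "bounded_clinear Ds"
  using positive_D positive_Ds by (simp_all add: positive_op_def)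

lemmas clinear = bounded_R[THEN bounded_clinear_on_imp_clinear_on]
  bounded_Rs[THEN bounded_clinear_on_imp_clinear_on]
  bounded_D[THEN bounded_clinear_on_imp_clinear_on]
  bounded_Ds[THEN bounded_clinear_on_imp_clinear_on]

lemmas bounded_linear = bounded_R[THEN bounded_clinear_imp_bounded_linear]
  bounded_Rs[THEN bounded_clinear_imp_bounded_linear]
  bounded_D[THEN bounded_clinear_imp_bounded_linear]
  bounded_Ds[THEN bounded_clinear_imp_bounded_linear]

lemmas linear_add = clinear[THEN clinear_on_add, OF UNIV_I UNIV_I]

lemmas linear_diff = clinear[THEN clinear_on_diff, OF UNIV_I csubspace_UNIV UNIV_I]

lemma R_D: "R (D v) = Ds (R v)"
  unfolding defect_op_def defect_op_star_def
  by (rule sqrt_op_intertwine[OF positive_contraction_D positive_contraction_Ds bounded_linear(1)])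
    (simp add: linear_diff)

lemma Rs_Ds: "Rs (Ds x) = D (Rs x)"
  unfolding defect_op_def defect_op_star_def
  by (rule sqrt_op_intertwine[OF positive_contraction_Ds positive_contraction_D bounded_linear(2)])
    (simp add: linear_diff)

lemma norm_D_squared: "(norm (D v))\<^sup>2 = (norm v)\<^sup>2 - (norm (R v))\<^sup>2"
proof -
  have "cinner (D v) (D v) = cinner (v - Rs (R v)) v"
    using positive_op_selfadjoint[OF positive_D, of "D v" v] by (simp add: D_squared)
  also have "\<dots> = cinner v v - cinner (R v) (R v)"
    by (simp add: cinner_diff_left cinner_cadjoint'[OF bounded_R])
  finally show ?thesis
    unfolding cinner_self of_real_diff[symmetric] of_real_eq_iff .
qed

lemma norm_Ds_squared: "(norm (Ds x))\<^sup>2 = (norm x)\<^sup>2 - (norm (Rs x))\<^sup>2"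
proof -
  have "cinner (Ds x) (Ds x) = cinner x (x - R (Rs x))"
    by (simp add: positive_op_selfadjoint[OF positive_Ds] Ds_squared)
  also have "\<dots> = cinner x x - cinner (Rs x) (Rs x)"
    by (simp add: cinner_diff_right cinner_cadjoint'[OF bounded_R])
  finally show ?thesis
    unfolding cinner_self of_real_diff[symmetric] of_real_eq_iff .
qed

text \<open>The mixed terms cancel: moving the row operator past the defect operator turns the inner
  product of \<open>Rs x\<close> with \<open>D f\<close> into that of \<open>Ds x\<close> with
  \<open>R f\<close>, and the latter enters with the opposite sign.\<close>

lemma julia_norm: "(norm (Rs x + D f))\<^sup>2 + (norm (Ds x - R f))\<^sup>2 = (norm x)\<^sup>2 + (norm f)\<^sup>2"
proof -
  have "cinner (Rs x) (D f) = cinner (Ds x) (R f)"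
    by (simp add: cinner_cadjoint'[OF bounded_R] R_D positive_op_selfadjoint[OF positive_Ds])
  then have "inner (Rs x) (D f) = inner (Ds x) (R f)"
    by (simp add: inner_eq_Re_cinner)
  then have "(norm (Rs x + D f))\<^sup>2 + (norm (Ds x - R f))\<^sup>2
      = (norm (Rs x))\<^sup>2 + (norm (D f))\<^sup>2 + (norm (Ds x))\<^sup>2 + (norm (R f))\<^sup>2"
    by (simp add: power2_norm_eq_inner inner_add_left inner_add_right inner_diff_left inner_diff_right
        inner_commute)
  then show ?thesis
    by (simp add: norm_D_squared norm_Ds_squared)
qed

abbreviation "\<D> \<equiv> defect_space T"
abbreviation "\<D>s \<equiv> defect_space_star T"

lemma closed_csubspace_defect: "closed_csubspace \<D>" "closed_csubspace \<D>s"
  unfolding defect_space_def defect_space_star_def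
  by (intro csubspace_closure csubspace_image[OF csubspace_UNIV] clinear)+

lemma csubspace_defect: "csubspace \<D>" "csubspace \<D>s" "closed \<D>" "closed \<D>s"
  using closed_csubspace_defect by (auto simp: closed_csubspace_def)

lemma defect_mem: "D v \<in> \<D>" "Ds x \<in> \<D>s"
  unfolding defect_space_def defect_space_star_def by (auto intro: closure_subset[THEN subsetD])

lemma R_mem: "f \<in> \<D> \<Longrightarrow> R f \<in> \<D>s"
proof -
  have "R ` closure (range D) \<subseteq> closure (range Ds)"
    by (rule image_closure_subset[OF bounded_linear.continuous_on[OF bounded_linear(1) continuous_on_id]])
      (auto simp: R_D intro: closure_subset[THEN subsetD])
  then show "f \<in> \<D> \<Longrightarrow> R f \<in> \<D>s"
    by (auto simp: defect_space_def defect_space_star_def)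
qed

lemma Rs_mem: "x \<in> \<D>s \<Longrightarrow> Rs x \<in> \<D>"
proof -
  have "Rs ` closure (range Ds) \<subseteq> closure (range D)"
    by (rule image_closure_subset[OF bounded_linear.continuous_on[OF bounded_linear(2) continuous_on_id]])
      (auto simp: Rs_Ds intro: closure_subset[THEN subsetD])
  then show "x \<in> \<D>s \<Longrightarrow> Rs x \<in> \<D>"
    by (auto simp: defect_space_def defect_space_star_def)
qed

lemma julia_mem: "f \<in> \<D> \<Longrightarrow> Ds x - R f \<in> \<D>s"
  by (intro csubspace_diff[OF csubspace_defect(2)] defect_mem R_mem)

text \<open>The adjoint of the Julia operator, written out, is a right inverse. Together with
  \<open>julia_norm\<close> this makes the Julia operator unitary.\<close>

lemma julia_surj:
  assumes "g \<in> \<D>s"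
  shows "Rs (R y + Ds g) + D (D y - Rs g) = y" "Ds (R y + Ds g) - R (D y - Rs g) = g"
    "D y - Rs g \<in> \<D>"
  by (simp_all add: linear_add linear_diff D_squared Ds_squared R_D Rs_Ds assms
      csubspace_diff[OF csubspace_defect(1)] defect_mem Rs_mem)

text \<open>
  An isometric system with inputs \<open>x\<close>, \<open>p\<close>, \<open>v\<close> and outputs \<open>y\<close>, \<open>z\<close>, whose adjoint sends the
  outputs \<open>(u, 0)\<close> to \<open>x = R u\<close> and \<open>p = 0\<close>, factors through the Julia operator: the component
  \<open>v\<close> of the adjoint at \<open>(u, 0)\<close> has the norm of \<open>D u\<close>, which embeds the defect space into \<open>V\<close>.
\<close>

lemma peel:
  fixes x :: "'l::chilbert_space \<Rightarrow> 'h" and p :: "'l \<Rightarrow> 'p::chilbert_space"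
    and v :: "'l \<Rightarrow> 'v::chilbert_space" and y :: "'l \<Rightarrow> 'h ^ 'n" and z :: "'l \<Rightarrow> 'z::chilbert_space"
    and \<phi> :: "'v \<Rightarrow> 'e::chilbert_space"
  assumes L: "csubspace L"
    and lin: "clinear_on L x" "clinear_on L p" "clinear_on L v" "clinear_on L y" "clinear_on L z"
    and energy: "\<And>l. l \<in> L \<Longrightarrow>
      (norm (x l))\<^sup>2 + (norm (p l))\<^sup>2 + (norm (v l))\<^sup>2 = (norm (y l))\<^sup>2 + (norm (z l))\<^sup>2"
    and lift: "\<And>u. \<exists>l\<in>L. y l = u \<and> z l = 0 \<and> x l = R u \<and> p l = 0"
    and V: "closed_csubspace V" and vV: "v ` L \<subseteq> V"
    and \<phi>: "bounded_clinear \<phi>" "\<And>v. v \<in> V \<Longrightarrow> norm (\<phi> v) = norm v"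
  obtains E U where "closed_csubspace E" "E \<subseteq> \<phi> ` V" "unitary_on V (\<D> \<times> E) U"
    "\<forall>l\<in>L. y l = Rs (x l) + D (fst (U (v l)))"
proof -
  \<comment> \<open>On \<open>L0\<close> the energy identity reduces to: the squared norm of
    \<open>v l\<close> is that of \<open>y l\<close> minus that of \<open>R (y l)\<close>, which is
    the squared norm of \<open>D (y l)\<close>.\<close>
  define L0 where "L0 = {l \<in> L. x l = R (y l) \<and> p l = 0 \<and> z l = 0}"
  have "L0 = {l \<in> L. (x l - R (y l), p l, z l) = 0}"
    by (auto simp: L0_def zero_prod_def)
  then have L0: "csubspace L0" "L0 \<subseteq> L"
    using csubspace_kernel[OF L clinear_on_Pair[OF clinear_on_minus clinear_on_Pair]]
      lin clinear_on_compose_UNIV[OF lin(4) clinear(1)] by auto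
  have linD: "clinear_on L0 (\<lambda>l. D (y l))"
    by (intro clinear_on_compose_UNIV[OF _ clinear(3)] clinear_on_subset[OF lin(4) L0(2)])
  have norm_eq: "norm (D (y l)) = norm (v l)" if "l \<in> L0" for l
  proof -
    have "(norm (D (y l)))\<^sup>2 = (norm (v l))\<^sup>2"
      using energy[of l] that by (simp add: L0_def norm_D_squared)
    then show ?thesis
      by (simp add: power2_eq_iff_nonneg)
  qed
  obtain J where J: "unitary_on (closure ((\<lambda>l. D (y l)) ` L0)) (closure (v ` L0)) J"
      "\<And>l. l \<in> L0 \<Longrightarrow> J (D (y l)) = v l"
    using isometry_extension[OF L0(1) linD clinear_on_subset[OF lin(3) L0(2)] norm_eq] by blast
  \<comment> \<open>The lifting hypothesis makes \<open>y\<close> map \<open>L0\<close> onto the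
    whole space, so \<open>J\<close> is defined on the entire defect space.\<close>
  have "\<exists>l\<in>L0. u = y l" for u
    using lift[of u] by (auto simp: L0_def)
  then have "y ` L0 = UNIV"
    by (auto simp: image_iff)
  then have "(\<lambda>l. D (y l)) ` L0 = range D"
    by (metis image_image)
  then have J1: "unitary_on \<D> (closure (v ` L0)) J"
    using J(1) by (simp add: defect_space_def)
  have sub: "closure (v ` L0) \<subseteq> V"
    using vV L0(2) V by (intro closure_minimal) (auto simp: closed_csubspace_def)
  obtain E U where EU: "closed_csubspace E" "E \<subseteq> \<phi> ` V" "unitary_on V (\<D> \<times> E) U"
      "\<And>a. a \<in> \<D> \<Longrightarrow> U (J a) = (a, 0)"
    using unitary_complement[OF closed_csubspace_defect(1) J1 sub _ V \<phi>] by (metis closed_closure)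
  have "y l = Rs (x l) + D (fst (U (v l)))" if l: "l \<in> L" for l
  proof (rule cinner_eqI)
    fix u
    \<comment> \<open>The polarized energy identity between \<open>l\<close> and the lift
      \<open>l0\<close> of \<open>u\<close> expresses the pairing of \<open>y l\<close> with
      \<open>u\<close> through \<open>R u\<close> and \<open>v l0\<close>, and \<open>U\<close> maps
      \<open>v l0\<close> to \<open>(D u, 0)\<close>.\<close>
    obtain l0 where l0: "l0 \<in> L" "y l0 = u" "z l0 = 0" "x l0 = R u" "p l0 = 0"
      using lift[of u] by blast
    then have l0': "l0 \<in> L0"
      by (simp add: L0_def)
    have norm: "norm ((x l, p l), v l) = norm (y l, z l)" if "l \<in> L" for l
      using energy[OF that] by (simp add: norm_prod_def)
    have "cinner ((x l, p l), v l) ((x l0, p l0), v l0) = cinner (y l, z l) (y l0, z l0)"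
      by (rule norm_eq_imp_cinner_eq[where A = "\<lambda>l. ((x l, p l), v l)" and B = "\<lambda>l. (y l, z l)"])
        (use L l l0(1) lin norm in \<open>auto intro!: clinear_on_Pair\<close>)
    then have "cinner (y l) u = cinner (x l) (R u) + cinner (v l) (v l0)"
      by (simp add: cinner_prod_def l0)
    also have "cinner (v l) (v l0) = cinner (U (v l)) (U (v l0))"
      using unitary_on_cinner[OF EU(3), of "v l" "v l0"] vV l l0 by (simp add: image_subset_iff)
    also have "U (v l0) = (D u, 0)"
      using J(2)[OF l0'] EU(4)[OF defect_mem(1)] l0 by metis
    also have "cinner (U (v l)) (D u, 0) = cinner (D (fst (U (v l)))) u"
      by (simp add: cinner_prod_def positive_op_selfadjoint[OF positive_D])
    finally show "cinner (y l) u = cinner (Rs (x l) + D (fst (U (v l)))) u"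
      by (simp add: cinner_add_left cinner_cadjoint'[OF bounded_R])
  qed
  then show thesis
    using that EU by blast
qed

end

section \<open>Fock space and the characteristic function\<close>

lemma Rep_ell2_sum: "Rep_ell2 (\<Sum>i\<in>I. f i) w = (\<Sum>i\<in>I. Rep_ell2 (f i) w)"
  by (induction I rule: infinite_finite_induct) simp_all

lemma fock_of_UNIV [simp]: "fock_of UNIV = UNIV"
  by (simp add: fock_of_def)

lemma Rep_fock_map_UNIV: "bounded_clinear A \<Longrightarrow> Rep_ell2 (fock_map A f) w = A (Rep_ell2 f w)"
  by (rule Rep_fock_map) auto

lemma scaleC_vec_nth [simp]: "(c *\<^sub>C v) $ i = c *\<^sub>C v $ i"
  by (simp add: scaleC_vec_def)

lemma bounded_clinear_vec_nth: "bounded_clinear (\<lambda>v. v $ i)"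
  by (rule bounded_clinearI) (auto simp: bounded_linear_vec_nth scaleC_vec_def)

section \<open>Expansion in the word basis and strong convergence on the Fock space\<close>

lemma ell2_norm_leI:
  assumes "(\<lambda>w. (norm (h w))\<^sup>2) summable_on UNIV"
    and "\<And>F. finite F \<Longrightarrow> (\<Sum>w\<in>F. (norm (h w))\<^sup>2) \<le> C\<^sup>2" and "0 \<le> C"
  shows "norm (Abs_ell2 h) \<le> C"
proof -
  have "(norm (Abs_ell2 h))\<^sup>2 \<le> C\<^sup>2"
    using assms by (simp add: ell2_norm_squared Abs_ell2_inverse infsum_le_finite_sums)
  then show ?thesis
    using assms(3) by (simp add: power2_le_iff_abs_le)
qed

lemma Rep_sum_fock_basis:
  assumes "finite F"
  shows "Rep_ell2 (\<Sum>w\<in>F. fock_basis w \<otimes>\<^sub>F x w) v = (if v \<in> F then x v else 0)"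
proof -
  have "Rep_ell2 (\<Sum>w\<in>F. fock_basis w \<otimes>\<^sub>F x w) v = (\<Sum>w\<in>F. if v = w then x w else 0)"
    by (auto simp: Rep_ell2_sum Rep_tensor Rep_fock_basis intro!: sum.cong)
  then show ?thesis
    using assms by simp
qed

text \<open>Parseval: the squared distance of a finite partial sum from \<open>f\<close> is the tail
  of the series of squared norms.\<close>

lemma has_sum_fock_basis:
  "((\<lambda>w. fock_basis w \<otimes>\<^sub>F Rep_ell2 f w) has_sum f) UNIV"
proof -
  define s where "s F = (\<Sum>w\<in>F. fock_basis w \<otimes>\<^sub>F Rep_ell2 f w)" for F
  have norm: "(norm (s F - f))\<^sup>2 = (norm f)\<^sup>2 - (\<Sum>w\<in>F. (norm (Rep_ell2 f w))\<^sup>2)" if "finite F" for F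
  proof -
    have "(norm (s F - f))\<^sup>2 = (\<Sum>\<^sub>\<infinity>w\<in>UNIV - F. (norm (Rep_ell2 f w))\<^sup>2)"
      unfolding ell2_norm_squared
      by (rule infsum_cong_neutral) (auto simp: s_def Rep_sum_fock_basis[OF that])
    also have "\<dots> = (norm f)\<^sup>2 - (\<Sum>w\<in>F. (norm (Rep_ell2 f w))\<^sup>2)"
      using infsum_Un_disjoint[of "\<lambda>w. (norm (Rep_ell2 f w))\<^sup>2" F "UNIV - F"] that
      by (simp add: ell2_norm_squared summable_on_subset_banach[OF summable_Rep_ell2])
    finally show ?thesis .
  qed
  have "((\<lambda>w. (norm (Rep_ell2 f w))\<^sup>2) has_sum (norm f)\<^sup>2) UNIV"
    unfolding ell2_norm_squared by (rule has_sum_infsum[OF summable_Rep_ell2])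
  then have "((\<lambda>F. \<Sum>w\<in>F. (norm (Rep_ell2 f w))\<^sup>2) \<longlongrightarrow> (norm f)\<^sup>2) (finite_subsets_at_top UNIV)"
    by (simp add: has_sum_def)
  then have "((\<lambda>F. sqrt ((norm f)\<^sup>2 - (\<Sum>w\<in>F. (norm (Rep_ell2 f w))\<^sup>2))) \<longlongrightarrow> sqrt ((norm f)\<^sup>2 - (norm f)\<^sup>2))
      (finite_subsets_at_top UNIV)"
    by (intro tendsto_intros)
  moreover have "\<forall>\<^sub>F F in finite_subsets_at_top UNIV.
      sqrt ((norm f)\<^sup>2 - (\<Sum>w\<in>F. (norm (Rep_ell2 f w))\<^sup>2)) = norm (s F - f)"
    by (rule eventually_finite_subsets_at_top_weakI) (simp flip: norm)
  ultimately have "((\<lambda>F. norm (s F - f)) \<longlongrightarrow> 0) (finite_subsets_at_top UNIV)"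
    using Lim_transform_eventually by fastforce
  then have "((\<lambda>F. s F - f) \<longlongrightarrow> 0) (finite_subsets_at_top UNIV)"
    by (rule tendsto_norm_zero_cancel)
  then show ?thesis
    unfolding has_sum_def s_def using LIM_zero_iff by blast
qed

text \<open>Uniformly bounded additive maps converge strongly once they converge on the total set of
  vectors e_w tensor x; an epsilon/3 argument with finite partial sums. Contractivity is asked only
  eventually, as it will hold for 0 <= r <= 1.\<close>

lemma fock_tendsto:
  fixes A :: "'r \<Rightarrow> ('n, 'h::chilbert_space) fock \<Rightarrow> 'k::real_normed_vector"
  assumes A: "\<forall>\<^sub>F r in F. \<forall>f g. A r (f + g) = A r f + A r g \<and> norm (A r f) \<le> norm f"
    and B: "\<And>f g. B (f + g) = B f + B g" "\<And>f. norm (B f) \<le> norm f"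
    and lim: "\<And>w x. ((\<lambda>r. A r (fock_basis w \<otimes>\<^sub>F x)) \<longlongrightarrow> B (fock_basis w \<otimes>\<^sub>F x)) F"
  shows "((\<lambda>r. A r f) \<longlongrightarrow> B f) F"
proof -
  define s where "s W = (\<Sum>w\<in>W. fock_basis w \<otimes>\<^sub>F Rep_ell2 f w)" for W
  have lim_s: "((\<lambda>r. A r (s W)) \<longlongrightarrow> B (s W)) F" if "finite W" for W
    using that
  proof (induction W)
    case empty
    have ev: "\<forall>\<^sub>F r in F. 0 = A r (s {})"
      using A
    proof eventually_elim
      case (elim r)
      from conjunct2[OF elim[rule_format, of 0 0]] show ?case
        by (simp add: s_def)
    qed
    moreover have "B (s {}) = 0"
      using B(2)[of 0] by (simp add: s_def)
    ultimately show ?case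
      using Lim_transform_eventually[OF tendsto_const ev] by simp
  next
    case (insert w W)
    have "\<forall>\<^sub>F r in F. A r (fock_basis w \<otimes>\<^sub>F Rep_ell2 f w) + A r (s W) = A r (s (insert w W))"
      using A by eventually_elim (use insert.hyps in \<open>simp add: s_def\<close>)
    moreover have "B (s (insert w W)) = B (fock_basis w \<otimes>\<^sub>F Rep_ell2 f w) + B (s W)"
      using insert.hyps by (simp add: s_def B)
    ultimately show ?case
      using Lim_transform_eventually[OF tendsto_add[OF lim insert.IH]] by simp
  qed
  show ?thesis
  proof (rule tendstoI)
    fix e :: real assume "e > 0"
    have "(s \<longlongrightarrow> f) (finite_subsets_at_top UNIV)"
      using has_sum_fock_basis[of f] by (simp add: has_sum_def s_def[abs_def])
    then have "\<forall>\<^sub>F W in finite_subsets_at_top UNIV. dist (s W) f < e / 3"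
      using \<open>e > 0\<close> by (intro tendstoD) auto
    then obtain W where W: "finite W" "dist (s W) f < e / 3"
      unfolding eventually_finite_subsets_at_top by blast
    have Bd: "dist (B (s W)) (B f) < e / 3"
      using W(2) B(2)[of "s W - f"] B(1)[of "s W - f" f] by (simp add: dist_norm)
    have "\<forall>\<^sub>F r in F. dist (A r (s W)) (B (s W)) < e / 3"
      using lim_s[OF W(1)] \<open>e > 0\<close> by (intro tendstoD) auto
    then show "\<forall>\<^sub>F r in F. dist (A r f) (B f) < e"
      using A
    proof eventually_elim
      case (elim r)
      have "A r (s W) - A r f = A r (s W - f)"
        using elim(2)[rule_format, of "s W - f" f] by simp
      moreover have "norm (A r (s W - f)) \<le> norm (s W - f)"
        using elim(2) by blast
      ultimately have "dist (A r (s W)) (A r f) < e / 3"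
        using W(2) by (simp add: dist_norm)
      then show ?case
        using Bd elim(1) dist_triangle[of "A r f" "B f" "A r (s W)"]
          dist_triangle[of "A r (s W)" "B f" "B (s W)"]
        by (simp add: dist_commute)
    qed
  qed
qed

context row_contr
begin

text \<open>
  The characteristic function is the input-output map of the linear system on the tree of words
  whose transition operator is the Julia operator; the resolvent at \<open>r\<close> corresponds to scaling
  the state transition by \<open>r\<close>.
\<close>

primrec state_rev :: "real \<Rightarrow> ('n list \<Rightarrow> 'h ^ 'n) \<Rightarrow> 'n list \<Rightarrow> 'h" where
  "state_rev r f [] = 0"
| "state_rev r f (i # u) = r *\<^sub>R (cadjoint (T i) (state_rev r f u) + D (f (rev u)) $ i)"

text \<open>Right creation appends the last letter of a word, whereas primitive recursion on lists
  removes the first one; hence the recursion on the reversed word.\<close>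

definition state :: "real \<Rightarrow> ('n list \<Rightarrow> 'h ^ 'n) \<Rightarrow> 'n list \<Rightarrow> 'h" where
  "state r f w = state_rev r f (rev w)"

definition out :: "real \<Rightarrow> ('n list \<Rightarrow> 'h ^ 'n) \<Rightarrow> 'n list \<Rightarrow> 'h" where
  "out r f w = Ds (state r f w) - R (f w)"

lemma state_Nil [simp]: "state r f [] = 0"
  by (simp add: state_def)

lemma state_snoc: "state r f (w @ [i]) = r *\<^sub>R (Rs (state r f w) + D (f w)) $ i"
  by (simp add: state_def cadjoint_row_op[OF bounded_T])

lemma state_add: "state r (\<lambda>w. f w + g w) w = state r f w + state r g w"
  by (induction w rule: rev_induct) (simp_all add: state_snoc linear_add scaleR_add_right add_ac)

lemma state_scaleC: "state r (\<lambda>w. c *\<^sub>C f w) w = c *\<^sub>C state r f w"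
  by (induction w rule: rev_induct)
    (simp_all add: state_snoc bounded_clinear_scale[OF bounded_Rs]
      bounded_clinear_scale[OF bounded_D] scaleC_add_right scaleC_scaleR_commute)

lemma out_add: "out r (\<lambda>w. f w + g w) w = out r f w + out r g w"
  by (simp add: out_def state_add linear_add)

lemma out_scaleC: "out r (\<lambda>w. c *\<^sub>C f w) w = c *\<^sub>C out r f w"
  by (simp add: out_def state_scaleC bounded_clinear_scale[OF bounded_R]
      bounded_clinear_scale[OF bounded_Ds] scaleC_diff_right)

section \<open>Energy balance on the tree of words\<close>

definition words_less :: "nat \<Rightarrow> 'n list set" where
  "words_less n = {w. length w < n}"

lemma finite_words: "finite {w :: 'n list. length w = n}" "finite (words_less n)"
  using finite_lists_length_eq[of "UNIV :: 'n set" n] finite_lists_length_le[of "UNIV :: 'n set" n]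
  by (auto simp: words_less_def intro: finite_subset[rotated])

lemma sum_words_less_Suc:
  "sum g (words_less (Suc n)) = sum g (words_less n) + (\<Sum>w | length w = n. g w)" for g :: "'n list \<Rightarrow> real"
proof -
  have "words_less (Suc n) = words_less n \<union> {w. length w = n}"
    by (auto simp: words_less_def)
  moreover have disj: "words_less n \<inter> {w. length w = n} = {}"
    by (auto simp: words_less_def)
  ultimately show ?thesis
    by (simp add: sum.union_disjoint[OF finite_words(2,1) disj])
qed

lemma sum_words_Suc:
  "(\<Sum>w | length w = Suc n. g w) = (\<Sum>w | length w = n. \<Sum>i\<in>UNIV. g (w @ [i]))" for g :: "'n list \<Rightarrow> real"
proof -
  have "(\<Sum>w | length w = Suc n. g w) = (\<Sum>(w, i)\<in>{w. length w = n} \<times> UNIV. g (w @ [i]))"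
    by (rule sum.reindex_bij_witness[where i = "\<lambda>(w, i). w @ [i]" and j = "\<lambda>w. (butlast w, last w)"])
      (auto simp: length_Suc_conv_rev)
  then show ?thesis
    by (simp add: sum.cartesian_product)
qed

lemma state_level:
  "(\<Sum>i\<in>UNIV. (norm (state r f (w @ [i])))\<^sup>2) = r\<^sup>2 * ((norm (state r f w))\<^sup>2 + (norm (f w))\<^sup>2 - (norm (out r f w))\<^sup>2)"
proof -
  have "(\<Sum>i\<in>UNIV. (norm (state r f (w @ [i])))\<^sup>2) = r\<^sup>2 * (norm (Rs (state r f w) + D (f w)))\<^sup>2"
    by (simp add: state_snoc norm_vec_squared sum_distrib_left power_mult_distrib)
  then show ?thesis
    using julia_norm[of "state r f w" "f w"] by (simp add: out_def)
qed

lemma out_le: "(norm (out r f w))\<^sup>2 \<le> (norm (state r f w))\<^sup>2 + (norm (f w))\<^sup>2"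
  using julia_norm[of "state r f w" "f w"] by (simp add: out_def flip: julia_norm)

lemma state_words_Suc:
  "(\<Sum>w | length w = Suc n. (norm (state r f w))\<^sup>2)
    = r\<^sup>2 * ((\<Sum>w | length w = n. (norm (state r f w))\<^sup>2) + (\<Sum>w | length w = n. (norm (f w))\<^sup>2)
        - (\<Sum>w | length w = n. (norm (out r f w))\<^sup>2))"
  by (simp add: sum_words_Suc state_level sum_distrib_left[symmetric] sum.distrib sum_subtractf)

text \<open>The Julia identity at each word bounds the state energy of the next level by state plus
  input minus output energy of the present one; summing over levels telescopes from the zero state
  at the root. The bound is uniform in \<open>r\<close>.\<close>

lemma out_energy:
  assumes "0 \<le> r" "r \<le> 1"
  shows "(\<Sum>w\<in>words_less n. (norm (out r f w))\<^sup>2) + (\<Sum>w | length w = n. (norm (state r f w))\<^sup>2)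
    \<le> (\<Sum>w\<in>words_less n. (norm (f w))\<^sup>2)"
proof (induction n)
  case 0
  then show ?case
    by (simp add: words_less_def)
next
  case (Suc n)
  let ?a = "\<Sum>w | length w = n. (norm (state r f w))\<^sup>2" and ?o = "\<Sum>w | length w = n. (norm (out r f w))\<^sup>2"
    and ?f = "\<Sum>w | length w = n. (norm (f w))\<^sup>2"
  \<comment> \<open>The balance of a level must be nonnegative before the factor r^2 may be replaced
    by 1.\<close>
  have "?o \<le> ?a + ?f"
    unfolding sum.distrib[symmetric] by (intro sum_mono out_le)
  moreover have "r\<^sup>2 \<le> 1"
    using assms by (simp add: power_le_one)
  ultimately have "r\<^sup>2 * (?a + ?f - ?o) \<le> 1 * (?a + ?f - ?o)"
    by (intro mult_right_mono) auto
  then show ?case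
    using Suc.IH by (simp add: sum_words_less_Suc state_words_Suc)
qed

text \<open>Scaling the transition by \<open>r\<close> loses a fraction 1 - r^2 of the energy at
  every level. For \<open>r < 1\<close> this makes the states themselves square-summable, so that
  they form a vector of the Fock space; at \<open>r = 1\<close> it does not bound their sum over all
  words.\<close>

lemma state_energy:
  assumes "0 \<le> r" "r \<le> 1"
  shows "(1 - r\<^sup>2) * (\<Sum>w\<in>words_less n. (norm (state r f w))\<^sup>2) + (\<Sum>w | length w = n. (norm (state r f w))\<^sup>2)
    \<le> (\<Sum>w\<in>words_less n. (norm (f w))\<^sup>2)"
proof (induction n)
  case 0
  then show ?case
    by (simp add: words_less_def)
next
  case (Suc n)
  let ?a = "\<Sum>w | length w = n. (norm (state r f w))\<^sup>2" and ?o = "\<Sum>w | length w = n. (norm (out r f w))\<^sup>2"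
    and ?f = "\<Sum>w | length w = n. (norm (f w))\<^sup>2"
  have "r\<^sup>2 * ?f \<le> 1 * ?f"
    using assms by (intro mult_right_mono) (auto simp: power_le_one sum_nonneg)
  moreover have "0 \<le> r\<^sup>2 * ?o"
    by (simp add: sum_nonneg)
  ultimately show ?case
    using Suc.IH by (simp add: sum_words_less_Suc state_words_Suc algebra_simps)
qed

lemma finite_sum_le_words_less:
  assumes "finite F" "\<And>n. (\<Sum>w\<in>words_less n. (norm (h w :: 'k::chilbert_space))\<^sup>2) \<le> C"
  shows "(\<Sum>w\<in>F. (norm (h w))\<^sup>2) \<le> C"
proof -
  have "\<exists>n. F \<subseteq> words_less n"
    using assms(1) by (auto simp: words_less_def intro!: exI[of _ "Suc (Max (length ` F))"] le_imp_less_Suc)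
  then obtain n where "F \<subseteq> words_less n"
    by blast
  then have "(\<Sum>w\<in>F. (norm (h w))\<^sup>2) \<le> (\<Sum>w\<in>words_less n. (norm (h w))\<^sup>2)"
    by (intro sum_mono2 finite_words) auto
  then show ?thesis
    using assms(2)[of n] by simp
qed

lemma out_bound:
  fixes f :: "('n, 'h ^ 'n) fock"
  assumes "0 \<le> r" "r \<le> 1" "finite F"
  shows "(\<Sum>w\<in>F. (norm (out r (Rep_ell2 f) w))\<^sup>2) \<le> (norm f)\<^sup>2"
proof (rule finite_sum_le_words_less[OF assms(3)])
  fix n
  show "(\<Sum>w\<in>words_less n. (norm (out r (Rep_ell2 f) w))\<^sup>2) \<le> (norm f)\<^sup>2"
    using out_energy[OF assms(1,2), where n = n and f = "Rep_ell2 f"] ell2_sum_le_norm[OF finite_words(2)[of n], of f]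
      sum_nonneg[of "{w. length w = n}" "\<lambda>w. (norm (state r (Rep_ell2 f) w))\<^sup>2"] by simp
qed

lemma out_summable:
  fixes f :: "('n, 'h ^ 'n) fock"
  assumes "0 \<le> r" "r \<le> 1"
  shows "(\<lambda>w. (norm (out r (Rep_ell2 f) w))\<^sup>2) summable_on UNIV"
  by (rule nonneg_bdd_above_summable_on) (use out_bound[OF assms] in \<open>auto intro!: bdd_aboveI[of _ "(norm f)\<^sup>2"]\<close>)

lemma state_summable:
  fixes f :: "('n, 'h ^ 'n) fock"
  assumes "0 \<le> r" "r < 1"
  shows "(\<lambda>w. (norm (state r (Rep_ell2 f) w))\<^sup>2) summable_on UNIV"
proof (rule nonneg_bdd_above_summable_on)
  have r: "0 < 1 - r\<^sup>2"
    using assms by (simp add: power_less_one_iff abs_square_less_1)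
  have "(\<Sum>w\<in>F. (norm (state r (Rep_ell2 f) w))\<^sup>2) \<le> (norm f)\<^sup>2 / (1 - r\<^sup>2)" if "finite F" for F
  proof (rule finite_sum_le_words_less[OF that])
    fix n
    have "(1 - r\<^sup>2) * (\<Sum>w\<in>words_less n. (norm (state r (Rep_ell2 f) w))\<^sup>2) \<le> (norm f)\<^sup>2"
      using state_energy[of r, where n = n and f = "Rep_ell2 f"] ell2_sum_le_norm[OF finite_words(2)[of n], of f]
        sum_nonneg[of "{w. length w = n}" "\<lambda>w. (norm (state r (Rep_ell2 f) w))\<^sup>2"] assms by simp
    then show "(\<Sum>w\<in>words_less n. (norm (state r (Rep_ell2 f) w))\<^sup>2) \<le> (norm f)\<^sup>2 / (1 - r\<^sup>2)"
      using r by (simp add: pos_le_divide_eq mult.commute)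
  qed
  then show "bdd_above (sum (\<lambda>w. (norm (state r (Rep_ell2 f) w))\<^sup>2) ` {F. F \<subseteq> UNIV \<and> finite F})"
    by (auto intro!: bdd_aboveI[of _ "(norm f)\<^sup>2 / (1 - r\<^sup>2)"])
qed simp

text \<open>For \<open>r < 1\<close> this is the expression whose limit defines the characteristic
  function. It stays a contraction at \<open>r = 1\<close>, where the states need not be
  square-summable.\<close>

definition transfer :: "real \<Rightarrow> ('n, 'h ^ 'n) fock \<Rightarrow> ('n, 'h) fock" where
  "transfer r f = Abs_ell2 (out r (Rep_ell2 f))"

lemma Rep_transfer: "0 \<le> r \<Longrightarrow> r \<le> 1 \<Longrightarrow> Rep_ell2 (transfer r f) w = out r (Rep_ell2 f) w"
  by (simp add: transfer_def Abs_ell2_inverse out_summable)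

lemma norm_transfer_le: "0 \<le> r \<Longrightarrow> r \<le> 1 \<Longrightarrow> norm (transfer r f) \<le> norm f"
  unfolding transfer_def by (rule ell2_norm_leI) (auto intro: out_summable out_bound)

lemma transfer_add: "0 \<le> r \<Longrightarrow> r \<le> 1 \<Longrightarrow> transfer r (f + g) = transfer r f + transfer r g"
proof -
  assume "0 \<le> r" "r \<le> 1"
  moreover have "Rep_ell2 (f + g) = (\<lambda>w. Rep_ell2 f w + Rep_ell2 g w)"
    by auto
  ultimately show ?thesis
    by (simp add: ell2_eq_iff Rep_transfer out_add)
qed

lemma transfer_scaleC: "0 \<le> r \<Longrightarrow> r \<le> 1 \<Longrightarrow> transfer r (c *\<^sub>C f) = c *\<^sub>C transfer r f"
proof -
  assume "0 \<le> r" "r \<le> 1"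
  moreover have "Rep_ell2 (c *\<^sub>C f) = (\<lambda>w. c *\<^sub>C Rep_ell2 f w)"
    by auto
  ultimately show ?thesis
    by (simp add: ell2_eq_iff Rep_transfer out_scaleC)
qed

text \<open>An input at the single word \<open>v\<close> leaves the state 0 up to the length of
  \<open>v\<close>; from then on each further letter contributes one factor \<open>r\<close>. This
  isolates the dependence on \<open>r\<close> as a power, with truncated subtraction in the exponent
  for shorter words.\<close>

lemma state_basis:
  assumes f: "\<And>w. w \<noteq> v \<Longrightarrow> f w = 0"
  shows "length w \<le> length v \<Longrightarrow> state r f w = 0"
    and "state r f w = r ^ (length w - length v) *\<^sub>R state 1 f w"
proof -
  have D0: "D 0 = 0" and Rs0: "Rs 0 = 0"
    using linear_diff(2)[of 0 0] linear_diff(3)[of 0 0] by auto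
  show 0: "state r f w = 0" if "length w \<le> length v" for w r
    using that
  proof (induction w rule: rev_induct)
    case (snoc i w)
    then have "w \<noteq> v"
      by auto
    with snoc show ?case
      by (simp add: state_snoc f D0 Rs0)
  qed simp
  show "state r f w = r ^ (length w - length v) *\<^sub>R state 1 f w"
  proof (induction w rule: rev_induct)
    case (snoc i w)
    show ?case
    proof (cases "length w < length v")
      case True
      then show ?thesis
        using 0[of "w @ [i]"] by simp
    next
      case False
      let ?k = "length w - length v"
      \<comment> \<open>Either \<open>w = v\<close>, where the state vanishes and the exponent is 0,
        or the input at \<open>w\<close> vanishes and only the scaled state remains.\<close>
      have "Rs (state r f w) + D (f w) = r ^ ?k *\<^sub>R (Rs (state 1 f w) + D (f w))"
        using f[of w] 0[of v r] 0[of v 1] by (cases "w = v")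
          (auto simp: snoc.IH linear_scale[OF bounded_linear(2)[THEN bounded_linear.linear]] D0 scaleR_add_right)
      then have "state r f (w @ [i]) = r *\<^sub>R r ^ ?k *\<^sub>R state 1 f (w @ [i])"
        by (simp add: state_snoc)
      then show ?thesis
        using False by (simp add: Suc_diff_le)
    qed
  qed simp
qed

lemma out_basis:
  assumes f: "\<And>w. w \<noteq> v \<Longrightarrow> f w = 0"
  shows "out r f w = r ^ (length w - length v) *\<^sub>R out 1 f w"
proof -
  have "R 0 = 0"
    using linear_diff(1)[of 0 0] by auto
  then show ?thesis
    using f[of w] state_basis(2)[OF f, where r = r and w = w]
    by (cases "w = v")
      (auto simp: out_def linear_scale[OF bounded_linear(4)[THEN bounded_linear.linear]] scaleR_diff_right)
qed

end

text \<open>Damps degrees above \<open>k\<close> by powers of \<open>r\<close> and leaves degrees up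
  to \<open>k\<close> unchanged because natural subtraction is truncated; with \<open>k\<close> the
  length of \<open>w\<close> it turns \<open>transfer 1\<close> into \<open>transfer r\<close> on
  inputs at \<open>w\<close>.\<close>

definition degree_scale :: "nat \<Rightarrow> real \<Rightarrow> ('n, 'h::chilbert_space) fock \<Rightarrow> ('n, 'h) fock" where
  "degree_scale k r f = Abs_ell2 (\<lambda>w. r ^ (length w - k) *\<^sub>R Rep_ell2 f w)"

lemma
  fixes f :: "('n, 'h::chilbert_space) fock"
  assumes r: "0 \<le> r" "r \<le> 1"
  shows Rep_degree_scale: "Rep_ell2 (degree_scale k r f) w = r ^ (length w - k) *\<^sub>R Rep_ell2 f w"
    and norm_degree_scale: "norm (degree_scale k r f) \<le> norm f"
proof -
  have le: "(norm (r ^ (length w - k) *\<^sub>R Rep_ell2 f w))\<^sup>2 \<le> (norm (Rep_ell2 f w))\<^sup>2" for w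
    using r by (intro power_mono) (auto simp: power_le_one mult_left_le_one_le)
  have summ: "(\<lambda>w. (norm (r ^ (length w - k) *\<^sub>R Rep_ell2 f w))\<^sup>2) summable_on UNIV"
    by (rule summable_on_comparison_test[OF summable_Rep_ell2[of f]]) (use le in auto)
  then show "Rep_ell2 (degree_scale k r f) w = r ^ (length w - k) *\<^sub>R Rep_ell2 f w"
    by (simp add: degree_scale_def Abs_ell2_inverse)
  show "norm (degree_scale k r f) \<le> norm f"
    unfolding degree_scale_def
  proof (rule ell2_norm_leI[OF summ])
    fix F :: "'n list set" assume "finite F"
    then show "(\<Sum>w\<in>F. (norm (r ^ (length w - k) *\<^sub>R Rep_ell2 f w))\<^sup>2) \<le> (norm f)\<^sup>2"
      by (rule order_trans[OF sum_mono[OF le] ell2_sum_le_norm])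
  qed simp
qed

lemma eventually_at_left_1: "\<forall>\<^sub>F r in at_left (1::real). 0 \<le> r \<and> r < 1"
  using eventually_at_left_real[of 0 "1::real"] by (rule eventually_mono) auto

lemma degree_scale_tendsto: "((\<lambda>r. degree_scale k r f) \<longlongrightarrow> f) (at_left 1)"
proof (rule fock_tendsto[where B = "\<lambda>f. f"])
  show "\<forall>\<^sub>F r in at_left 1. \<forall>f g. degree_scale k r (f + g) = degree_scale k r f + degree_scale k r g
      \<and> norm (degree_scale k r f) \<le> norm f"
    using eventually_at_left_1
    by eventually_elim
      (auto simp: ell2_eq_iff Rep_degree_scale norm_degree_scale scaleR_add_right)
  fix w x
  have "\<forall>\<^sub>F r in at_left 1. r ^ (length w - k) *\<^sub>R (fock_basis w \<otimes>\<^sub>F x) = degree_scale k r (fock_basis w \<otimes>\<^sub>F x)"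
    using eventually_at_left_1
    by eventually_elim
      (auto simp: ell2_eq_iff Rep_degree_scale Rep_tensor Rep_fock_basis)
  moreover have "((\<lambda>r. r ^ (length w - k) *\<^sub>R (fock_basis w \<otimes>\<^sub>F x)) \<longlongrightarrow> 1 ^ (length w - k) *\<^sub>R (fock_basis w \<otimes>\<^sub>F x)) (at_left 1)"
    by (intro tendsto_intros)
  ultimately show "((\<lambda>r. degree_scale k r (fock_basis w \<otimes>\<^sub>F x)) \<longlongrightarrow> fock_basis w \<otimes>\<^sub>F x) (at_left 1)"
    using Lim_transform_eventually by fastforce
qed auto

section \<open>The limit r -> 1 and the identification with the characteristic function\<close>

context row_contr
begin

text \<open>On e_w tensor x the claim is the strong convergence of \<open>degree_scale\<close> to
  the identity, applied to one fixed vector; uniform contractivity extends it to all inputs.\<close>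

lemma transfer_tendsto: "((\<lambda>r. transfer r f) \<longlongrightarrow> transfer 1 f) (at_left 1)"
proof (rule fock_tendsto[where A = transfer and B = "transfer 1"])
  show "\<forall>\<^sub>F r in at_left 1. \<forall>f g. transfer r (f + g) = transfer r f + transfer r g
      \<and> norm (transfer r f) \<le> norm f"
    using eventually_at_left_1 by eventually_elim (auto simp: transfer_add norm_transfer_le)
  fix w :: "'n list" and x :: "'h ^ 'n"
  have "Rep_ell2 (fock_basis w \<otimes>\<^sub>F x) v = 0" if "v \<noteq> w" for v
    using that by (simp add: Rep_tensor Rep_fock_basis)
  note basis = out_basis[OF this]
  have "\<forall>\<^sub>F r in at_left 1. degree_scale (length w) r (transfer 1 (fock_basis w \<otimes>\<^sub>F x)) = transfer r (fock_basis w \<otimes>\<^sub>F x)"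
    using eventually_at_left_1
    by eventually_elim (simp add: ell2_eq_iff Rep_degree_scale Rep_transfer flip: basis)
  with degree_scale_tendsto
  show "((\<lambda>r. transfer r (fock_basis w \<otimes>\<^sub>F x)) \<longlongrightarrow> transfer 1 (fock_basis w \<otimes>\<^sub>F x)) (at_left 1)"
    by (rule Lim_transform_eventually)
qed (auto simp: transfer_add norm_transfer_le)

text \<open>Read at the word \<open>w @ [i]\<close>, the resolvent equation is the state recursion,
  and at the empty word it is the initial value 0. Induction on words from the right gives
  injectivity, and the states supply the preimage.\<close>

lemma resolvent_eq:
  assumes r: "0 \<le> r" "r < 1"
  shows "inv (\<lambda>g. g - r *\<^sub>R (\<Sum>i\<in>UNIV. right_creation i (fock_map (cadjoint (T i)) g)))
      (r *\<^sub>R right_row (fock_map D f)) = Abs_ell2 (state r (Rep_ell2 f))" (is "inv ?M ?h = ?y")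
proof (rule inv_f_eq)
  have M: "Rep_ell2 (?M g) [] = Rep_ell2 g []"
    "Rep_ell2 (?M g) (w @ [i]) = Rep_ell2 g (w @ [i]) - r *\<^sub>R cadjoint (T i) (Rep_ell2 g w)" for g w i
    by (simp_all add: Rep_ell2_sum Rep_right_creation
        Rep_fock_map_UNIV[OF bounded_clinear_cadjoint[OF bounded_T]])
  show "inj ?M"
  proof (rule injI)
    fix g g' assume eq: "?M g = ?M g'"
    have "Rep_ell2 g w = Rep_ell2 g' w" for w
    proof (induction w rule: rev_induct)
      case Nil
      then show ?case
        using M(1)[of g] M(1)[of g'] eq by simp
    next
      case (snoc i w)
      then show ?case
        using M(2)[of g w i] M(2)[of g' w i] eq by simp
    qed
    then show "g = g'"
      by (simp add: ell2_eq_iff)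
  qed
  have y: "Rep_ell2 ?y w = state r (Rep_ell2 f) w" for w
    by (simp add: Abs_ell2_inverse state_summable[OF r])
  show "?M ?y = ?h"
    unfolding ell2_eq_iff
  proof
    fix w
    show "Rep_ell2 (?M ?y) w = Rep_ell2 ?h w"
    proof (cases w rule: rev_cases)
      case Nil
      then show ?thesis
        using M(1)[of ?y] y[of "[]"] by (simp add: right_row_def Rep_ell2_sum Rep_right_creation)
    next
      case (snoc u i)
      have "Rep_ell2 ?h w = r *\<^sub>R D (Rep_ell2 f u) $ i"
        by (simp add: snoc right_row_def Rep_ell2_sum Rep_right_creation
            Rep_fock_map_UNIV[OF bounded_clinear_vec_nth] Rep_fock_map_UNIV[OF bounded_D])
      also have "\<dots> = Rep_ell2 ?y (u @ [i]) - r *\<^sub>R cadjoint (T i) (Rep_ell2 ?y u)"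
        unfolding y by (simp add: state_snoc cadjoint_row_op[OF bounded_T] scaleR_add_right)
      finally show ?thesis
        unfolding snoc M(2) by (rule sym)
    qed
  qed
qed

text \<open>Establishes that the limit in the definition exists for every argument;
  \<open>Lim\<close> by itself would denote an arbitrary value otherwise.\<close>

lemma char_fun_eq: "char_fun T f = transfer 1 f"
proof -
  have "\<forall>\<^sub>F r in at_left 1. transfer r f = - fock_map R f + fock_map Ds
      (inv (\<lambda>g. g - r *\<^sub>R (\<Sum>i\<in>UNIV. right_creation i (fock_map (cadjoint (T i)) g)))
        (r *\<^sub>R right_row (fock_map D f)))"
    using eventually_at_left_1
    by eventually_elim
      (simp add: resolvent_eq ell2_eq_iff Rep_transfer Rep_fock_map_UNIV[OF bounded_R]
        Rep_fock_map_UNIV[OF bounded_Ds] Abs_ell2_inverse state_summable out_def)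
  from Lim_transform_eventually[OF transfer_tendsto this]
  show ?thesis
    unfolding char_fun_def by (intro tendsto_Lim) (auto simp: trivial_limit_at_left_real)
qed

lemma Rep_char_fun: "Rep_ell2 (char_fun T f) w = Ds (state 1 (Rep_ell2 f) w) - R (Rep_ell2 f w)"
  by (simp add: char_fun_eq Rep_transfer out_def)

text \<open>Prefixing a letter moves the input into the subtree below \<open>i\<close>. The state is
  still 0 on entering it, so the system runs there as from the root; this is why the input-output
  map commutes with left creation.\<close>

lemma state_left_creation:
  "state r (Rep_ell2 (left_creation i f)) w
    = (if w \<noteq> [] \<and> hd w = i then state r (Rep_ell2 f) (tl w) else 0)"
proof -
  have "D 0 = 0" "Rs 0 = 0"
    using linear_diff(2)[of 0 0] linear_diff(3)[of 0 0] by auto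
  then have "state r (\<lambda>w. if w \<noteq> [] \<and> hd w = i then g (tl w) else 0) w
    = (if w \<noteq> [] \<and> hd w = i then state r g (tl w) else 0)" for g :: "'n list \<Rightarrow> 'h ^ 'n"
  proof (induction w rule: rev_induct)
    case (snoc j w)
    then show ?case
      using state_snoc[of r _ "[]" j] by (cases "w = []") (auto simp: state_snoc)
  qed simp
  moreover have "Rep_ell2 (left_creation i f) = (\<lambda>w. if w \<noteq> [] \<and> hd w = i then Rep_ell2 f (tl w) else 0)"
    by (auto simp: Rep_left_creation)
  ultimately show ?thesis
    by simp
qed

lemma multi_analytic_char_fun: "multi_analytic \<D> \<D>s (char_fun T)"
  unfolding multi_analytic_def
proof (intro conjI allI ballI)
  show "bounded_clinear_on (fock_of \<D>) (fock_of \<D>s) (char_fun T)"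
    unfolding bounded_clinear_on_def
  proof (intro conjI ballI allI exI[of _ 1])
    show "char_fun T f \<in> fock_of \<D>s" if "f \<in> fock_of \<D>" for f
      using that by (simp add: fock_of_def Rep_char_fun julia_mem)
  qed (auto simp: char_fun_eq transfer_add transfer_scaleC norm_transfer_le)
  have "Ds 0 = 0" "R 0 = 0"
    using linear_diff(1)[of 0 0] linear_diff(4)[of 0 0] by auto
  then show "char_fun T (left_creation i f) = left_creation i (char_fun T f)" for i f
    by (simp add: ell2_eq_iff Rep_char_fun Rep_left_creation state_left_creation)
qed

end

section \<open>Multi-analytic operators and coincidence\<close>

lemma Rep_fock_diag:
  "Rep_ell2 (fock_diag A B f) w = (Rep_ell2 (A (fock_map fst f)) w, Rep_ell2 (B (fock_map snd f)) w)"
proof -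
  have "(\<lambda>w. (norm (Rep_ell2 (A (fock_map fst f)) w, Rep_ell2 (B (fock_map snd f)) w))\<^sup>2) summable_on UNIV"
    by (simp add: norm_prod_squared summable_on_add summable_Rep_ell2)
  then show ?thesis
    by (simp add: fock_diag_def Abs_ell2_inverse)
qed

lemma fock_map_mem:
  assumes "unitary_on V W U" "f \<in> fock_of V"
  shows "Rep_ell2 (fock_map U f) w = U (Rep_ell2 f w)" "fock_map U f \<in> fock_of W"
  using Rep_fock_map[OF unitary_on_bounded[OF assms(1)] assms(2)] assms unitary_on_mem[OF assms(1)]
  by (auto simp: fock_of_def)

lemma csubspace_fock_of: "csubspace V \<Longrightarrow> csubspace (fock_of V)"
  by (simp add: csubspace_def fock_of_def)

lemma left_creation_mem: "csubspace V \<Longrightarrow> f \<in> fock_of V \<Longrightarrow> left_creation i f \<in> fock_of V"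
  by (simp add: fock_of_def Rep_left_creation csubspace_0)

lemma multi_analytic_fock_map:
  fixes U :: "'h::chilbert_space \<Rightarrow> 'k::chilbert_space"
  assumes V: "csubspace V" and U: "unitary_on V W U"
  shows "multi_analytic V W (fock_map U :: ('n, 'h) fock \<Rightarrow> ('n, 'k) fock)"
  unfolding multi_analytic_def bounded_clinear_on_def
proof (intro conjI ballI allI exI[of _ 1])
  note lin = unitary_on_clinear_on[OF U]
  note sV = csubspace_fock_of[OF V]
  fix f :: "('n, 'h) fock" assume f: "f \<in> fock_of V"
  have mem: "Rep_ell2 f w \<in> V" for w
    using f by (simp add: fock_of_def)
  show "fock_map U f \<in> fock_of W"
    by (rule fock_map_mem[OF U f])
  show "fock_map U (f + g) = fock_map U f + fock_map U g" if g: "g \<in> fock_of V" for g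
    using mem g csubspace_add[OF sV f g]
    by (simp add: ell2_eq_iff fock_map_mem(1)[OF U] f clinear_on_add[OF lin] fock_of_def)
  show "fock_map U (c *\<^sub>C f) = c *\<^sub>C fock_map U f" for c
    using csubspace_scale[OF sV f, of c]
    by (simp add: ell2_eq_iff fock_map_mem(1)[OF U] f clinear_on_scale[OF lin mem])
  have "(norm (fock_map U f))\<^sup>2 = (norm f)\<^sup>2"
    unfolding ell2_norm_squared by (simp add: fock_map_mem(1)[OF U f] unitary_on_norm[OF U mem])
  then show "norm (fock_map U f) \<le> 1 * norm f"
    by (simp add: power2_eq_iff_nonneg)
next
  fix i and f :: "('n, 'h) fock" assume f: "f \<in> fock_of V"
  have "U 0 = 0"
    using unitary_on_norm[OF U csubspace_0[OF V]] by simp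
  then show "fock_map U (left_creation i f) = left_creation i (fock_map U f)"
    by (simp add: ell2_eq_iff fock_map_mem(1)[OF U] f left_creation_mem[OF V f] Rep_left_creation)
qed

lemma multi_analytic_compose:
  assumes M: "multi_analytic V W M" and M': "multi_analytic W Z M'"
  shows "multi_analytic V Z (\<lambda>f. M' (M f))"
proof -
  obtain K where K: "\<And>f. f \<in> fock_of V \<Longrightarrow> norm (M f) \<le> K * norm f"
    using M unfolding multi_analytic_def bounded_clinear_on_def by blast
  obtain K' where K': "\<And>f. f \<in> fock_of W \<Longrightarrow> norm (M' f) \<le> K' * norm f"
    using M' unfolding multi_analytic_def bounded_clinear_on_def by blast
  have "norm (M' (M f)) \<le> (\<bar>K'\<bar> * K) * norm f" if "f \<in> fock_of V" for f
  proof -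
    have "norm (M' (M f)) \<le> K' * norm (M f)"
      using K' M that by (simp add: multi_analytic_def bounded_clinear_on_def)
    also have "\<dots> \<le> \<bar>K'\<bar> * norm (M f)"
      by (intro mult_right_mono) auto
    also have "\<dots> \<le> \<bar>K'\<bar> * (K * norm f)"
      by (intro mult_left_mono K that) auto
    finally show ?thesis
      by (simp add: mult.assoc)
  qed
  then show ?thesis
    using M M' unfolding multi_analytic_def bounded_clinear_on_def by auto
qed

lemma multi_analytic_cong:
  assumes "csubspace V" "multi_analytic V W M" "\<And>f. f \<in> fock_of V \<Longrightarrow> M' f = M f"
  shows "multi_analytic V W M'"
proof -
  note sV = csubspace_fock_of[OF assms(1)]
  show ?thesis
    unfolding multi_analytic_def bounded_clinear_on_def
  proof (intro conjI ballI allI)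
    show "\<exists>K. \<forall>f\<in>fock_of V. norm (M' f) \<le> K * norm f"
      using assms(2) by (simp add: multi_analytic_def bounded_clinear_on_def assms(3))
  qed (use assms(2) in \<open>simp_all add: multi_analytic_def bounded_clinear_on_def assms(3)
      csubspace_add[OF sV] csubspace_scale[OF sV] left_creation_mem[OF assms(1)]\<close>)
qed

text \<open>Coincidence demands multi-analyticity of both operators. That of \<open>M'\<close> is
  inherited from \<open>M\<close> by conjugating with the unitaries, so a product of several factors
  need not be examined factor by factor.\<close>

lemma coincideI:
  assumes V: "csubspace V" and M: "multi_analytic V U M"
    and U: "csubspace U" and W: "unitary_on V V' W" and W1: "unitary_on U U' W1"
    and eq: "\<And>f. f \<in> fock_of V \<Longrightarrow> M' (fock_map W f) = fock_map W1 (M f)"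
  shows "coincide V U M V' U' M'"
proof -
  obtain W' where W': "unitary_on V' V W'" "\<forall>y\<in>V'. W (W' y) = y"
    using unitary_on_inverse[OF V W] by metis
  have V': "csubspace V'"
    using csubspace_image[OF V unitary_on_clinear_on[OF W]] unitary_on_image[OF W] by simp
  have "M' h = fock_map W1 (M (fock_map W' h))" if h: "h \<in> fock_of V'" for h
  proof -
    have "fock_map W (fock_map W' h) = h"
      using fock_map_mem(1)[OF W fock_map_mem(2)[OF W'(1) h]] fock_map_mem(1)[OF W'(1) h] W'(2) h
      by (simp add: ell2_eq_iff fock_of_def)
    then show ?thesis
      using eq[OF fock_map_mem(2)[OF W'(1) h]] by simp
  qed
  moreover have "multi_analytic V' U' (\<lambda>h. fock_map W1 (M (fock_map W' h)))"
    by (intro multi_analytic_compose[OF multi_analytic_compose[OF multi_analytic_fock_map[OF V' W'(1)] M]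
          multi_analytic_fock_map[OF U W1]])
  ultimately have "multi_analytic V' U' M'"
    using multi_analytic_cong[OF V'] by blast
  then show ?thesis
    using M W W1 eq unfolding coincide_def by (intro conjI exI[of _ W] exI[of _ W1]) auto
qed

section \<open>Upper triangular row contractions\<close>

lemma bounded_clinear_0: "bounded_clinear A \<Longrightarrow> A 0 = 0"
  by (metis bounded_clinear_scale scaleC_zero_left)

lemma clinear_on_row_contr:
  assumes "row_contraction T" "clinear_on L x" "clinear_on L f"
  shows "clinear_on L (\<lambda>l. cadjoint (row_op T) (x l) + defect_op T (f l))"
    "clinear_on L (\<lambda>l. defect_op_star T (x l) - row_op T (f l))"
proof -
  interpret row_contr T
    by unfold_locales (rule assms(1))
  show "clinear_on L (\<lambda>l. Rs (x l) + D (f l))" "clinear_on L (\<lambda>l. Ds (x l) - R (f l))"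
    by (intro clinear_on_plus clinear_on_minus clinear_on_compose_UNIV[OF _ clinear(1)]
        clinear_on_compose_UNIV[OF _ clinear(2)] clinear_on_compose_UNIV[OF _ clinear(3)]
        clinear_on_compose_UNIV[OF _ clinear(4)] assms(2,3))+
qed

locale block_row_contraction =
  fixes T :: "'n::finite \<Rightarrow> 'h1::chilbert_space \<times> 'h0::chilbert_space \<times> 'hm::chilbert_space
                \<Rightarrow> 'h1 \<times> 'h0 \<times> 'hm"
    and S :: "'n \<Rightarrow> 'h1 \<Rightarrow> 'h1" and N :: "'n \<Rightarrow> 'h0 \<Rightarrow> 'h0" and C :: "'n \<Rightarrow> 'hm \<Rightarrow> 'hm"
    and X :: "'n \<Rightarrow> 'h0 \<Rightarrow> 'h1" and Y :: "'n \<Rightarrow> 'hm \<Rightarrow> 'h1" and Z :: "'n \<Rightarrow> 'hm \<Rightarrow> 'h0"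
  assumes row_contraction_T: "row_contraction T"
    and bounded: "\<And>i. bounded_clinear (S i)" "\<And>i. bounded_clinear (N i)" "\<And>i. bounded_clinear (C i)"
      "\<And>i. bounded_clinear (X i)" "\<And>i. bounded_clinear (Y i)" "\<And>i. bounded_clinear (Z i)"
    and T_block: "\<And>i x y z. T i (x, y, z) = (S i x + X i y + Y i z, N i y + Z i z, C i z)"
begin

definition emb1 :: "'h1 ^ 'n \<Rightarrow> ('h1 \<times> 'h0 \<times> 'hm) ^ 'n" where "emb1 u = (\<chi> i. (u $ i, 0, 0))"
definition emb0 :: "'h0 ^ 'n \<Rightarrow> ('h1 \<times> 'h0 \<times> 'hm) ^ 'n" where "emb0 u = (\<chi> i. (0, u $ i, 0))"
definition embm :: "'hm ^ 'n \<Rightarrow> ('h1 \<times> 'h0 \<times> 'hm) ^ 'n" where "embm u = (\<chi> i. (0, 0, u $ i))"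

lemma emb_nth [simp]: "emb1 u $ i = (u $ i, 0, 0)" "emb0 v $ i = (0, v $ i, 0)" "embm w $ i = (0, 0, w $ i)"
  by (simp_all add: emb1_def emb0_def embm_def)

text \<open>Triangularity in the form used for splitting: the two zeros for \<open>emb1\<close> and
  the one for \<open>emb0\<close> are the vanishing of the remaining states that \<open>peel\<close>
  asks of its lift.\<close>

lemma row_op_emb:
  "row_op T (emb1 u) = (row_op S u, 0, 0)"
  "row_op T (emb0 v) = (\<Sum>i\<in>UNIV. X i (v $ i), row_op N v, 0)"
  "row_op T (embm w) = (\<Sum>i\<in>UNIV. Y i (w $ i), \<Sum>i\<in>UNIV. Z i (w $ i), row_op C w)"
  by (simp_all add: row_op_def T_block bounded[THEN bounded_clinear_0]
      prod_eq_iff fst_sum snd_sum)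

lemma norm_emb: "norm (emb1 u) = norm u" "norm (emb0 v) = norm v" "norm (embm w) = norm w"
proof -
  have "(norm (emb1 u))\<^sup>2 = (norm u)\<^sup>2" "(norm (emb0 v))\<^sup>2 = (norm v)\<^sup>2" "(norm (embm w))\<^sup>2 = (norm w)\<^sup>2"
    unfolding norm_vec_squared by (simp_all add: norm_prod_squared)
  then show "norm (emb1 u) = norm u" "norm (emb0 v) = norm v" "norm (embm w) = norm w"
    by (simp_all add: power2_eq_iff_nonneg)
qed

sublocale T: row_contr T
  by unfold_locales (rule row_contraction_T)

text \<open>The diagonal entries are compressions: the row operator of \<open>S\<close> is a
  component of that of \<open>T\<close> on embedded vectors, and passing to a component does not
  increase the norm; likewise for \<open>N\<close> and \<open>C\<close>.\<close>

sublocale S: row_contr S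
proof
  have "norm (row_op S u) \<le> norm u" for u
    using T.norm_R[of "emb1 u"] by (simp add: row_op_emb norm_emb norm_Pair)
  then show "row_contraction S"
    by (simp add: row_contraction_iff bounded)
qed

sublocale N: row_contr N
proof
  have "norm (row_op N u) \<le> norm u" for u
    using T.norm_R[of "emb0 u"] norm_fst_le[of "row_op N u" "0 :: 'hm"]
      norm_snd_le[of "(row_op N u, 0 :: 'hm)" "\<Sum>i\<in>UNIV. X i (u $ i)"]
    by (simp add: row_op_emb norm_emb )
  then show "row_contraction N"
    by (simp add: row_contraction_iff bounded)
qed

sublocale C: row_contr C
proof
  have "norm (row_op C u) \<le> norm u" for u
    using T.norm_R[of "embm u"] norm_snd_le[of "(\<Sum>i\<in>UNIV. Z i (u $ i), row_op C u)" "\<Sum>i\<in>UNIV. Y i (u $ i)"]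
      norm_snd_le[of "row_op C u" "\<Sum>i\<in>UNIV. Z i (u $ i)"]
    by (simp add: row_op_emb norm_emb)
  then show "row_contraction C"
    by (simp add: row_contraction_iff bounded)
qed

lemma norm_blocks:
  "(norm v)\<^sup>2 = (norm (\<chi> i. fst (v $ i)))\<^sup>2 + (norm (\<chi> i. fst (snd (v $ i))))\<^sup>2
    + (norm (\<chi> i. snd (snd (v $ i))))\<^sup>2" for v :: "('h1 \<times> 'h0 \<times> 'hm) ^ 'n"
  unfolding norm_vec_squared by (simp add: norm_prod_squared sum.distrib)

text \<open>
  The Julia operator of \<open>T\<close> is the cascade of the Julia operators of \<open>S\<close>, \<open>N\<close> and \<open>C\<close>,
  connected by the constant unitaries \<open>W\<close>, \<open>\<tau>\<^sub>2\<close>, \<open>\<tau>\<^sub>1\<close> and \<open>W\<^sub>1\<close>.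
\<close>

definition cascade where
  "cascade W W\<^sub>1 \<tau>\<^sub>1 \<tau>\<^sub>2 \<longleftrightarrow> (\<forall>x1 x0 xm. \<forall>f\<in>T.\<D>.
     let a = fst (W f); b = S.Ds x1 - S.R a;
         c = fst (\<tau>\<^sub>2 (b, snd (W f))); d = N.Ds x0 - N.R c;
         p = fst (\<tau>\<^sub>1 (d, snd (\<tau>\<^sub>2 (b, snd (W f))))); q = C.Ds xm - C.R p;
         y = T.Rs (x1, x0, xm) + T.D f
     in (\<chi> i. fst (y $ i)) = S.Rs x1 + S.D a \<and>
        (\<chi> i. fst (snd (y $ i))) = N.Rs x0 + N.D c \<and>
        (\<chi> i. snd (snd (y $ i))) = C.Rs xm + C.D p \<and>
        W\<^sub>1 (T.Ds (x1, x0, xm) - T.R f) = (q, snd (\<tau>\<^sub>1 (d, snd (\<tau>\<^sub>2 (b, snd (W f)))))))"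

text \<open>\<open>peel\<close> for \<open>S\<close>, \<open>N\<close> and \<open>C\<close> yields
  \<open>W\<close>, \<open>\<tau>\<^sub>2\<close> and \<open>\<tau>\<^sub>1\<close> in this order.
  The last unitary \<open>W\<^sub>1\<close> compares the output of \<open>T\<close> with the end of
  the cascade, both regarded as functions of state and input.\<close>

lemma cascade_exists:
  obtains E\<^sub>1 E\<^sub>2 E :: "('n, 'h1 \<times> 'h0 \<times> 'hm) aux set" and W W\<^sub>1 \<tau>\<^sub>1 \<tau>\<^sub>2 where
    "closed_csubspace E\<^sub>1" "closed_csubspace E\<^sub>2" "closed_csubspace E"
    "unitary_on T.\<D> (S.\<D> \<times> E\<^sub>2) W" "unitary_on T.\<D>s (C.\<D>s \<times> E\<^sub>1) W\<^sub>1"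
    "unitary_on (N.\<D>s \<times> E) (C.\<D> \<times> E\<^sub>1) \<tau>\<^sub>1" "unitary_on (S.\<D>s \<times> E\<^sub>2) (N.\<D> \<times> E) \<tau>\<^sub>2"
    "cascade W W\<^sub>1 \<tau>\<^sub>1 \<tau>\<^sub>2"
proof -
  define L :: "(('h1 \<times> 'h0 \<times> 'hm) \<times> (('h1 \<times> 'h0 \<times> 'hm) ^ 'n)) set" where "L = UNIV \<times> T.\<D>"
  have L: "csubspace L"
    unfolding L_def by (intro csubspace_Times csubspace_UNIV T.csubspace_defect)
  define out where "out l = T.Rs (fst l) + T.D (snd l)" for l
  define g where "g l = T.Ds (fst l) - T.R (snd l)" for l
  define y1 where "y1 l = (\<chi> i. fst (out l $ i))" for l
  define y0 where "y0 l = (\<chi> i. fst (snd (out l $ i)))" for l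
  define ym where "ym l = (\<chi> i. snd (snd (out l $ i)))" for l
  define x1 :: "('h1 \<times> 'h0 \<times> 'hm) \<times> (('h1 \<times> 'h0 \<times> 'hm) ^ 'n) \<Rightarrow> 'h1" where "x1 l = fst (fst l)" for l
  define x0 :: "('h1 \<times> 'h0 \<times> 'hm) \<times> (('h1 \<times> 'h0 \<times> 'hm) ^ 'n) \<Rightarrow> 'h0" where "x0 l = fst (snd (fst l))" for l
  define xm :: "('h1 \<times> 'h0 \<times> 'hm) \<times> (('h1 \<times> 'h0 \<times> 'hm) ^ 'n) \<Rightarrow> 'hm" where "xm l = snd (snd (fst l))" for l
  have lin_out: "clinear_on L out" and lin_g: "clinear_on L g"
    unfolding out_def[abs_def] g_def[abs_def]
    by (intro clinear_on_row_contr[OF row_contraction_T clinear_on_fst clinear_on_snd])+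
  have lin_x: "clinear_on L x1" "clinear_on L x0" "clinear_on L xm"
    unfolding x1_def[abs_def] x0_def[abs_def] xm_def[abs_def]
    by (intro clinear_on_compose_UNIV[OF _ clinear_on_fst] clinear_on_compose_UNIV[OF _ clinear_on_snd]
        clinear_on_fst clinear_on_snd)+
  have lin_y: "clinear_on L y1" "clinear_on L y0" "clinear_on L ym"
    unfolding y1_def[abs_def] y0_def[abs_def] ym_def[abs_def]
    by (intro clinear_on_vec_lambda clinear_on_compose_UNIV[OF _ clinear_on_fst]
        clinear_on_compose_UNIV[OF _ clinear_on_snd] clinear_on_compose_UNIV[OF lin_out clinear_on_vec_nth])+
  have energy: "(norm (x1 l))\<^sup>2 + (norm (x0 l))\<^sup>2 + (norm (xm l))\<^sup>2 + (norm (snd l))\<^sup>2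
      = (norm (y1 l))\<^sup>2 + (norm (y0 l))\<^sup>2 + (norm (ym l))\<^sup>2 + (norm (g l))\<^sup>2" for l
    using T.julia_norm[of "fst l" "snd l"]
    unfolding norm_blocks[of "T.Rs (fst l) + T.D (snd l)"]
    by (simp add: x1_def x0_def xm_def y1_def y0_def ym_def out_def g_def norm_prod_squared)
  \<comment> \<open>\<open>l\<close> is the adjoint of the Julia operator of \<open>T\<close> at
    \<open>(u, 0)\<close>. Applied to vectors of a single block it supplies the lifting hypothesis
    of \<open>peel\<close> at all three stages.\<close>
  have lift: "\<exists>l\<in>L. out l = u \<and> g l = 0 \<and> fst l = T.R u" for u
  proof -
    have "T.Ds 0 = 0" "T.Rs 0 = 0"
      using T.bounded_Ds T.bounded_Rs by (simp_all add: bounded_clinear_0)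
    then show ?thesis
      using T.julia_surj[OF csubspace_0[OF T.csubspace_defect(2)], of u]
      by (intro bexI[of _ "(T.R u, T.D u)"]) (simp_all add: out_def g_def L_def)
  qed

  \<comment> \<open>Puts the first auxiliary space into 0 + H^n, leaving all of H free for the
    defect spaces of S and N.\<close>
  define \<phi>2 :: "('h1 \<times> 'h0 \<times> 'hm) ^ 'n \<Rightarrow> ('n, 'h1 \<times> 'h0 \<times> 'hm) aux" where "\<phi>2 f = (0, f)" for f
  have \<phi>2: "bounded_clinear \<phi>2" "norm (\<phi>2 f) = norm f" for f
    by (auto simp: \<phi>2_def[abs_def] scaleC_prod_def norm_Pair simp flip: zero_prod_def
        intro!: bounded_clinearI bounded_linear_Pair bounded_linear_zero bounded_linear_ident)
  obtain E2 W where W: "closed_csubspace E2" "E2 \<subseteq> \<phi>2 ` T.\<D>" "unitary_on T.\<D> (S.\<D> \<times> E2) W"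
    "\<forall>l\<in>L. y1 l = S.Rs (x1 l) + S.D (fst (W (snd l)))"
  proof (rule S.peel[OF L lin_x(1) _ clinear_on_snd lin_y(1) _ _ _ T.closed_csubspace_defect(1) _ \<phi>2])
    show "clinear_on L (\<lambda>l. (x0 l, xm l))" "clinear_on L (\<lambda>l. ((y0 l, ym l), g l))"
      by (intro clinear_on_Pair lin_x lin_y lin_g)+
    show "(norm (x1 l))\<^sup>2 + (norm (x0 l, xm l))\<^sup>2 + (norm (snd l))\<^sup>2
        = (norm (y1 l))\<^sup>2 + (norm ((y0 l, ym l), g l))\<^sup>2" for l
      using energy[of l] by (simp add: norm_prod_squared)
    show "\<exists>l\<in>L. y1 l = u \<and> ((y0 l, ym l), g l) = 0 \<and> x1 l = S.R u \<and> (x0 l, xm l) = 0" for u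
    proof -
      obtain l where "l \<in> L" "out l = emb1 u" "g l = 0" "fst l = T.R (emb1 u)"
        using lift[of "emb1 u"] by blast
      then show ?thesis
        by (intro bexI[of _ l])
          (simp_all add: y1_def y0_def ym_def x1_def x0_def xm_def row_op_emb
            vec_eq_iff prod_eq_iff)
    qed
    show "snd ` L \<subseteq> T.\<D>"
      by (auto simp: L_def)
  qed blast
  define a where "a l = fst (W (snd l))" for l :: "('h1 \<times> 'h0 \<times> 'hm) \<times> (('h1 \<times> 'h0 \<times> 'hm) ^ 'n)"
  define e2 where "e2 l = snd (W (snd l))" for l :: "('h1 \<times> 'h0 \<times> 'hm) \<times> (('h1 \<times> 'h0 \<times> 'hm) ^ 'n)"
  define b where "b l = S.Ds (x1 l) - S.R (a l)" for l
  have lin_W: "clinear_on L (\<lambda>l. W (snd l))"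
    by (rule clinear_on_compose[OF clinear_on_snd unitary_on_clinear_on[OF W(3)]]) (auto simp: L_def)
  have lin_a: "clinear_on L a" and lin_e2: "clinear_on L e2"
    unfolding a_def[abs_def] e2_def[abs_def]
    by (rule clinear_on_compose_UNIV[OF lin_W clinear_on_fst] clinear_on_compose_UNIV[OF lin_W clinear_on_snd])+
  have lin_b: "clinear_on L b"
    unfolding b_def[abs_def] by (rule clinear_on_row_contr[OF S.row_contraction lin_x(1) lin_a])
  have mem_a: "a l \<in> S.\<D>" "e2 l \<in> E2" if "l \<in> L" for l
    using unitary_on_mem[OF W(3), of "snd l"] that by (auto simp: a_def e2_def L_def mem_Times_iff)
  have mem_b: "b l \<in> S.\<D>s" if "l \<in> L" for l
    unfolding b_def by (rule S.julia_mem[OF mem_a(1)[OF that]])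
  have energy_W: "(norm (snd l))\<^sup>2 = (norm (a l))\<^sup>2 + (norm (e2 l))\<^sup>2" if "l \<in> L" for l
    using unitary_on_norm[OF W(3), of "snd l"] that norm_prod_squared[of "W (snd l)"]
    by (auto simp: a_def e2_def L_def)
  have energy_S: "(norm (y1 l))\<^sup>2 + (norm (b l))\<^sup>2 = (norm (x1 l))\<^sup>2 + (norm (a l))\<^sup>2" if "l \<in> L" for l
    unfolding W(4)[rule_format, OF that] b_def a_def[symmetric] by (rule S.julia_norm)

  \<comment> \<open>On the space being split, the second component lies in 0 + H^n, so the defect
    vector of S can occupy the H_1 slot and the map is isometric there; the H_0 slot stays
    free.\<close>
  define \<phi>0 :: "'h1 \<times> ('n, 'h1 \<times> 'h0 \<times> 'hm) aux \<Rightarrow> ('n, 'h1 \<times> 'h0 \<times> 'hm) aux"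
    where "\<phi>0 z = ((fst z, 0, 0), snd (snd z))" for z
  have \<phi>0: "bounded_clinear \<phi>0"
    unfolding \<phi>0_def[abs_def]
    by (intro bounded_clinearI bounded_linear_Pair bounded_linear_zero bounded_linear_fst
        bounded_linear_compose[OF bounded_linear_snd bounded_linear_snd])
      (simp add: scaleC_prod_def)
  have norm_\<phi>0: "norm (\<phi>0 z) = norm z" if "z \<in> S.\<D>s \<times> E2" for z
    using that W(2) by (auto simp: \<phi>0_def \<phi>2_def norm_Pair)
  have V0: "closed_csubspace (S.\<D>s \<times> E2)"
    by (intro closed_csubspace_Times W(1) S.closed_csubspace_defect)
  obtain E \<tau>2 where \<tau>2: "closed_csubspace E" "E \<subseteq> \<phi>0 ` (S.\<D>s \<times> E2)"
    "unitary_on (S.\<D>s \<times> E2) (N.\<D> \<times> E) \<tau>2"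
    "\<forall>l\<in>L. y0 l = N.Rs (x0 l) + N.D (fst (\<tau>2 (b l, e2 l)))"
  proof (rule N.peel[OF L lin_x(2) lin_x(3) _ lin_y(2) _ _ _ V0 _ \<phi>0 norm_\<phi>0])
    show "clinear_on L (\<lambda>l. (b l, e2 l))" "clinear_on L (\<lambda>l. (ym l, g l))"
      by (intro clinear_on_Pair lin_b lin_e2 lin_y lin_g)+
    \<comment> \<open>The balance of T minus that of the Julia operator of S: \<open>x1\<close> and
      \<open>y1\<close> cancel, and \<open>b\<close> takes the place of \<open>a\<close> as
      input.\<close>
    show "(norm (x0 l))\<^sup>2 + (norm (xm l))\<^sup>2 + (norm (b l, e2 l))\<^sup>2
        = (norm (y0 l))\<^sup>2 + (norm (ym l, g l))\<^sup>2" if "l \<in> L" for l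
      using energy[of l] energy_W[OF that] energy_S[OF that] by (simp add: norm_prod_squared)
    \<comment> \<open>Here \<open>x1 l\<close> is in general nonzero, through the entries X, but it
      has left the energy balance.\<close>
    show "\<exists>l\<in>L. y0 l = u \<and> (ym l, g l) = 0 \<and> x0 l = N.R u \<and> xm l = 0" for u
    proof -
      obtain l where "l \<in> L" "out l = emb0 u" "g l = 0" "fst l = T.R (emb0 u)"
        using lift[of "emb0 u"] by blast
      then show ?thesis
        by (intro bexI[of _ l])
          (simp_all add: y1_def y0_def ym_def x1_def x0_def xm_def row_op_emb
            vec_eq_iff prod_eq_iff)
    qed
    show "(\<lambda>l. (b l, e2 l)) ` L \<subseteq> S.\<D>s \<times> E2"
      using mem_a mem_b by auto
  qed blast
  define c where "c l = fst (\<tau>2 (b l, e2 l))" for l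
  define e where "e l = snd (\<tau>2 (b l, e2 l))" for l
  define d where "d l = N.Ds (x0 l) - N.R (c l)" for l
  have lin_\<tau>2: "clinear_on L (\<lambda>l. \<tau>2 (b l, e2 l))"
    by (rule clinear_on_compose[OF clinear_on_Pair[OF lin_b lin_e2] unitary_on_clinear_on[OF \<tau>2(3)]])
      (use mem_a mem_b in auto)
  have lin_c: "clinear_on L c" and lin_e: "clinear_on L e"
    unfolding c_def[abs_def] e_def[abs_def]
    by (rule clinear_on_compose_UNIV[OF lin_\<tau>2 clinear_on_fst] clinear_on_compose_UNIV[OF lin_\<tau>2 clinear_on_snd])+
  have lin_d: "clinear_on L d"
    unfolding d_def[abs_def] by (rule clinear_on_row_contr[OF N.row_contraction lin_x(2) lin_c])
  have mem_c: "c l \<in> N.\<D>" "e l \<in> E" if "l \<in> L" for l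
    using unitary_on_mem[OF \<tau>2(3), of "(b l, e2 l)"] mem_a mem_b that
    by (auto simp: c_def e_def mem_Times_iff)
  have mem_d: "d l \<in> N.\<D>s" if "l \<in> L" for l
    unfolding d_def by (rule N.julia_mem[OF mem_c(1)[OF that]])
  have energy_\<tau>2: "(norm (b l))\<^sup>2 + (norm (e2 l))\<^sup>2 = (norm (c l))\<^sup>2 + (norm (e l))\<^sup>2" if "l \<in> L" for l
    using unitary_on_norm[OF \<tau>2(3), of "(b l, e2 l)"] mem_a mem_b that
      norm_prod_squared[of "\<tau>2 (b l, e2 l)"] norm_prod_squared[of "(b l, e2 l)"]
    by (auto simp: c_def e_def)
  have energy_N: "(norm (y0 l))\<^sup>2 + (norm (d l))\<^sup>2 = (norm (x0 l))\<^sup>2 + (norm (c l))\<^sup>2" if "l \<in> L" for l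
    unfolding \<tau>2(4)[rule_format, OF that] d_def c_def[symmetric] by (rule N.julia_norm)

  \<comment> \<open>Elements of \<open>E\<close> use only the H_1 slot and H^n, so the defect vector
    of N fits isometrically into the H_0 slot.\<close>
  define \<phi>1 :: "'h0 \<times> ('n, 'h1 \<times> 'h0 \<times> 'hm) aux \<Rightarrow> ('n, 'h1 \<times> 'h0 \<times> 'hm) aux"
    where "\<phi>1 z = ((fst (fst (snd z)), fst z, 0), snd (snd z))" for z
  have \<phi>1: "bounded_clinear \<phi>1"
    unfolding \<phi>1_def[abs_def]
    by (intro bounded_clinearI bounded_linear_Pair bounded_linear_zero bounded_linear_fst
        bounded_linear_compose[OF bounded_linear_snd bounded_linear_snd]
        bounded_linear_compose[OF bounded_linear_fst
          bounded_linear_compose[OF bounded_linear_fst bounded_linear_snd]])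
      (simp add: scaleC_prod_def)
  have norm_\<phi>1: "norm (\<phi>1 z) = norm z" if "z \<in> N.\<D>s \<times> E" for z
    using that \<tau>2(2) by (auto simp: \<phi>1_def \<phi>0_def norm_Pair add_ac)
  have V1: "closed_csubspace (N.\<D>s \<times> E)"
    by (intro closed_csubspace_Times \<tau>2(1) N.closed_csubspace_defect)
  obtain E1 :: "('n, 'h1 \<times> 'h0 \<times> 'hm) aux set" and \<tau>1 where \<tau>1: "closed_csubspace E1"
    "unitary_on (N.\<D>s \<times> E) (C.\<D> \<times> E1) \<tau>1"
    "\<forall>l\<in>L. ym l = C.Rs (xm l) + C.D (fst (\<tau>1 (d l, e l)))"
  proof (rule C.peel[OF L lin_x(3) _ _ lin_y(3) lin_g _ _ V1 _ \<phi>1 norm_\<phi>1])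
    \<comment> \<open>After S and N no further state remains beside that of C, so the slot
      \<open>p\<close> of \<open>peel\<close> is filled with the constant 0.\<close>
    show "clinear_on L (\<lambda>l. 0 :: complex)" "clinear_on L (\<lambda>l. (d l, e l))"
      by (intro clinear_on_0 clinear_on_Pair lin_d lin_e)+
    show "(norm (xm l))\<^sup>2 + (norm (0 :: complex))\<^sup>2 + (norm (d l, e l))\<^sup>2
        = (norm (ym l))\<^sup>2 + (norm (g l))\<^sup>2" if "l \<in> L" for l
      using energy[of l] energy_W[OF that] energy_S[OF that] energy_\<tau>2[OF that] energy_N[OF that]
      by (simp add: norm_prod_squared)
    show "\<exists>l\<in>L. ym l = u \<and> g l = 0 \<and> xm l = C.R u \<and> (0 :: complex) = 0" for u
    proof -
      obtain l where "l \<in> L" "out l = embm u" "g l = 0" "fst l = T.R (embm u)"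
        using lift[of "embm u"] by blast
      then show ?thesis
        by (intro bexI[of _ l])
          (simp_all add: y1_def y0_def ym_def x1_def x0_def xm_def row_op_emb
            vec_eq_iff prod_eq_iff)
    qed
    show "(\<lambda>l. (d l, e l)) ` L \<subseteq> N.\<D>s \<times> E"
      using mem_c mem_d by auto
  qed blast
  define p where "p l = fst (\<tau>1 (d l, e l))" for l
  define e1 where "e1 l = snd (\<tau>1 (d l, e l))" for l
  define q where "q l = C.Ds (xm l) - C.R (p l)" for l
  have lin_\<tau>1: "clinear_on L (\<lambda>l. \<tau>1 (d l, e l))"
    by (rule clinear_on_compose[OF clinear_on_Pair[OF lin_d lin_e] unitary_on_clinear_on[OF \<tau>1(2)]])
      (use mem_c mem_d in auto)
  have lin_p: "clinear_on L p" and lin_e1: "clinear_on L e1"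
    unfolding p_def[abs_def] e1_def[abs_def]
    by (rule clinear_on_compose_UNIV[OF lin_\<tau>1 clinear_on_fst] clinear_on_compose_UNIV[OF lin_\<tau>1 clinear_on_snd])+
  have lin_q: "clinear_on L q"
    unfolding q_def[abs_def] by (rule clinear_on_row_contr[OF C.row_contraction lin_x(3) lin_p])
  have mem_p: "p l \<in> C.\<D>" "e1 l \<in> E1" if "l \<in> L" for l
    using unitary_on_mem[OF \<tau>1(2), of "(d l, e l)"] mem_c mem_d that
    by (auto simp: p_def e1_def mem_Times_iff)
  have mem_q: "q l \<in> C.\<D>s" if "l \<in> L" for l
    unfolding q_def by (rule C.julia_mem[OF mem_p(1)[OF that]])
  have energy_\<tau>1: "(norm (d l))\<^sup>2 + (norm (e l))\<^sup>2 = (norm (p l))\<^sup>2 + (norm (e1 l))\<^sup>2" if "l \<in> L" for l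
    using unitary_on_norm[OF \<tau>1(2), of "(d l, e l)"] mem_c mem_d that
      norm_prod_squared[of "\<tau>1 (d l, e l)"] norm_prod_squared[of "(d l, e l)"]
    by (auto simp: p_def e1_def)
  have energy_C: "(norm (ym l))\<^sup>2 + (norm (q l))\<^sup>2 = (norm (xm l))\<^sup>2 + (norm (p l))\<^sup>2" if "l \<in> L" for l
    unfolding \<tau>1(3)[rule_format, OF that] q_def p_def[symmetric] by (rule C.julia_norm)

  \<comment> \<open>Subtracting all balances from that of T leaves only the outputs:
    \<open>l\<close> determines \<open>g l\<close> and the end of the cascade with equal
    norms.\<close>
  have g_norm: "norm (g l) = norm (q l, e1 l)" if "l \<in> L" for l
  proof -
    have "(norm (g l))\<^sup>2 = (norm (q l, e1 l))\<^sup>2"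
      using energy[of l] energy_W[OF that] energy_S[OF that] energy_\<tau>2[OF that] energy_N[OF that]
        energy_\<tau>1[OF that] energy_C[OF that]
      by (simp add: norm_prod_squared)
    then show ?thesis
      by (simp add: power2_eq_iff_nonneg)
  qed
  have g_image: "g ` L = T.\<D>s"
  proof
    show "g ` L \<subseteq> T.\<D>s"
      by (auto simp: g_def L_def intro: T.julia_mem)
    show "T.\<D>s \<subseteq> g ` L"
    proof
      fix h assume "h \<in> T.\<D>s"
      then show "h \<in> g ` L"
        using T.julia_surj[of h 0] by (intro image_eqI[of _ _ "(T.R 0 + T.Ds h, T.D 0 - T.Rs h)"])
          (simp_all add: g_def L_def)
    qed
  qed
  \<comment> \<open>Onto by running the cascade backwards from \<open>(q', e1')\<close>: each Julia
    operator reaches any prescribed output by a suitable state and input, and each constant unitary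
    is onto. The three states found on the way can be prescribed independently, so they and the
    input form one element of \<open>L\<close>.\<close>
  have q_image: "(\<lambda>l. (q l, e1 l)) ` L = C.\<D>s \<times> E1"
  proof
    show "(\<lambda>l. (q l, e1 l)) ` L \<subseteq> C.\<D>s \<times> E1"
      using mem_q mem_p by auto
    show "C.\<D>s \<times> E1 \<subseteq> (\<lambda>l. (q l, e1 l)) ` L"
    proof (rule subsetI, clarify)
      fix q' e1' assume "q' \<in> C.\<D>s" "e1' \<in> E1"
      obtain xm' p' where p': "p' \<in> C.\<D>" "C.Ds xm' - C.R p' = q'"
        using C.julia_surj[OF \<open>q' \<in> C.\<D>s\<close>, of 0] by blast
      have "(p', e1') \<in> \<tau>1 ` (N.\<D>s \<times> E)"
        using unitary_on_image[OF \<tau>1(2)] p'(1) \<open>e1' \<in> E1\<close> by simp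
      then obtain d' e' where d': "d' \<in> N.\<D>s" "e' \<in> E" "\<tau>1 (d', e') = (p', e1')"
        by auto
      obtain x0' c' where c': "c' \<in> N.\<D>" "N.Ds x0' - N.R c' = d'"
        using N.julia_surj[OF \<open>d' \<in> N.\<D>s\<close>, of 0] by blast
      have "(c', e') \<in> \<tau>2 ` (S.\<D>s \<times> E2)"
        using unitary_on_image[OF \<tau>2(3)] c'(1) \<open>e' \<in> E\<close> by simp
      then obtain b' e2' where b': "b' \<in> S.\<D>s" "e2' \<in> E2" "\<tau>2 (b', e2') = (c', e')"
        by auto
      obtain x1' a' where a': "a' \<in> S.\<D>" "S.Ds x1' - S.R a' = b'"
        using S.julia_surj[OF \<open>b' \<in> S.\<D>s\<close>, of 0] by blast
      have "(a', e2') \<in> W ` T.\<D>"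
        using unitary_on_image[OF W(3)] a'(1) \<open>e2' \<in> E2\<close> by simp
      then obtain f' where f': "f' \<in> T.\<D>" "W f' = (a', e2')"
        by auto
      define l where "l = ((x1', x0', xm'), f')"
      have "b l = b'" "e2 l = e2'"
        by (simp_all add: l_def b_def a_def e2_def x1_def f' a')
      then have "d l = d'" "e l = e'"
        by (simp_all add: l_def d_def c_def e_def x0_def b' c')
      then have "q l = q'" "e1 l = e1'"
        by (simp_all add: l_def q_def p_def e1_def xm_def d' p')
      then show "(q', e1') \<in> (\<lambda>l. (q l, e1 l)) ` L"
        using f'(1) by (intro image_eqI[of _ _ l]) (auto simp: l_def L_def)
    qed
  qed
  have "closed_csubspace (C.\<D>s \<times> E1)"
    by (intro closed_csubspace_Times C.closed_csubspace_defect \<tau>1(1))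
  then obtain W1 where W1: "unitary_on T.\<D>s (C.\<D>s \<times> E1) W1" "\<And>l. l \<in> L \<Longrightarrow> W1 (g l) = (q l, e1 l)"
    using isometry_extension[OF L lin_g clinear_on_Pair[OF lin_q lin_e1] g_norm]
      T.csubspace_defect(4)
    unfolding g_image q_image closed_csubspace_def by (metis closure_closed)
  have "cascade W W1 \<tau>1 \<tau>2"
    unfolding cascade_def
  proof (intro allI ballI)
    fix x1' :: 'h1 and x0' :: 'h0 and xm' :: 'hm and f assume f: "f \<in> T.\<D>"
    define l where "l = ((x1', x0', xm'), f)"
    have l: "l \<in> L"
      using f by (simp add: l_def L_def)
    have eqs: "x1' = x1 l" "x0' = x0 l" "xm' = xm l" "f = snd l" "(x1 l, x0 l, xm l) = fst l"
      by (simp_all add: l_def x1_def x0_def xm_def)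
    show "let a = fst (W f); b = S.Ds x1' - S.R a;
         c = fst (\<tau>2 (b, snd (W f))); d = N.Ds x0' - N.R c;
         p = fst (\<tau>1 (d, snd (\<tau>2 (b, snd (W f))))); q = C.Ds xm' - C.R p;
         y = T.Rs (x1', x0', xm') + T.D f
     in (\<chi> i. fst (y $ i)) = S.Rs x1' + S.D a \<and>
        (\<chi> i. fst (snd (y $ i))) = N.Rs x0' + N.D c \<and>
        (\<chi> i. snd (snd (y $ i))) = C.Rs xm' + C.D p \<and>
        W1 (T.Ds (x1', x0', xm') - T.R f) = (q, snd (\<tau>1 (d, snd (\<tau>2 (b, snd (W f))))))"
      unfolding Let_def eqs(1-3) eqs(5) unfolding eqs(4)
        a_def[symmetric] e2_def[symmetric] b_def[symmetric] c_def[symmetric] e_def[symmetric]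
        d_def[symmetric] p_def[symmetric] e1_def[symmetric] q_def[symmetric]
        out_def[symmetric] g_def[symmetric] y1_def[symmetric] y0_def[symmetric] ym_def[symmetric]
      using W(4)[rule_format, OF l] \<tau>2(4)[rule_format, OF l] \<tau>1(3)[rule_format, OF l] W1(2)[OF l]
      by (simp add: a_def c_def p_def)
  qed
  then show thesis
    using that[OF \<tau>1(1) W(1) \<tau>2(1) W(3) W1(1) \<tau>1(2) \<tau>2(3)] by blast
qed

end

theorem theorem4p3:
  fixes T :: "'n::finite \<Rightarrow> 'h1::chilbert_space \<times> 'h0::chilbert_space \<times> 'hm::chilbert_space
                \<Rightarrow> 'h1 \<times> 'h0 \<times> 'hm"
    and S :: "'n \<Rightarrow> 'h1 \<Rightarrow> 'h1" and N :: "'n \<Rightarrow> 'h0 \<Rightarrow> 'h0" and C :: "'n \<Rightarrow> 'hm \<Rightarrow> 'hm"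
    and X :: "'n \<Rightarrow> 'h0 \<Rightarrow> 'h1" and Y :: "'n \<Rightarrow> 'hm \<Rightarrow> 'h1" and Z :: "'n \<Rightarrow> 'hm \<Rightarrow> 'h0"
  assumes "row_contraction T"
    and "\<And>i. bounded_clinear (S i)" "\<And>i. bounded_clinear (N i)" "\<And>i. bounded_clinear (C i)"
    and "\<And>i. bounded_clinear (X i)" "\<And>i. bounded_clinear (Y i)" "\<And>i. bounded_clinear (Z i)"
    and "\<And>i x y z. T i (x, y, z) = (S i x + X i y + Y i z, N i y + Z i z, C i z)"
  shows "row_contraction S \<and> row_contraction N \<and> row_contraction C \<and>
    (\<exists>(E\<^sub>1 :: ('n, 'h1 \<times> 'h0 \<times> 'hm) aux set) (E\<^sub>2 :: ('n, 'h1 \<times> 'h0 \<times> 'hm) aux set)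
        (E :: ('n, 'h1 \<times> 'h0 \<times> 'hm) aux set) \<tau>\<^sub>1 \<tau>\<^sub>2.
       closed_csubspace E\<^sub>1 \<and> closed_csubspace E\<^sub>2 \<and> closed_csubspace E \<and>
       unitary_on (defect_space_star N \<times> E) (defect_space C \<times> E\<^sub>1) \<tau>\<^sub>1 \<and>
       unitary_on (defect_space_star S \<times> E\<^sub>2) (defect_space N \<times> E) \<tau>\<^sub>2 \<and>
       coincide (defect_space T) (defect_space_star T) (char_fun T)
         (defect_space S \<times> E\<^sub>2) (defect_space_star C \<times> E\<^sub>1)
         (fock_diag (char_fun C) id \<circ> fock_map \<tau>\<^sub>1 \<circ> fock_diag (char_fun N) id \<circ>
          fock_map \<tau>\<^sub>2 \<circ> fock_diag (char_fun S) id))"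
proof -
  interpret block_row_contraction T S N C X Y Z
    by unfold_locales (fact assms)+
  obtain E1 E2 E :: "('n, 'h1 \<times> 'h0 \<times> 'hm) aux set" and W W1 \<tau>1 \<tau>2 where
    E: "closed_csubspace E1" "closed_csubspace E2" "closed_csubspace E"
    and W: "unitary_on T.\<D> (S.\<D> \<times> E2) W" and W1: "unitary_on T.\<D>s (C.\<D>s \<times> E1) W1"
    and \<tau>1: "unitary_on (N.\<D>s \<times> E) (C.\<D> \<times> E1) \<tau>1" and \<tau>2: "unitary_on (S.\<D>s \<times> E2) (N.\<D> \<times> E) \<tau>2"
    and casc: "cascade W W1 \<tau>1 \<tau>2"
    by (rule cascade_exists)
  note fst_snd = Rep_fock_map_UNIV[OF bounded_clinearI[OF bounded_linear_fst]]
    Rep_fock_map_UNIV[OF bounded_clinearI[OF bounded_linear_snd]]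
  have "(fock_diag (char_fun C) id \<circ> fock_map \<tau>1 \<circ> fock_diag (char_fun N) id \<circ>
      fock_map \<tau>2 \<circ> fock_diag (char_fun S) id) (fock_map W f) = fock_map W1 (char_fun T f)"
    if f: "f \<in> fock_of T.\<D>" for f
  proof -
    define h1 where "h1 = fock_map W f"
    define h2 where "h2 = fock_diag (char_fun S) id h1"
    define h3 where "h3 = fock_map \<tau>2 h2"
    define h4 where "h4 = fock_diag (char_fun N) id h3"
    define h5 where "h5 = fock_map \<tau>1 h4"
    define h6 where "h6 = fock_diag (char_fun C) id h5"
    define x where "x = T.state 1 (Rep_ell2 f)"
    define x1 where "x1 = S.state 1 (Rep_ell2 (fock_map fst h1))"
    define x0 where "x0 = N.state 1 (Rep_ell2 (fock_map fst h3))"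
    define xm where "xm = C.state 1 (Rep_ell2 (fock_map fst h5))"
    have fmem: "Rep_ell2 f w \<in> T.\<D>" for w
      using f by (simp add: fock_of_def)
    have h1: "Rep_ell2 h1 w = W (Rep_ell2 f w)" "Rep_ell2 h1 w \<in> S.\<D> \<times> E2" for w
      using fock_map_mem[OF W f] by (auto simp: h1_def fock_of_def)
    have h2: "Rep_ell2 h2 w = (S.Ds (x1 w) - S.R (fst (W (Rep_ell2 f w))), snd (W (Rep_ell2 f w)))" for w
      by (simp add: h2_def Rep_fock_diag S.Rep_char_fun x1_def fst_snd scaleC_prod_def h1)
    have "h2 \<in> fock_of (S.\<D>s \<times> E2)"
      using h1 by (auto simp: fock_of_def h2 mem_Times_iff intro!: S.julia_mem)
    from fock_map_mem[OF \<tau>2 this]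
    have h3: "Rep_ell2 h3 w = \<tau>2 (Rep_ell2 h2 w)" "Rep_ell2 h3 w \<in> N.\<D> \<times> E" for w
      by (auto simp: h3_def fock_of_def)
    have h4: "Rep_ell2 h4 w = (N.Ds (x0 w) - N.R (fst (Rep_ell2 h3 w)), snd (Rep_ell2 h3 w))" for w
      by (simp add: h4_def Rep_fock_diag N.Rep_char_fun x0_def fst_snd scaleC_prod_def)
    have "h4 \<in> fock_of (N.\<D>s \<times> E)"
      using h3(2) by (auto simp: fock_of_def h4 mem_Times_iff intro!: N.julia_mem)
    from fock_map_mem[OF \<tau>1 this]
    have h5: "Rep_ell2 h5 w = \<tau>1 (Rep_ell2 h4 w)" for w
      by (auto simp: h5_def)
    have h6: "Rep_ell2 h6 w = (C.Ds (xm w) - C.R (fst (Rep_ell2 h5 w)), snd (Rep_ell2 h5 w))" for w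
      by (simp add: h6_def Rep_fock_diag C.Rep_char_fun xm_def fst_snd scaleC_prod_def)
    have step: "(\<chi> i. fst ((T.Rs (x1 w, x0 w, xm w) + T.D (Rep_ell2 f w)) $ i)) = S.Rs (x1 w) + S.D (fst (Rep_ell2 h1 w))"
      "(\<chi> i. fst (snd ((T.Rs (x1 w, x0 w, xm w) + T.D (Rep_ell2 f w)) $ i))) = N.Rs (x0 w) + N.D (fst (Rep_ell2 h3 w))"
      "(\<chi> i. snd (snd ((T.Rs (x1 w, x0 w, xm w) + T.D (Rep_ell2 f w)) $ i))) = C.Rs (xm w) + C.D (fst (Rep_ell2 h5 w))"
      "W1 (T.Ds (x1 w, x0 w, xm w) - T.R (Rep_ell2 f w)) = Rep_ell2 h6 w" for w
      using casc[unfolded cascade_def Let_def, THEN spec[of _ "x1 w"], THEN spec[of _ "x0 w"],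
          THEN spec[of _ "xm w"], THEN bspec, OF fmem[of w]]
      by (simp_all add: h1 h2 h3 h4 h5 h6)
    \<comment> \<open>All four systems start at 0, and at each word the cascade equations say that
      one step of T is the triple of the steps of S, N and C. Hence the state of T is the triple of
      their states, and the last cascade equation compares the outputs.\<close>
    have "x w = (x1 w, x0 w, xm w)" for w
    proof (induction w rule: rev_induct)
      case Nil
      show ?case
        by (simp add: x_def x1_def x0_def xm_def zero_prod_def)
    next
      case (snoc i w)
      have "x (w @ [i]) = (T.Rs (x w) + T.D (Rep_ell2 f w)) $ i"
        "x1 (w @ [i]) = (S.Rs (x1 w) + S.D (fst (Rep_ell2 h1 w))) $ i"
        "x0 (w @ [i]) = (N.Rs (x0 w) + N.D (fst (Rep_ell2 h3 w))) $ i"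
        "xm (w @ [i]) = (C.Rs (xm w) + C.D (fst (Rep_ell2 h5 w))) $ i"
        by (simp_all only: x_def x1_def x0_def xm_def T.state_snoc S.state_snoc N.state_snoc C.state_snoc
            scaleR_one) (simp_all add: fst_snd scaleC_prod_def)
      then show ?case
        by (simp only: snoc.IH step[symmetric]) (simp add: prod_eq_iff)
    qed
    then have "Rep_ell2 (char_fun T f) w = T.Ds (x1 w, x0 w, xm w) - T.R (Rep_ell2 f w)" for w
      by (simp add: T.Rep_char_fun flip: x_def)
    moreover have "char_fun T f \<in> fock_of T.\<D>s"
      using T.multi_analytic_char_fun f by (auto simp: multi_analytic_def bounded_clinear_on_def)
    ultimately have "Rep_ell2 h6 w = Rep_ell2 (fock_map W1 (char_fun T f)) w" for w
      using fock_map_mem(1)[OF W1, of "char_fun T f" w] step(4)[of w] by simp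
    then show ?thesis
      by (simp add: ell2_eq_iff h1_def h2_def h3_def h4_def h5_def h6_def)
  qed
  then have "coincide T.\<D> T.\<D>s (char_fun T) (S.\<D> \<times> E2) (C.\<D>s \<times> E1)
      (fock_diag (char_fun C) id \<circ> fock_map \<tau>1 \<circ> fock_diag (char_fun N) id \<circ>
        fock_map \<tau>2 \<circ> fock_diag (char_fun S) id)"
    by (rule coincideI[OF T.csubspace_defect(1) T.multi_analytic_char_fun T.csubspace_defect(2) W W1])
  then show ?thesis
    using E \<tau>1 \<tau>2 S.row_contraction N.row_contraction C.row_contraction by blast
qed

end
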